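(* Fix $m\in\mathbb{N}$ and a convex body $K\subset\mathbb{R}^n$. Let $\mu$ be a Borel measure on $\mathbb{R}^n$ with density, strictly positive on $K$, finite on $K$, and $Q$-concave on the (compact) convex subsets of $K$, where $Q:(0,\mu(K)]\to(-\infty,\infty)$ is an increasing and invertible (continuous) function. Then, for $-1<p\le q<\infty$, one has $$C_Q(q,\mu,K)\,R^m_{q,\mu}K\subseteq C_Q(p,\mu,K)\,R^m_{p,\mu}K\subseteq\frac{1}{Q'(\mu(K))}\,\Pi^{\circ,m}_\mu K,$$ where $$C_Q(p,\mu,K)=\begin{cases}\left(\dfrac{p}{\mu(K)}\displaystyle\int_0^\infty Q^{-1}\big[Q(\mu(K))-t\big]t^{p-1}\,dt\right)^{-\frac1p}&\text{for }p>0,\\[3mm]\left(\dfrac{p}{\mu(K)}\displaystyle\int_0^\infty t^{p-1}\big(Q^{-1}\big[Q(\mu(K))-t\big]-\mu(K)\big)\,dt\right)^{-\frac1p}&\text{for }p\in(-1,0),\end{cases}$$ and, for the second set inclusion, it is additionally assumed that $\mu\in\mathcal{M}(K)$ and that $Q$ is differentiable at $\mu(K)$ (with $Q'(\mu(K))>0$, so that the expression is defined). In particular, if $\mu$ is log-concave, then (the second inclusion again under $\mu\in\mathcal{M}(K)$) $$\frac{1}{\Gamma(1+q)^{\frac1q}}R^m_{q,\mu}K\subseteq\frac{1}{\Gamma(1+p)^{\frac1p}}R^m_{p,\mu}K\subseteq\mu(K)\,\Pi^{\circ,m}_\mu K,$$ where $\lim_{p\to0}\Gamma(1+p)^{-1/p}R^m_{p,\mu}K$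 is interpreted via continuity.
   Context: A convex body is a compact convex set with nonempty interior; $\mathbb{R}^{nm}=(\mathbb{R}^n)^m$, with unit sphere $\mathbb{S}^{nm-1}$. "Density" means locally integrable density with respect to Lebesgue measure. $\mu$ is $Q$-concave on a class of compact sets if $\mu(\tau A+(1-\tau)B)\ge Q^{-1}\big(\tau Q(\mu(A))+(1-\tau)Q(\mu(B))\big)$ for all $A,B$ in the class with positive measure and $\tau\in[0,1]$; log-concave is the case $Q=\log$. Convention: if $Q$ is bounded below, then $Q^{-1}(u)=0$ for $u$ below the range of $Q$. The derivative at the endpoint $\mu(K)$ is the left derivative. Constants and bodies at $p=0$ (or $q=0$) are defined by continuity (limit $p\to0$). Radial function: $\rho_L(y)=\sup\{\tau:\tau y\in L\}$. For $p>-1$, $p\ne0$, $R^m_{p,\mu}K\subset\mathbb{R}^{nm}$ is the star body with radial function, for $\bar\theta=(\theta_1,\dots,\theta_m)\in\mathbb{S}^{nm-1}$, $$\rho_{R^m_{p,\mu}K}(\bar\theta)^p=\frac1{\mu(K)}\int_K\Big(\min_{1\le i\le m}\rho_{K-x}(-\theta_i)\Big)^p d\mu(x).$$ $\mathcal{M}(K)$ is the class of Radon (locally finite, regular Borel) measures $\mu$ on $\mathbb{R}^n$ having a density $\phi:\mathbb{R}^n\to[0,\infty)$, $\phi\in L^1_{\rm loc}$, whose support contains $K$, and such that $\partial K$ is contained in the Lebesgue set of $\phi$; on $\partial K$, $\phi$ is the representative given by the Lebesgue differentiation theorem. For $\mu\in\mathcal{M}(K)$, $\Pi^m_\mu K\subset\mathbb{R}^{nm}$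 is the convex body with support function $$h_{\Pi^m_\mu K}(x_1,\dots,x_m)=\int_{\partial K}\max_{1\le i\le m}\langle x_i,n_K(y)\rangle_-\,\phi(y)\,d\mathcal{H}^{n-1}(y),$$ where $a_-=-\min(a,0)$ and $n_K(y)$ is the outer unit normal at $y$; $\Pi^{\circ,m}_\mu K=(\Pi^m_\mu K)^\circ=\{\bar x:h_{\Pi^m_\mu K}(\bar x)\le1\}$. *)

theory Defs
  imports "HOL-Analysis.Analysis"
begin

definition convex_body :: "'a::euclidean_space set \<Rightarrow> bool" where
  "convex_body K \<longleftrightarrow> compact K \<and> convex K \<and> interior K \<noteq> {}"

section \<open>Extended-valued powers, dilations and extension by continuity\<close>

text \<open>Radial functions and the constants below may a priori take the values 0 and infinity, so
  they live in \<^typ>\<open>ennreal\<close>; a negative power exchanges these two values.\<close>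

definition epowr :: "ennreal \<Rightarrow> real \<Rightarrow> ennreal" where
  "epowr a p =
     (if p = 0 then 1
      else if a = 0 then (if p < 0 then \<infinity> else 0)
      else if a = \<infinity> then (if p < 0 then 0 else \<infinity>)
      else ennreal (enn2real a powr p))"

text \<open>The dilate of a set by a factor in [0, infinity]. The infinite dilate of a star body about the
  origin is the whole space.\<close>

definition dilate :: "ennreal \<Rightarrow> 'a::real_vector set \<Rightarrow> 'a set" where
  "dilate c L = (if c = \<infinity> then UNIV else (\<lambda>x. enn2real c *\<^sub>R x) ` L)"

text \<open>The value at 0 is the limit. The limit is taken from the right so that it exists for all the
  functions of \<^term>\<open>p\<close> below (they are monotone in \<^term>\<open>p\<close>) even where a constant degenerates
  for negative \<^term>\<open>p\<close>; it is the two-sided limit as soon as the latter exists.\<close>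

definition extend_at_0 :: "(real \<Rightarrow> 'a::t2_space) \<Rightarrow> real \<Rightarrow> 'a" where
  "extend_at_0 f p = (if p = 0 then Lim (at_right 0) f else f p)"

lemma extend_at_0_eq_limit:
  assumes "(f \<longlongrightarrow> l) (at 0)"
  shows "extend_at_0 f 0 = l"
proof -
  have "(f \<longlongrightarrow> l) (at_right 0)"
    using assms by (simp add: filterlim_at_split)
  then show ?thesis
    unfolding extend_at_0_def by (simp add: tendsto_Lim)
qed

section \<open>Measures with density and concave measures\<close>

definition has_loc_density :: "'a::euclidean_space measure \<Rightarrow> ('a \<Rightarrow> real) \<Rightarrow> bool" where
  "has_loc_density \<mu> \<phi> \<longleftrightarrow>
     \<phi> \<in> borel_measurable borel \<and> (\<forall>x. 0 \<le> \<phi> x) \<and>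
     (\<forall>C. compact C \<longrightarrow> set_integrable lborel C \<phi>) \<and>
     \<mu> = density lborel (\<lambda>x. ennreal (\<phi> x))"

text \<open>The inverse of the increasing function \<^term>\<open>Q\<close> on (0, M], extended by 0 to arguments below
  its range. It is only used at arguments not exceeding \<^term>\<open>Q M\<close>.\<close>

definition Q_inv :: "(real \<Rightarrow> real) \<Rightarrow> real \<Rightarrow> real \<Rightarrow> real" where
  "Q_inv Q M u = (if u \<in> Q ` {0<..M} then inv_into {0<..M} Q u else 0)"

definition minkowski_comb :: "real \<Rightarrow> 'a::real_vector set \<Rightarrow> 'a set \<Rightarrow> 'a set" where
  "minkowski_comb \<tau> A B = {\<tau> *\<^sub>R a + (1 - \<tau>) *\<^sub>R b | a b. a \<in> A \<and> b \<in> B}"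

text \<open>Here \<^term>\<open>M\<close> is the right endpoint of the domain (0, M] of \<^term>\<open>Q\<close>.\<close>

definition Q_concave_on ::
  "(real \<Rightarrow> real) \<Rightarrow> real \<Rightarrow> 'a::euclidean_space set set \<Rightarrow> 'a measure \<Rightarrow> bool" where
  "Q_concave_on Q M \<C> \<mu> \<longleftrightarrow>
     (\<forall>A\<in>\<C>. \<forall>B\<in>\<C>. \<forall>\<tau>\<in>{0..1}. 0 < emeasure \<mu> A \<and> 0 < emeasure \<mu> B \<longrightarrow>
        measure \<mu> (minkowski_comb \<tau> A B)
          \<ge> Q_inv Q M (\<tau> * Q (measure \<mu> A) + (1 - \<tau>) * Q (measure \<mu> B)))"

definition compact_convex_subsets :: "'a::euclidean_space set \<Rightarrow> 'a set set" where
  "compact_convex_subsets K = {A. A \<subseteq> K \<and> compact A \<and> convex A}"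

definition measure_support :: "'a::topological_space measure \<Rightarrow> 'a set" where
  "measure_support \<mu> = {x. \<forall>U. open U \<and> x \<in> U \<longrightarrow> 0 < emeasure \<mu> U}"

text \<open>Lebesgue points of the representative \<^term>\<open>\<phi>\<close>: its value at such a point is the limit of
  its averages over small balls, as in the Lebesgue differentiation theorem.\<close>

definition lebesgue_set :: "('a::euclidean_space \<Rightarrow> real) \<Rightarrow> 'a set" where
  "lebesgue_set \<phi> =
     {y. ((\<lambda>r. (LINT z:ball y r|lborel. \<bar>\<phi> z - \<phi> y\<bar>) / measure lborel (ball y r))
            \<longlongrightarrow> 0) (at_right 0)}"

text \<open>Membership in M(K), with the representative \<^term>\<open>\<phi>\<close> of the density made explicit. The support
  of a locally integrable density, defined up to null sets, is the support of the measure.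
  A measure with locally integrable density is automatically Radon.\<close>

definition class_M :: "'a::euclidean_space set \<Rightarrow> 'a measure \<Rightarrow> ('a \<Rightarrow> real) \<Rightarrow> bool" where
  "class_M K \<mu> \<phi> \<longleftrightarrow>
     has_loc_density \<mu> \<phi> \<and> K \<subseteq> measure_support \<mu> \<and> frontier K \<subseteq> lebesgue_set \<phi>"

section \<open>Hausdorff measure\<close>

text \<open>The Hausdorff measure of integer dimension \<^term>\<open>d\<close>, normalized to agree with Lebesgue measure
  when \<^term>\<open>d\<close> is the dimension of the space. The empty set is singled out because a power with
  exponent 0 is 1, as it must be for nonempty sets of diameter 0 (for \<^term>\<open>d = 0\<close> one gets the counting
  measure). The outer measure is a metric outer measure, hence countably additive on Borel sets.\<close>

definition hausdorff_weight :: "nat \<Rightarrow> 'a::metric_space set \<Rightarrow> ennreal" where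
  "hausdorff_weight d U =
     (if U = {} then 0 else ennreal (unit_ball_vol (real d) * (diameter U / 2) ^ d))"

definition hausdorff_pre :: "nat \<Rightarrow> real \<Rightarrow> 'a::metric_space set \<Rightarrow> ennreal" where
  "hausdorff_pre d \<delta> A =
     (INF U \<in> {U :: nat \<Rightarrow> 'a set. A \<subseteq> (\<Union>i. U i) \<and> (\<forall>i. bounded (U i) \<and> diameter (U i) \<le> \<delta>)}.
        \<Sum>i. hausdorff_weight d (U i))"

definition hausdorff_outer :: "nat \<Rightarrow> 'a::metric_space set \<Rightarrow> ennreal" where
  "hausdorff_outer d A = (SUP \<delta> \<in> {0<..}. hausdorff_pre d \<delta> A)"

definition hausdorff_measure :: "nat \<Rightarrow> 'a::metric_space measure" where
  "hausdorff_measure d = measure_of UNIV (sets borel) (hausdorff_outer d)"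

section \<open>Radial mean bodies and polar projection bodies of higher order\<close>

text \<open>The space of \<^term>\<open>m\<close>-tuples of vectors is \<^typ>\<open>real^'n^'m\<close>, whose norm is the Euclidean
  norm.\<close>

text \<open>The supremum is infinite at \<^term>\<open>y = 0\<close> when \<^term>\<open>0 \<in> L\<close>; this is needed below, since some
  (not all) of the components of a unit vector of \<^typ>\<open>real^'n^'m\<close> may vanish. Negative \<^term>\<open>\<tau>\<close>
  contribute \<^term>\<open>ennreal \<tau> = 0\<close>, which is harmless since all sets used contain the origin.\<close>

definition radial_fun :: "'a::real_vector set \<Rightarrow> 'a \<Rightarrow> ennreal" where
  "radial_fun L y = (SUP \<tau> \<in> {\<tau>::real. \<tau> *\<^sub>R y \<in> L}. ennreal \<tau>)"

definition star_body :: "('a::real_normed_vector \<Rightarrow> ennreal) \<Rightarrow> 'a set" where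
  "star_body \<rho> = {t *\<^sub>R \<theta> | t \<theta>. norm \<theta> = 1 \<and> 0 \<le> t \<and> ennreal t \<le> \<rho> \<theta>}"

definition radial_mean ::
  "(real^'n) measure \<Rightarrow> (real^'n) set \<Rightarrow> (real^'n)^'m \<Rightarrow> real \<Rightarrow> ennreal" where
  "radial_mean \<mu> K \<theta> p =
     epowr ((\<integral>\<^sup>+x\<in>K. epowr (INF i. radial_fun ((\<lambda>y. y - x) ` K) (- (\<theta> $ i))) p \<partial>\<mu>)
              / emeasure \<mu> K) (1 / p)"

definition radial_mean_body ::
  "real \<Rightarrow> (real^'n) measure \<Rightarrow> (real^'n) set \<Rightarrow> ((real^'n)^'m) set" where
  "radial_mean_body p \<mu> K = star_body (\<lambda>\<theta>. extend_at_0 (radial_mean \<mu> K \<theta>) p)"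

text \<open>The outer unit normal is unique at almost every boundary point of a convex body with
  respect to the (n-1)-dimensional Hausdorff measure.\<close>

definition outer_normal :: "'a::euclidean_space set \<Rightarrow> 'a \<Rightarrow> 'a" where
  "outer_normal K y = (THE u. norm u = 1 \<and> (\<forall>x\<in>K. u \<bullet> (x - y) \<le> 0))"

definition neg_part :: "real \<Rightarrow> real" where
  "neg_part a = - min a 0"

definition proj_support :: "(real^'n \<Rightarrow> real) \<Rightarrow> (real^'n) set \<Rightarrow> (real^'n)^'m \<Rightarrow> ennreal" where
  "proj_support \<phi> K x =
     (\<integral>\<^sup>+y\<in>frontier K.
        ennreal (Max (range (\<lambda>i. neg_part ((x $ i) \<bullet> outer_normal K y))) * \<phi> y)
        \<partial>hausdorff_measure (CARD('n) - 1))"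

definition polar_proj_body :: "(real^'n \<Rightarrow> real) \<Rightarrow> (real^'n) set \<Rightarrow> ((real^'n)^'m) set" where
  "polar_proj_body \<phi> K = {x. proj_support \<phi> K x \<le> 1}"

section \<open>The constants\<close>

text \<open>For negative \<^term>\<open>p\<close> the integrand, including the factor \<^term>\<open>p\<close>, is the product of two
  nonpositive factors. Divergent integrals have the value infinity.\<close>

definition C_const_nz :: "(real \<Rightarrow> real) \<Rightarrow> 'a measure \<Rightarrow> 'a set \<Rightarrow> real \<Rightarrow> ennreal" where
  "C_const_nz Q \<mu> K p =
     (let M = measure \<mu> K in
      if p > 0 then
        epowr (\<integral>\<^sup>+t\<in>{0<..}. ennreal (p / M * (Q_inv Q M (Q M - t) * t powr (p - 1))) \<partial>lborel)
          (- 1 / p)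
      else
        epowr (\<integral>\<^sup>+t\<in>{0<..}. ennreal (p / M * (t powr (p - 1) * (Q_inv Q M (Q M - t) - M))) \<partial>lborel)
          (- 1 / p))"

definition C_const :: "(real \<Rightarrow> real) \<Rightarrow> real \<Rightarrow> 'a measure \<Rightarrow> 'a set \<Rightarrow> ennreal" where
  "C_const Q p \<mu> K = extend_at_0 (C_const_nz Q \<mu> K) p"

definition gamma_const :: "real \<Rightarrow> real" where
  "gamma_const p = extend_at_0 (\<lambda>p. 1 / Gamma (1 + p) powr (1 / p)) p"

end

theory Submission
  imports Defs
begin

text \<open>
  For a unit vector \<open>\<theta>\<close> let \<open>g(r)\<close> be the measure of the points \<open>x\<close> of \<open>K\<close> with all
  \<open>x - r \<theta>\<^sub>i\<close> in \<open>K\<close>. The radial function of \<open>R\<^sub>p\<close> is the \<open>L\<^sup>p\<close> mean of the random variable with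
  survival function \<open>g / M\<close>, where \<open>M = \<mu>(K)\<close>, and \<open>1 / C(p)\<close> is the mean belonging to
  \<open>\<psi>(t) = Q\<^sup>-\<^sup>1(Q(M) - t)\<close>. Concavity of \<open>Q \<circ> g\<close> says that \<open>g\<close> crosses every dilate
  \<open>\<psi>(r / \<lambda>)\<close> at most once, from above. If the dilate is chosen with equal \<open>p\<close>-means, the
  crossing decides the order of the \<open>q\<close>-means for \<open>q > p\<close>, which is the first inclusion.

  The second inclusion needs only one inequality between the boundary integral \<open>h(\<theta>)\<close> and the
  decay of \<open>g\<close>, namely \<open>h(\<theta>) \<le> liminf (M - g(r)) / r\<close>: by the crossing property it implies
  \<open>g(r) \<le> \<psi>(Q'(M) h(\<theta>) r)\<close>. To prove it, the boundary points that are entered in direction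
  \<open>\<theta>\<^sub>i\<close> carry the measure \<open>\<nu>\<^sub>i\<close> given by the volume of the cylinders \<open>E + [0, 1) \<theta>\<^sub>i\<close>. Comparing lower
  densities, \<open>\<langle>\<theta>\<^sub>i, n\<rangle>\<^sub>-\<close> times the Hausdorff measure is at most \<open>\<nu>\<^sub>i\<close>; and averaging the density over balls of
  radius comparable to \<open>r\<close>, together with Fatou's lemma, bounds the \<open>\<nu>\<^sub>i\<close>-integrals by the mass of
  the shell of thickness \<open>r\<close>.
\<close>

section \<open>Means of nonincreasing functions\<close>

text \<open>Single crossing has a simple source: \<open>Q\<close> turns the dilate
  \<open>\<psi>(r / \<lambda>)\<close> into the straight line \<open>Q(M) - r / \<lambda>\<close>,
  which starts at the same value as the concave function \<open>Q \<circ> g\<close>. For the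
  boundary layer only a lower bound is wanted, so every approximation may lose mass: boundary pieces
  are replaced by compact subsets, and only part of the shell is seen. The obstacle is that \<phi>
  is controlled on the boundary only through averages over balls and need not have limits along
  individual lines. Its value at \<open>y\<close> is therefore compared with its average over a tube
  of radius \<open>r\<close> about the line through \<open>y\<close>, cut off at parameter
  \<open>r\<close> after entry. The volume of that region is known exactly, because slabs given by
  two different height functions are fundamental domains of the same translations. Means and
  constants take values in [0, infinity], since for negative \<open>p\<close> and general
  \<open>Q\<close> the constant can be infinite; the exponent 0 is reached as a monotone limit from
  the right.\<close>

lemma epowr_ennreal: "0 < r \<Longrightarrow> epowr (ennreal r) x = ennreal (r powr x)"
  by (auto simp: epowr_def)

lemma epowr_0: "x \<noteq> 0 \<Longrightarrow> epowr 0 x = (if x < 0 then \<infinity> else 0)"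
  by (auto simp: epowr_def)

lemma epowr_top: "x \<noteq> 0 \<Longrightarrow> epowr \<infinity> x = (if x < 0 then 0 else \<infinity>)" "x \<noteq> 0 \<Longrightarrow> epowr top x = (if x < 0 then 0 else \<infinity>)"
  by (auto simp: epowr_def)

lemma ennreal_cases_pos:
  obtains "a = 0" | "a = \<infinity>" | r where "0 < r" "a = ennreal r"
  by (cases a) (auto simp: le_less)

lemma epowr_uminus: "x \<noteq> 0 \<Longrightarrow> epowr a (- x) = inverse (epowr a x)"
  by (cases a rule: ennreal_cases_pos)
    (auto simp: epowr_ennreal epowr_0 epowr_top inverse_ennreal powr_minus)

lemma epowr_mono: "0 < x \<Longrightarrow> a \<le> b \<Longrightarrow> epowr a x \<le> epowr b x"
  by (cases a rule: ennreal_cases_pos; cases b rule: ennreal_cases_pos)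
    (auto simp: epowr_ennreal epowr_0 epowr_top top_unique intro!: ennreal_leI powr_mono2)

lemma ennreal_inverse_antimono:
  fixes a b :: ennreal assumes "a \<le> b" shows "inverse b \<le> inverse a"
  using assms by (cases a rule: ennreal_cases_pos; cases b rule: ennreal_cases_pos)
    (auto simp: inverse_ennreal top_unique intro!: ennreal_leI le_imp_inverse_le)

lemma epowr_antimono:
  assumes "x < 0" "a \<le> b" shows "epowr b x \<le> epowr a x"
proof -
  have "inverse (epowr b (- x)) \<le> inverse (epowr a (- x))"
    using epowr_mono[of "- x" a b] assms by (auto intro: ennreal_inverse_antimono)
  then show ?thesis using assms epowr_uminus[of "- x"] by simp
qed

lemma epowr_inverse_exponent: "x \<noteq> 0 \<Longrightarrow> epowr (epowr a x) (1 / x) = a"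
  by (cases a rule: ennreal_cases_pos)
    (auto simp: epowr_ennreal epowr_0 epowr_top powr_powr)

lemma epowr_inverse_exponent': "x \<noteq> 0 \<Longrightarrow> epowr (epowr a (1 / x)) x = a"
  using epowr_inverse_exponent[of "1 / x" a] by simp

lemma epowr_mult_ennreal:
  assumes "x \<noteq> 0" "0 < c"
  shows "epowr (ennreal c * a) x = ennreal (c powr x) * epowr a x"
proof (cases a rule: ennreal_cases_pos)
  case 1 then show ?thesis using assms by (auto simp: epowr_0 ennreal_mult_top)
next
  case 2 then show ?thesis using assms by (auto simp: epowr_top ennreal_mult_top)
next
  case (3 r)
  then show ?thesis using assms
    by (simp add: epowr_ennreal ennreal_mult'[symmetric] powr_mult)
qed

text \<open>For negative \<open>p\<close> the layer cake formula uses the distribution function in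
  place of the survival function, hence \<open>h t - M\<close>. The integrands are spelled as in
  \<open>C_const_nz\<close>, so that unfolding identifies the constant with the inverse of a
  mean.\<close>

definition moment_int :: "real \<Rightarrow> (real \<Rightarrow> real) \<Rightarrow> real \<Rightarrow> ennreal" where
  "moment_int M h p =
     (if p > 0 then \<integral>\<^sup>+t\<in>{0<..}. ennreal (p / M * (h t * t powr (p - 1))) \<partial>lborel
      else \<integral>\<^sup>+t\<in>{0<..}. ennreal (p / M * (t powr (p - 1) * (h t - M))) \<partial>lborel)"

text \<open>This is the \<open>L\<^sup>p\<close> norm of a random variable whose survival function is \<^term>\<open>\<lambda>t. h t / M\<close>.\<close>

definition profile_mean :: "real \<Rightarrow> (real \<Rightarrow> real) \<Rightarrow> real \<Rightarrow> ennreal" where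
  "profile_mean M h p = epowr (moment_int M h p) (1 / p)"

text \<open>Arguments \<open>t \<le> 0\<close> are left free: the integrals do not see them, and the
  level sets of the radial function are described only for positive levels.\<close>

definition profile :: "real \<Rightarrow> (real \<Rightarrow> real) \<Rightarrow> bool" where
  "profile M h \<longleftrightarrow> (\<forall>t>0. 0 \<le> h t \<and> h t \<le> M) \<and> (\<forall>s>0. \<forall>t\<ge>s. h t \<le> h s)"

text \<open>Since \<open>ennreal\<close> truncates at 0, this is the integral of the positive part
  of \<open>f\<close>. Both signs of a difference \<open>g - h\<close> can thus be handled
  separately without integrability.\<close>

definition weighted_int :: "real \<Rightarrow> (real \<Rightarrow> real) \<Rightarrow> ennreal" where
  "weighted_int p f = (\<integral>\<^sup>+t\<in>{0<..}. ennreal (t powr (p - 1)) * ennreal (f t) \<partial>lborel)"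

lemma weighted_int_cmult:
  assumes "set_borel_measurable borel {0<..} f" "0 \<le> c"
  shows "(\<integral>\<^sup>+t\<in>{0<..}. ennreal (c * t powr (p - 1)) * ennreal (f t) \<partial>lborel) = ennreal c * weighted_int p f"
proof -
  define F where "F t = ennreal (indicator {0<..} t * f t)" for t
  have [measurable]: "F \<in> borel_measurable borel"
    using assms(1) unfolding set_borel_measurable_def F_def[abs_def] real_scaleR_def
    by (rule measurable_compose[OF _ measurable_ennreal])
  have F: "ennreal (f t) * indicator {0<..} t = F t" for t
    by (auto simp: F_def indicator_def)
  have "(\<integral>\<^sup>+t\<in>{0<..}. ennreal (c * t powr (p - 1)) * ennreal (f t) \<partial>lborel) = (\<integral>\<^sup>+t. ennreal c * (ennreal (t powr (p - 1)) * F t) \<partial>lborel)"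
    using assms(2) by (intro nn_integral_cong) (simp add: F[symmetric] ennreal_mult' mult_ac)
  also have "\<dots> = ennreal c * (\<integral>\<^sup>+t. ennreal (t powr (p - 1)) * F t \<partial>lborel)"
    by (intro nn_integral_cmult) measurable
  also have "(\<integral>\<^sup>+t. ennreal (t powr (p - 1)) * F t \<partial>lborel) = weighted_int p f"
    unfolding weighted_int_def by (intro nn_integral_cong) (simp add: F[symmetric] mult_ac)
  finally show ?thesis .
qed

lemma set_borel_measurable_diff:
  fixes f g :: "'a \<Rightarrow> real"
  assumes "set_borel_measurable M A f" "set_borel_measurable M A g"
  shows "set_borel_measurable M A (\<lambda>t. f t - g t)"
  using borel_measurable_diff[OF assms[unfolded set_borel_measurable_def]]
  unfolding set_borel_measurable_def by (simp add: algebra_simps)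

lemma set_borel_measurable_const_real:
  "set_borel_measurable borel {0<..} (\<lambda>_::real. c :: real)"
  unfolding set_borel_measurable_def by measurable

lemma moment_int_pos:
  assumes "p > 0" "M > 0" "set_borel_measurable borel {0<..} h"
  shows "moment_int M h p = ennreal (p / M) * weighted_int p h"
proof -
  have "moment_int M h p = (\<integral>\<^sup>+t\<in>{0<..}. ennreal (p / M * t powr (p - 1)) * ennreal (h t) \<partial>lborel)"
  proof -
    have "ennreal (p / M * (h t * t powr (p - 1))) = ennreal (p / M * t powr (p - 1)) * ennreal (h t)" for t
      using assms(1,2) by (subst ennreal_mult'[symmetric]) (auto simp: mult_ac)
    then show ?thesis using assms(1) by (simp add: moment_int_def)
  qed
  also have "\<dots> = ennreal (p / M) * weighted_int p h"
    using assms by (intro weighted_int_cmult) auto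
  finally show ?thesis .
qed

lemma moment_int_neg:
  assumes "p < 0" "M > 0" "set_borel_measurable borel {0<..} h"
  shows "moment_int M h p = ennreal (- p / M) * weighted_int p (\<lambda>t. M - h t)"
proof -
  have e: "p / M * (t powr (p - 1) * (h t - M)) = (- p / M * t powr (p - 1)) * (M - h t)" for t
    using assms(2) by (simp add: field_simps)
  have c: "0 \<le> - p / M" using assms(1,2) by (simp add: divide_nonpos_pos)
  have "moment_int M h p = (\<integral>\<^sup>+t\<in>{0<..}. ennreal (- p / M * t powr (p - 1)) * ennreal (M - h t) \<partial>lborel)"
  proof -
    have "ennreal (- p / M * t powr (p - 1) * (M - h t)) = ennreal (- p / M * t powr (p - 1)) * ennreal (M - h t)" for t
      by (rule ennreal_mult'[OF mult_nonneg_nonneg[OF c]]) simp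
    then show ?thesis using assms(1) by (simp only: moment_int_def e) simp
  qed
  also have "\<dots> = ennreal (- p / M) * weighted_int p (\<lambda>t. M - h t)"
    using assms c by (intro weighted_int_cmult set_borel_measurable_diff set_borel_measurable_const_real) auto
  finally show ?thesis .
qed

lemma profile_measurable:
  assumes "profile M h" shows "set_borel_measurable borel {0<..} h"
proof -
  define h' where "h' t = (if t > 0 then - h t else - M)" for t
  have "mono h'"
    using assms unfolding mono_def h'_def profile_def by auto
  then have "h' \<in> borel_measurable borel" by (rule borel_measurable_mono)
  then have "(\<lambda>t. indicator {0<..} t * (- h' t)) \<in> borel_measurable borel" by measurable
  then show ?thesis unfolding set_borel_measurable_def
    by (rule measurable_cong[THEN iffD1, rotated]) (auto simp: h'_def indicator_def)
qed

lemma weighted_int_mono: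
  "(\<And>t. t > 0 \<Longrightarrow> f t \<le> g t) \<Longrightarrow> weighted_int p f \<le> weighted_int p g"
  unfolding weighted_int_def
  by (intro nn_integral_mono) (auto simp: indicator_def intro!: mult_left_mono ennreal_leI)

text \<open>\<open>g\<close> may change sign; the truncation in \<open>weighted_int\<close> is what
  produces the \<open>max\<close>. Typically \<open>g\<close> is a difference, added to one of its
  two terms.\<close>

lemma weighted_int_add:
  assumes "set_borel_measurable borel {0<..} f" "set_borel_measurable borel {0<..} g"
    and "\<And>t. t > 0 \<Longrightarrow> 0 \<le> f t"
  shows "weighted_int p f + weighted_int p g = weighted_int p (\<lambda>t. f t + max 0 (g t))"
proof -
  define F where "F t = ennreal (indicator {0<..} t * f t)" for t
  define G where "G t = ennreal (indicator {0<..} t * g t)" for t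
  have [measurable]: "F \<in> borel_measurable borel" "G \<in> borel_measurable borel"
    using assms(1,2) unfolding set_borel_measurable_def F_def[abs_def] G_def[abs_def] real_scaleR_def
    by (auto intro: measurable_compose[OF _ measurable_ennreal])
  have FG: "ennreal (f t) * indicator {0<..} t = F t" "ennreal (g t) * indicator {0<..} t = G t" for t
    by (auto simp: F_def G_def indicator_def)
  have "weighted_int p f + weighted_int p g =
      (\<integral>\<^sup>+t. ennreal (t powr (p - 1)) * F t \<partial>lborel) + (\<integral>\<^sup>+t. ennreal (t powr (p - 1)) * G t \<partial>lborel)"
    unfolding weighted_int_def
    by (intro arg_cong2[where f = "(+)"] nn_integral_cong) (auto simp: FG[symmetric] mult_ac)
  also have "\<dots> = (\<integral>\<^sup>+t. ennreal (t powr (p - 1)) * F t + ennreal (t powr (p - 1)) * G t \<partial>lborel)"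
    by (intro nn_integral_add[symmetric]) measurable
  also have "\<dots> = weighted_int p (\<lambda>t. f t + max 0 (g t))"
    unfolding weighted_int_def F_def G_def
    by (intro nn_integral_cong)
      (use assms(3) in \<open>auto simp: indicator_def distrib_left[symmetric] max_def ennreal_neg\<close>)
  finally show ?thesis .
qed

text \<open>Passing from exponent \<open>p\<close> to \<open>q\<close> multiplies the weight by
  \<open>t powr (q - p)\<close>. This factor is at most its value at \<open>r0\<close> where
  \<open>g - h\<close> can be positive, and at least that value where \<open>h - g\<close> can be
  positive.\<close>

lemma weighted_int_sign_change:
  assumes pq: "p \<le> q" and r0: "0 \<le> r0"
    and ge: "\<And>t. 0 < t \<Longrightarrow> t < r0 \<Longrightarrow> h t \<le> g t"
    and le: "\<And>t. r0 < t \<Longrightarrow> g t \<le> h t"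
    and p: "weighted_int p (\<lambda>t. g t - h t) \<le> weighted_int p (\<lambda>t. h t - g t)"
    and fin: "weighted_int p (\<lambda>t. g t - h t) \<noteq> \<infinity>"
    and m: "set_borel_measurable borel {0<..} g" "set_borel_measurable borel {0<..} h"
  shows "weighted_int q (\<lambda>t. g t - h t) \<le> weighted_int q (\<lambda>t. h t - g t)"
    and "weighted_int q (\<lambda>t. g t - h t) \<noteq> \<infinity>"
proof -
  have scale: "ennreal (r0 powr (q - p)) * weighted_int p f =
      (\<integral>\<^sup>+t\<in>{0<..}. ennreal (r0 powr (q - p) * t powr (p - 1)) * ennreal (f t) \<partial>lborel)"
    if "set_borel_measurable borel {0<..} f" for f
    using weighted_int_cmult[OF that, of "r0 powr (q - p)" p] by simp
  have split: "t powr (q - 1) = t powr (q - p) * t powr (p - 1)" for t :: real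
    by (simp add: powr_add[symmetric])
  have *: "weighted_int q (\<lambda>t. g t - h t) \<le> ennreal (r0 powr (q - p)) * weighted_int p (\<lambda>t. g t - h t)"
    unfolding scale[OF set_borel_measurable_diff[OF m]] unfolding weighted_int_def
  proof (intro nn_integral_mono)
    fix t :: real
    have "ennreal (t powr (q - 1)) * ennreal (g t - h t) \<le> ennreal (r0 powr (q - p) * t powr (p - 1)) * ennreal (g t - h t)" if "t > 0"
    proof (cases "t \<le> r0")
      case True then show ?thesis using that pq
        by (intro mult_right_mono) (auto simp: split[of t] intro!: ennreal_leI mult_right_mono powr_mono2)
    next
      case False then show ?thesis using le[of t] by (simp add: ennreal_neg)
    qed
    then show "ennreal (t powr (q - 1)) * ennreal (g t - h t) * indicator {0<..} t \<le>
        ennreal (r0 powr (q - p) * t powr (p - 1)) * ennreal (g t - h t) * indicator {0<..} t"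
      by (auto simp: indicator_def)
  qed
  also have "\<dots> \<le> ennreal (r0 powr (q - p)) * weighted_int p (\<lambda>t. h t - g t)"
    using p by (rule mult_left_mono) simp
  also have "\<dots> \<le> weighted_int q (\<lambda>t. h t - g t)"
    unfolding scale[OF set_borel_measurable_diff[OF m(2,1)]] unfolding weighted_int_def
  proof (intro nn_integral_mono)
    fix t :: real
    have "ennreal (r0 powr (q - p) * t powr (p - 1)) * ennreal (h t - g t) \<le> ennreal (t powr (q - 1)) * ennreal (h t - g t)" if "t > 0"
    proof (cases "t < r0")
      case False then show ?thesis using that pq r0
        by (intro mult_right_mono) (auto simp: split[of t] intro!: ennreal_leI mult_right_mono powr_mono2)
    next
      case True then show ?thesis using ge[of t] that by (simp add: ennreal_neg)
    qed
    then show "ennreal (r0 powr (q - p) * t powr (p - 1)) * ennreal (h t - g t) * indicator {0<..} t \<le>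
        ennreal (t powr (q - 1)) * ennreal (h t - g t) * indicator {0<..} t"
      by (auto simp: indicator_def)
  qed
  finally show "weighted_int q (\<lambda>t. g t - h t) \<le> weighted_int q (\<lambda>t. h t - g t)" .
  show "weighted_int q (\<lambda>t. g t - h t) \<noteq> \<infinity>"
    using * fin by (auto simp: ennreal_mult_eq_top_iff top_unique)
qed

lemma epowr_le_cancel:
  assumes "x \<noteq> 0" shows "epowr a (1 / x) \<le> epowr b (1 / x) \<longleftrightarrow> (if x > 0 then a \<le> b else b \<le> a)"
proof (cases "x > 0")
  case True
  then show ?thesis
    using epowr_mono[of "1 / x" a b] epowr_mono[of x "epowr a (1 / x)" "epowr b (1 / x)"]
    by (auto simp: epowr_inverse_exponent')
next
  case False
  then show ?thesis using assms
    using epowr_antimono[of "1 / x" b a] epowr_antimono[of x "epowr a (1 / x)" "epowr b (1 / x)"]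
    by (auto simp: epowr_inverse_exponent')
qed

lemma profile_mean_le_iff:
  assumes "M > 0" "profile M g" "profile M h" "p \<noteq> 0"
  shows "profile_mean M g p \<le> profile_mean M h p \<longleftrightarrow>
    (if p > 0 then weighted_int p g \<le> weighted_int p h
     else weighted_int p (\<lambda>t. M - h t) \<le> weighted_int p (\<lambda>t. M - g t))"
proof -
  have canc: "ennreal c * a \<le> ennreal c * b \<longleftrightarrow> a \<le> b" if "c > 0" for c a b
    using that by (simp add: ennreal_mult_le_mult_iff)
  have "profile_mean M g p \<le> profile_mean M h p \<longleftrightarrow>
    (if p > 0 then moment_int M g p \<le> moment_int M h p else moment_int M h p \<le> moment_int M g p)"
    unfolding profile_mean_def by (rule epowr_le_cancel[OF assms(4)])
  also have "\<dots> \<longleftrightarrow> (if p > 0 then weighted_int p g \<le> weighted_int p h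
     else weighted_int p (\<lambda>t. M - h t) \<le> weighted_int p (\<lambda>t. M - g t))"
  proof (cases "p > 0")
    case True then show ?thesis using assms canc[of "p / M"]
      by (simp add: moment_int_pos profile_measurable)
  next
    case False
    then have p: "p < 0" using assms(4) by simp
    then have "0 < - p / M" using assms(1) by (simp add: divide_neg_pos)
    then show ?thesis using assms(1-3) canc[of "- p / M"] False
      unfolding moment_int_neg[OF p assms(1) profile_measurable[OF assms(2)]]
        moment_int_neg[OF p assms(1) profile_measurable[OF assms(3)]] by simp
  qed
  finally show ?thesis .
qed

lemma profile_mean_mono:
  assumes "M > 0" "profile M g" "profile M h" "p \<noteq> 0" "\<And>t. t > 0 \<Longrightarrow> g t \<le> h t"
  shows "profile_mean M g p \<le> profile_mean M h p"
  using assms by (auto simp: profile_mean_le_iff intro!: weighted_int_mono)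

lemma profile_mean_eq_0_iff:
  assumes "M > 0" "profile M h" "p < 0"
  shows "profile_mean M h p = 0 \<longleftrightarrow> weighted_int p (\<lambda>t. M - h t) = \<infinity>"
proof -
  have "profile_mean M h p = 0 \<longleftrightarrow> moment_int M h p = \<infinity>"
    unfolding profile_mean_def using assms(3)
    by (cases "moment_int M h p" rule: ennreal_cases_pos) (auto simp: epowr_0 epowr_top epowr_ennreal)
  then show ?thesis using assms
    by (auto simp: moment_int_neg profile_measurable ennreal_mult_eq_top_iff field_simps)
qed

lemma profile_mean_eq_top_iff:
  assumes "M > 0" "profile M h" "p > 0"
  shows "profile_mean M h p = \<infinity> \<longleftrightarrow> weighted_int p h = \<infinity>"
proof -
  have "profile_mean M h p = \<infinity> \<longleftrightarrow> moment_int M h p = \<infinity>"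
    unfolding profile_mean_def using assms(3)
    by (cases "moment_int M h p" rule: ennreal_cases_pos) (auto simp: epowr_0 epowr_top epowr_ennreal)
  then show ?thesis using assms
    by (auto simp: moment_int_pos profile_measurable ennreal_mult_eq_top_iff field_simps)
qed

text \<open>Order of means is rewritten as order of the integrals of the two positive parts of
  \<open>g - h\<close>. These make sense for every exponent, so \<open>p < 0 < q\<close> is covered
  although the means are then computed from different functions. The hypotheses \<open>fin\<close>
  supply the finite terms to be cancelled: the first for positive \<open>p\<close>, the second for
  negative \<open>p\<close>.\<close>

lemma profile_mean_sign_change:
  assumes M: "M > 0" and g: "profile M g" and h: "profile M h"
    and pq: "p < q" "p \<noteq> 0" "q \<noteq> 0" and r0: "0 \<le> r0"
    and ge: "\<And>t. 0 < t \<Longrightarrow> t < r0 \<Longrightarrow> h t \<le> g t"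
    and le: "\<And>t. r0 < t \<Longrightarrow> g t \<le> h t"
    and p: "profile_mean M g p \<le> profile_mean M h p"
    and fin: "profile_mean M g p \<noteq> \<infinity>" "profile_mean M h p \<noteq> 0"
  shows "profile_mean M g q \<le> profile_mean M h q"
proof -
  note m = profile_measurable[OF g] profile_measurable[OF h]
  note md = set_borel_measurable_diff[OF m] set_borel_measurable_diff[OF m(2,1)]
    set_borel_measurable_diff[OF set_borel_measurable_const_real m(1)]
    set_borel_measurable_diff[OF set_borel_measurable_const_real m(2)]
  have b: "0 \<le> g t" "g t \<le> M" "0 \<le> h t" "h t \<le> M" if "t > 0" for t
    using g h that by (auto simp: profile_def)
  have cong: "weighted_int s f = weighted_int s f'" if "\<And>t. t > 0 \<Longrightarrow> f t = f' t" for s f f'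
    using that by (intro antisym weighted_int_mono) auto
  \<comment> \<open>Both sides integrate the maximum of \<open>g\<close> and \<open>h\<close>; in
    \<open>eq2\<close> both integrate \<open>M\<close> minus their minimum.\<close>
  have eq1: "weighted_int s g + weighted_int s (\<lambda>t. h t - g t) = weighted_int s h + weighted_int s (\<lambda>t. g t - h t)" for s
    using m md b by (subst (1 2) weighted_int_add) (auto intro!: cong)
  have eq2: "weighted_int s (\<lambda>t. M - h t) + weighted_int s (\<lambda>t. h t - g t) =
      weighted_int s (\<lambda>t. M - g t) + weighted_int s (\<lambda>t. g t - h t)" for s
    using m md b by (subst (1 2) weighted_int_add) (auto intro!: cong)
  have "weighted_int p (\<lambda>t. g t - h t) \<le> weighted_int p (\<lambda>t. h t - g t) \<and> weighted_int p (\<lambda>t. g t - h t) \<noteq> \<infinity>"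
  proof (cases "p > 0")
    case True
    have f: "weighted_int p g \<noteq> \<infinity>" using fin(1) profile_mean_eq_top_iff[OF M g True] by simp
    have "weighted_int p g + weighted_int p (\<lambda>t. g t - h t) \<le> weighted_int p h + weighted_int p (\<lambda>t. g t - h t)"
      using p True profile_mean_le_iff[OF M g h pq(2)] by (intro add_right_mono) auto
    then have "weighted_int p g + weighted_int p (\<lambda>t. g t - h t) \<le> weighted_int p g + weighted_int p (\<lambda>t. h t - g t)"
      using eq1 by simp
    moreover have "weighted_int p (\<lambda>t. g t - h t) \<le> weighted_int p g" using b by (intro weighted_int_mono) auto
    ultimately show ?thesis using f by (auto simp: ennreal_add_left_cancel_le top_unique)
  next
    case False
    then have pn: "p < 0" using pq by auto
    have f: "weighted_int p (\<lambda>t. M - h t) \<noteq> \<infinity>" using fin(2) profile_mean_eq_0_iff[OF M h pn] by simp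
    have "weighted_int p (\<lambda>t. M - h t) + weighted_int p (\<lambda>t. g t - h t) \<le> weighted_int p (\<lambda>t. M - g t) + weighted_int p (\<lambda>t. g t - h t)"
      using p False profile_mean_le_iff[OF M g h pq(2)] by (intro add_right_mono) auto
    then have "weighted_int p (\<lambda>t. M - h t) + weighted_int p (\<lambda>t. g t - h t) \<le> weighted_int p (\<lambda>t. M - h t) + weighted_int p (\<lambda>t. h t - g t)"
      using eq2 by simp
    moreover have "weighted_int p (\<lambda>t. g t - h t) \<le> weighted_int p (\<lambda>t. M - h t)" using b by (intro weighted_int_mono) auto
    ultimately show ?thesis using f by (auto simp: ennreal_add_left_cancel_le top_unique)
  qed
  then have q: "weighted_int q (\<lambda>t. g t - h t) \<le> weighted_int q (\<lambda>t. h t - g t)" "weighted_int q (\<lambda>t. g t - h t) \<noteq> \<infinity>"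
    using weighted_int_sign_change[of p q r0 h g, OF _ r0 ge le _ _ m] pq by auto
  show ?thesis
  proof (cases "q > 0")
    case True
    have "weighted_int q g + weighted_int q (\<lambda>t. g t - h t) \<le> weighted_int q h + weighted_int q (\<lambda>t. g t - h t)"
      using eq1[of q] q(1) by (metis add_left_mono)
    then have "weighted_int q g \<le> weighted_int q h"
      using q(2) by (auto simp: ennreal_add_left_cancel_le add.commute[of _ "weighted_int q (\<lambda>t. g t - h t)"])
    then show ?thesis using True profile_mean_le_iff[OF M g h pq(3)] by auto
  next
    case False
    have "weighted_int q (\<lambda>t. M - h t) \<le> weighted_int q (\<lambda>t. M - g t)"
    proof (cases "weighted_int q (\<lambda>t. M - g t) = \<infinity>")
      case False
      have "weighted_int q (\<lambda>t. h t - g t) \<le> weighted_int q (\<lambda>t. M - g t)" using b by (intro weighted_int_mono) auto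
      then have f: "weighted_int q (\<lambda>t. h t - g t) \<noteq> \<infinity>" using False by (auto simp: top_unique)
      have "weighted_int q (\<lambda>t. M - h t) + weighted_int q (\<lambda>t. h t - g t) \<le> weighted_int q (\<lambda>t. M - g t) + weighted_int q (\<lambda>t. h t - g t)"
        using eq2[of q] q(1) by (metis add_left_mono)
      then show ?thesis
        using f by (auto simp: ennreal_add_left_cancel_le add.commute[of _ "weighted_int q (\<lambda>t. h t - g t)"])
    qed auto
    then show ?thesis using False profile_mean_le_iff[OF M g h pq(3)] by auto
  qed
qed

section \<open>Step functions and dilations of profiles\<close>

lemma weighted_int_step:
  assumes "0 < p" "0 < a" "0 \<le> c"
  shows "weighted_int p (\<lambda>t. if t \<le> a then c else 0) = ennreal (c * a powr p / p)"
proof -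
  have "((\<lambda>t. t powr (p - 1) * c) has_integral (a powr (p - 1 + 1) / (p - 1 + 1) * c)) {0..a}"
    using assms by (intro has_integral_mult_left has_integral_powr_from_0) auto
  from nn_integral_has_integral_lebesgue[OF _ this] assms
  have "(\<integral>\<^sup>+t. ennreal (indicator {0..a} t * (t powr (p - 1) * c)) \<partial>lborel) = ennreal (c * a powr p / p)"
    by (simp add: mult_ac)
  also have "(\<integral>\<^sup>+t. ennreal (indicator {0..a} t * (t powr (p - 1) * c)) \<partial>lborel) =
      weighted_int p (\<lambda>t. if t \<le> a then c else 0)"
    unfolding weighted_int_def using assms
    by (intro nn_integral_cong) (auto simp: indicator_def ennreal_mult'[symmetric])
  finally show ?thesis .
qed

lemma weighted_int_tail:
  assumes "p < 0" "0 < a" "0 \<le> c"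
  shows "weighted_int p (\<lambda>t. if t \<le> a then 0 else c) = ennreal (c * a powr p / (- p))"
proof -
  have "((\<lambda>t. t powr (p - 1) * c) has_integral (- (a powr (p - 1 + 1)) / (p - 1 + 1) * c)) {a..}"
    using assms by (intro has_integral_mult_left has_integral_powr_to_inf) auto
  from nn_integral_has_integral_lebesgue[OF _ this] assms
  have "(\<integral>\<^sup>+t. ennreal (indicator {a..} t * (t powr (p - 1) * c)) \<partial>lborel) = ennreal (c * a powr p / (- p))"
    by (simp add: mult_ac)
  also have "(\<integral>\<^sup>+t. ennreal (indicator {a..} t * (t powr (p - 1) * c)) \<partial>lborel) =
      weighted_int p (\<lambda>t. if t \<le> a then 0 else c)"
    unfolding weighted_int_def using assms
    \<comment> \<open>The point \<open>a\<close> belongs to the ray but the step function still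
      vanishes there, so the integrands differ at one point.\<close>
    by (intro nn_integral_cong_AE AE_mp[OF AE_lborel_singleton[of a] AE_I2])
      (auto simp: indicator_def ennreal_mult'[symmetric])
  finally show ?thesis .
qed

text \<open>The step function is \<open>M\<close> times the survival function of the constant
  \<open>a\<close>, whose moment of order \<open>p\<close> is the power of \<open>a\<close>.\<close>

lemma epowr_eq_moment_int_step:
  assumes "M > 0" "p \<noteq> 0" "a > 0"
  shows "epowr (ennreal a) p = moment_int M (\<lambda>t. if t \<le> a then M else 0) p"
proof -
  have prof: "profile M (\<lambda>t. if t \<le> a then M else 0)" using assms by (auto simp: profile_def)
  show ?thesis
  proof (cases "p > 0")
    case True
    then show ?thesis using assms
      by (simp add: moment_int_pos profile_measurable[OF prof] weighted_int_step epowr_ennreal ennreal_mult'[symmetric])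
  next
    case False
    have "(\<lambda>t. M - (if t \<le> a then M else 0)) = (\<lambda>t. if t \<le> a then 0 else M)" by auto
    moreover have "p < 0" "0 \<le> - p / M" using assms False by (auto simp: divide_nonpos_pos)
    ultimately have "moment_int M (\<lambda>t. if t \<le> a then M else 0) p = ennreal ((- p / M) * (M * a powr p / (- p)))"
      using assms by (simp only: moment_int_neg profile_measurable[OF prof] weighted_int_tail less_imp_le ennreal_mult'[symmetric])
    then show ?thesis using assms by (simp add: epowr_ennreal)
  qed
qed

lemma profile_step: "M > 0 \<Longrightarrow> profile M (\<lambda>t. if t \<le> a then M else 0)"
  by (auto simp: profile_def)

lemma profile_mean_step:
  "M > 0 \<Longrightarrow> p \<noteq> 0 \<Longrightarrow> a > 0 \<Longrightarrow> profile_mean M (\<lambda>t. if t \<le> a then M else 0) p = ennreal a"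
  unfolding profile_mean_def by (simp add: epowr_eq_moment_int_step[symmetric] epowr_inverse_exponent)

lemma profile_scale:
  "profile M h \<Longrightarrow> 0 < l \<Longrightarrow> profile M (\<lambda>t. h (t / l))"
  by (auto simp: profile_def divide_right_mono)

lemma weighted_int_scale:
  assumes "0 < l" "set_borel_measurable borel {0<..} f"
  shows "weighted_int p (\<lambda>t. f (t / l)) = ennreal (l powr p) * weighted_int p f"
proof -
  define F where "F t = ennreal (indicator {0<..} t * f t)" for t
  have [measurable]: "F \<in> borel_measurable borel"
    using assms(2) unfolding set_borel_measurable_def F_def[abs_def] real_scaleR_def
    by (rule measurable_compose[OF _ measurable_ennreal])
  have F: "F t = ennreal (f t) * indicator {0<..} t" for t
    by (auto simp: F_def indicator_def)
  have "weighted_int p (\<lambda>t. f (t / l)) = (\<integral>\<^sup>+t. ennreal (t powr (p - 1)) * F (t / l) \<partial>lborel)"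
    unfolding weighted_int_def F using assms(1)
    by (intro nn_integral_cong) (auto simp: indicator_def zero_less_divide_iff)
  also have "\<dots> = ennreal l * (\<integral>\<^sup>+t. ennreal ((l * t) powr (p - 1)) * F (l * t / l) \<partial>lborel)"
    using nn_integral_real_affine[of "\<lambda>t. ennreal (t powr (p - 1)) * F (t / l)" l 0] assms(1) by simp
  also have "(\<integral>\<^sup>+t. ennreal ((l * t) powr (p - 1)) * F (l * t / l) \<partial>lborel) =
      (\<integral>\<^sup>+t\<in>{0<..}. ennreal (l powr (p - 1) * t powr (p - 1)) * ennreal (f t) \<partial>lborel)"
    using assms(1) by (intro nn_integral_cong) (auto simp: F indicator_def powr_mult)
  also have "\<dots> = ennreal (l powr (p - 1)) * weighted_int p f"
    by (rule weighted_int_cmult[OF assms(2)]) simp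
  finally show ?thesis using assms(1)
    by (simp add: mult.assoc[symmetric] ennreal_mult'[symmetric] powr_mult_base)
qed

lemma profile_mean_scale:
  assumes "M > 0" "profile M h" "0 < l" "p \<noteq> 0"
  shows "profile_mean M (\<lambda>t. h (t / l)) p = ennreal l * profile_mean M h p"
proof -
  note m = profile_measurable[OF assms(2)] profile_measurable[OF profile_scale[OF assms(2,3)]]
  have "moment_int M (\<lambda>t. h (t / l)) p = ennreal (l powr p) * moment_int M h p"
  proof (cases "p > 0")
    case True
    then show ?thesis using assms m by (simp add: moment_int_pos weighted_int_scale mult_ac)
  next
    case False
    then have "p < 0" using assms by simp
    then show ?thesis
      using assms m weighted_int_scale[OF assms(3) set_borel_measurable_diff[OF set_borel_measurable_const_real m(1)], of p M]
      by (simp add: moment_int_neg mult_ac)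
  qed
  then show ?thesis unfolding profile_mean_def using assms
    by (simp add: epowr_mult_ennreal powr_powr)
qed

text \<open>The step function with jump at \<^term>\<open>a\<close> crosses every profile from above, and its mean is
  \<^term>\<open>a\<close> for every exponent; so monotonicity in the exponent is a case of the crossing lemma.\<close>

lemma profile_mean_mono_exponent:
  assumes M: "M > 0" and h: "profile M h" and "p \<le> q" "p \<noteq> 0" "q \<noteq> 0"
  shows "profile_mean M h p \<le> profile_mean M h q"
proof (cases "p = q")
  case False
  then have pq: "p < q" using assms by simp
  show ?thesis
  \<comment> \<open>Testing the numbers below the \<open>p\<close>-mean includes the case of an
    infinite mean, which no step function shares.\<close>
  proof (rule dense_le)
    fix x assume x: "x < profile_mean M h p"
    show "x \<le> profile_mean M h q"
    proof (cases x rule: ennreal_cases_pos)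
      case (3 a)
      have "profile_mean M (\<lambda>t. if t \<le> a then M else 0) q \<le> profile_mean M h q"
      proof (rule profile_mean_sign_change[OF M profile_step[OF M] h pq assms(4,5), of a])
        show "profile_mean M (\<lambda>t. if t \<le> a then M else 0) p \<le> profile_mean M h p"
          using x 3 M assms by (simp add: profile_mean_step)
        show "profile_mean M (\<lambda>t. if t \<le> a then M else 0) p \<noteq> \<infinity>"
          using 3 M assms by (simp add: profile_mean_step)
        show "profile_mean M h p \<noteq> 0" using x 3 by auto
      qed (use h 3 in \<open>auto simp: profile_def\<close>)
      then show ?thesis using 3 M assms by (simp add: profile_mean_step)
    qed (use x in auto)
  qed
qed simp

lemma profile_mean_pos:
  assumes M: "M > 0" and h: "profile M h" and "p > 0" "r > 0" "h r > 0"
  shows "profile_mean M h p \<noteq> 0"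
proof -
  have "0 < ennreal (h r * r powr p / p)" using assms by simp
  also have "\<dots> = weighted_int p (\<lambda>t. if t \<le> r then h r else 0)" using assms by (simp add: weighted_int_step)
  also have "\<dots> \<le> weighted_int p h" using h assms by (intro weighted_int_mono) (auto simp: profile_def)
  finally have "moment_int M h p \<noteq> 0" using assms
    by (simp add: moment_int_pos profile_measurable)
  then show ?thesis unfolding profile_mean_def using assms(3)
    by (cases "moment_int M h p" rule: ennreal_cases_pos) (auto simp: epowr_0 epowr_top epowr_ennreal)
qed

text \<open>For negative exponents only the singularity of the weight at 0 can make the integral
  diverge. Up to \<open>r / 2\<close> the function \<open>M - g\<close> is at most
  \<open>M - h\<close>; beyond it the weight is integrable and \<open>M\<close> bounds
  everything.\<close>

lemma profile_mean_neg_pos: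
  assumes M: "M > 0" and h: "profile M h" and g: "profile M g" and "p < 0" "r > 0"
    and le: "\<And>t. 0 < t \<Longrightarrow> t < r \<Longrightarrow> h t \<le> g t" and h0: "profile_mean M h p \<noteq> 0"
  shows "profile_mean M g p \<noteq> 0"
proof -
  have "weighted_int p (\<lambda>t. M - g t) \<le> weighted_int p (\<lambda>t. M - h t + max 0 (if t \<le> r / 2 then 0 else M))"
  proof (rule weighted_int_mono)
    fix t :: real assume t: "t > 0"
    have "0 \<le> g t" "h t \<le> M" using g h t by (auto simp: profile_def)
    then show "M - g t \<le> M - h t + max 0 (if t \<le> r / 2 then 0 else M)"
      using le[OF t] \<open>r > 0\<close> M by auto
  qed
  also have "\<dots> = weighted_int p (\<lambda>t. M - h t) + weighted_int p (\<lambda>t. if t \<le> r / 2 then 0 else M)"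
  proof (rule weighted_int_add[symmetric])
    show "set_borel_measurable borel {0<..} (\<lambda>t. M - h t)"
      by (intro set_borel_measurable_diff set_borel_measurable_const_real profile_measurable[OF h])
    show "set_borel_measurable borel {0<..} (\<lambda>t. if t \<le> r / 2 then 0 else M)"
      unfolding set_borel_measurable_def by measurable
  qed (use h in \<open>auto simp: profile_def\<close>)
  also have "\<dots> < \<infinity>"
    using h0 assms weighted_int_tail[of p "r / 2" M]
    by (simp add: profile_mean_eq_0_iff less_top)
  finally show ?thesis using assms by (auto simp: profile_mean_eq_0_iff)
qed

lemma profile_mean_le_bound:
  assumes M: "M > 0" and g: "profile M g" and R: "R > 0" "\<And>t. t > R \<Longrightarrow> g t = 0" and "p \<noteq> 0"
  shows "profile_mean M g p \<le> ennreal R"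
proof -
  have "profile_mean M g p \<le> profile_mean M (\<lambda>t. if t \<le> R then M else 0) p"
    using assms by (intro profile_mean_mono profile_step) (auto simp: profile_def)
  then show ?thesis using assms by (simp add: profile_mean_step)
qed

text \<open>Single crossing, required for all dilates at once because the factor \<open>l\<close> is
  fixed only later, by matching means or slopes. This is the form in which concavity of the measure
  reaches both inclusions.\<close>

definition dominates_from_right :: "(real \<Rightarrow> real) \<Rightarrow> (real \<Rightarrow> real) \<Rightarrow> bool" where
  "dominates_from_right \<psi> g \<longleftrightarrow>
     (\<forall>l>0. \<forall>r>0. \<forall>s>r. \<psi> (s / l) < g s \<longrightarrow> \<psi> (r / l) \<le> g r)"

text \<open>The factor \<open>l\<close> is the quotient of the two \<open>p\<close>-means, so
  \<open>g\<close> and the dilate of \<psi> by \<open>l\<close> have equal \<open>p\<close>-means;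
  the crossing lemma then bounds the \<open>q\<close>-mean of \<open>g\<close> by \<open>l\<close>
  times that of \<psi>. An infinite \<open>p\<close>-mean of \<psi> makes the left side 0.\<close>

lemma profile_mean_ratio_antimono:
  assumes M: "M > 0" and g: "profile M g" and \<psi>: "profile M \<psi>"
    and cross: "dominates_from_right \<psi> g"
    and R: "R > 0" "\<And>t. t > R \<Longrightarrow> g t = 0" and r: "r > 0" "g r > 0"
    and van: "\<And>e. e > 0 \<Longrightarrow> \<exists>T>0. \<psi> T < e"
    and pq: "p < q" "p \<noteq> 0" "q \<noteq> 0" and nz: "profile_mean M \<psi> p \<noteq> 0"
  shows "profile_mean M g q * inverse (profile_mean M \<psi> q) \<le> profile_mean M g p * inverse (profile_mean M \<psi> p)"
proof -
  have gfin: "profile_mean M g s \<noteq> \<infinity>" if "s \<noteq> 0" for s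
    using profile_mean_le_bound[OF M g R that] by (auto simp: top_unique)
  have g0: "profile_mean M g p \<noteq> 0"
  proof (cases "p > 0")
    case True then show ?thesis using profile_mean_pos[OF M g True r] by simp
  next
    case False
    \<comment> \<open>The dilate carrying \<open>T\<close> to \<open>r\<close> lies strictly below
      \<open>g\<close> at \<open>r\<close>, hence below \<open>g\<close> on all of (0, r) by
      domination. This controls \<open>M - g\<close> near 0.\<close>
    obtain T where T: "T > 0" "\<psi> T < g r" using van[OF r(2)] by blast
    define l where "l = r / T"
    have l: "l > 0" "r / l = T" using T r by (auto simp: l_def)
    show ?thesis
    proof (rule profile_mean_neg_pos[OF M profile_scale[OF \<psi> l(1)] g _ r(1)])
      show "\<psi> (t / l) \<le> g t" if "0 < t" "t < r" for t
        using cross that l T unfolding dominates_from_right_def by metis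
      show "profile_mean M (\<lambda>t. \<psi> (t / l)) p \<noteq> 0"
        using nz l(1) M \<psi> pq by (simp add: profile_mean_scale)
    qed (use False pq in auto)
  qed
  show ?thesis
  proof (cases "profile_mean M \<psi> p = \<infinity>")
    case True
    then have "profile_mean M \<psi> q = \<infinity>"
      using profile_mean_mono_exponent[OF M \<psi>, of p q] pq by (auto simp: top_unique)
    then show ?thesis by simp
  next
    case False
    obtain a where a: "a > 0" "profile_mean M \<psi> p = ennreal a"
      using False nz by (cases "profile_mean M \<psi> p" rule: ennreal_cases_pos) auto
    obtain b where b: "b > 0" "profile_mean M g p = ennreal b"
      using gfin[OF pq(2)] g0 by (cases "profile_mean M g p" rule: ennreal_cases_pos) auto
    define l where "l = b / a"
    have l: "l > 0" using a b by (simp add: l_def)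
    let ?X = "{s. 0 < s \<and> \<psi> (s / l) < g s}"
    \<comment> \<open>The crossing point is the supremum of the points where the dilate is strictly
      below \<open>g\<close>, and 0 if there are none. The set is bounded because \<open>g\<close>
      vanishes past \<open>R\<close>.\<close>
    define r0 where "r0 = (if ?X = {} then 0 else Sup ?X)"
    have bdd: "bdd_above ?X"
    proof (rule bdd_aboveI)
      fix s assume s: "s \<in> ?X"
      show "s \<le> R"
      proof (rule ccontr)
        assume "\<not> s \<le> R"
        moreover have "\<psi> (s / l) \<ge> 0" using \<psi> s l by (auto simp: profile_def)
        ultimately show False using s R(2)[of s] by auto
      qed
    qed
    have "profile_mean M g q \<le> profile_mean M (\<lambda>t. \<psi> (t / l)) q"
    proof (rule profile_mean_sign_change[OF M g profile_scale[OF \<psi> l] pq, of r0])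
      show "0 \<le> r0"
      proof (cases "?X = {}")
        case False
        then obtain s where "s \<in> ?X" by blast
        then have "0 < s" "s \<le> Sup ?X" using bdd by (auto intro: cSup_upper)
        then show ?thesis by (simp add: r0_def)
      qed (simp add: r0_def)
      show "\<psi> (t / l) \<le> g t" if t: "0 < t" "t < r0" for t
      proof -
        have ne: "?X \<noteq> {}" using t by (auto simp: r0_def split: if_splits)
        then have "t < Sup ?X" using t unfolding r0_def by (simp only: if_False)
        then obtain s where "s \<in> ?X" "t < s" using less_cSup_iff[OF ne bdd] by blast
        then show ?thesis using cross l t unfolding dominates_from_right_def by blast
      qed
      show "g t \<le> \<psi> (t / l)" if t: "r0 < t" for t
      proof (rule ccontr)
        assume *: "\<not> g t \<le> \<psi> (t / l)"
        have "0 < t" using \<open>0 \<le> r0\<close> t by simp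
        then have "t \<in> ?X" using * by simp
        then have "t \<le> r0" using cSup_upper[OF _ bdd, of t] by (auto simp: r0_def)
        then show False using t by simp
      qed
      show "profile_mean M g p \<le> profile_mean M (\<lambda>t. \<psi> (t / l)) p"
        unfolding profile_mean_scale[OF M \<psi> l pq(2)] a b(2)
        using a(1) b(1) by (simp add: l_def ennreal_mult'[symmetric])
      show "profile_mean M (\<lambda>t. \<psi> (t / l)) p \<noteq> 0"
        using nz l(1) M \<psi> pq by (simp add: profile_mean_scale)
    qed (use gfin pq in auto)
    also have "\<dots> = ennreal l * profile_mean M \<psi> q" using l M \<psi> pq by (simp add: profile_mean_scale)
    finally have "profile_mean M g q * inverse (profile_mean M \<psi> q) \<le> ennreal l * profile_mean M \<psi> q * inverse (profile_mean M \<psi> q)"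
      by (rule mult_right_mono) simp
    also have "\<dots> \<le> ennreal l"
      by (cases "profile_mean M \<psi> q" rule: ennreal_cases_pos)
        (auto simp: mult.assoc inverse_ennreal ennreal_mult'[symmetric])
    also have "\<dots> = profile_mean M g p * inverse (profile_mean M \<psi> p)"
      using a b by (simp add: l_def inverse_ennreal ennreal_mult'[symmetric] field_simps)
    finally show ?thesis .
  qed
qed

section \<open>Means and constants at the exponent 0\<close>

lemma mono_tendsto_at_right_0:
  fixes f :: "real \<Rightarrow> ennreal"
  assumes "\<And>s t. 0 < s \<Longrightarrow> s \<le> t \<Longrightarrow> f s \<le> f t"
  shows "(f \<longlongrightarrow> (INF t\<in>{0<..}. f t)) (at_right 0)"
proof (rule order_tendstoI)
  fix a assume "a < (INF t\<in>{0<..}. f t)"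
  then have "a < f t" if "t > 0" for t using that by (auto intro: less_le_trans INF_lower)
  then show "\<forall>\<^sub>F t in at_right 0. a < f t" by (auto simp: eventually_at_filter intro!: always_eventually)
next
  fix a assume "(INF t\<in>{0<..}. f t) < a"
  then obtain t where t: "t > 0" "f t < a" by (auto simp: INF_less_iff)
  then have "f s < a" if "0 < s" "s < t" for s using assms[of s t] that by auto
  then show "\<forall>\<^sub>F s in at_right 0. f s < a" using t(1)
    by (auto simp: eventually_at_right_field)
qed

lemma antimono_tendsto_at_right_0:
  fixes f :: "real \<Rightarrow> ennreal"
  assumes "\<And>s t. 0 < s \<Longrightarrow> s \<le> t \<Longrightarrow> f t \<le> f s"
  shows "(f \<longlongrightarrow> (SUP t\<in>{0<..}. f t)) (at_right 0)"
proof (rule order_tendstoI)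
  fix a assume "(SUP t\<in>{0<..}. f t) < a"
  then have "f t < a" if "t > 0" for t
    using that by (metis SUP_upper greaterThan_iff le_less_trans)
  then show "\<forall>\<^sub>F t in at_right 0. f t < a" by (auto simp: eventually_at_filter intro!: always_eventually)
next
  fix a assume "a < (SUP t\<in>{0<..}. f t)"
  then obtain t where t: "t > 0" "a < f t" by (auto simp: less_SUP_iff)
  then have "a < f s" if "0 < s" "s < t" for s using assms[of s t] that by auto
  then show "\<forall>\<^sub>F s in at_right 0. a < f s" using t(1)
    by (auto simp: eventually_at_right_field)
qed

lemma extend_at_0_cong:
  assumes "\<And>p. p \<noteq> 0 \<Longrightarrow> f p = g p"
  shows "extend_at_0 f p = extend_at_0 g p"
proof -
  have "(f \<longlongrightarrow> l) (at_right 0) \<longleftrightarrow> (g \<longlongrightarrow> l) (at_right 0)" for l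
    by (rule filterlim_cong) (auto simp: eventually_at_filter assms)
  then show ?thesis unfolding extend_at_0_def t2_space_class.Lim_def using assms by simp
qed

lemma extend_at_0_eq_limit_right: "(f \<longlongrightarrow> l) (at_right 0) \<Longrightarrow> extend_at_0 f 0 = l"
  unfolding extend_at_0_def by (simp add: tendsto_Lim)

lemma extend_at_0_nonzero: "p \<noteq> 0 \<Longrightarrow> extend_at_0 f p = f p"
  by (simp add: extend_at_0_def)

abbreviation extended_mean :: "real \<Rightarrow> (real \<Rightarrow> real) \<Rightarrow> real \<Rightarrow> ennreal" where
  "extended_mean M h \<equiv> extend_at_0 (profile_mean M h)"

abbreviation extended_const :: "real \<Rightarrow> (real \<Rightarrow> real) \<Rightarrow> real \<Rightarrow> ennreal" where
  "extended_const M h \<equiv> extend_at_0 (\<lambda>p. inverse (profile_mean M h p))"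

lemma profile_mean_tendsto_0:
  assumes "M > 0" "profile M h"
  shows "(profile_mean M h \<longlongrightarrow> extended_mean M h 0) (at_right 0)"
proof -
  have "(profile_mean M h \<longlongrightarrow> (INF t\<in>{0<..}. profile_mean M h t)) (at_right 0)"
    using assms by (intro mono_tendsto_at_right_0 profile_mean_mono_exponent) auto
  then show ?thesis using extend_at_0_eq_limit_right by metis
qed

lemma inverse_profile_mean_antimono:
  assumes "M > 0" "profile M h" "p \<le> q" "p \<noteq> 0" "q \<noteq> 0"
  shows "inverse (profile_mean M h q) \<le> inverse (profile_mean M h p)"
  using assms by (intro ennreal_inverse_antimono profile_mean_mono_exponent)

lemma extend_at_0_inverse_profile_mean:
  assumes "M > 0" "profile M h"
  shows "((\<lambda>p. inverse (profile_mean M h p)) \<longlongrightarrow> (SUP t\<in>{0<..}. inverse (profile_mean M h t))) (at_right 0)"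
    and "extended_const M h 0 = (SUP t\<in>{0<..}. inverse (profile_mean M h t))"
proof -
  show *: "((\<lambda>p. inverse (profile_mean M h p)) \<longlongrightarrow> (SUP t\<in>{0<..}. inverse (profile_mean M h t))) (at_right 0)"
    using assms by (intro antimono_tendsto_at_right_0 inverse_profile_mean_antimono) auto
  show "extended_const M h 0 = (SUP t\<in>{0<..}. inverse (profile_mean M h t))"
    by (rule extend_at_0_eq_limit_right[OF *])
qed

lemma extended_const_antimono:
  assumes "M > 0" "profile M \<psi>" "p \<le> q"
  shows "extended_const M \<psi> q \<le> extended_const M \<psi> p"
proof -
  consider "p = q" | "p \<noteq> 0" "q \<noteq> 0" | "p = 0" "q > 0" | "p < 0" "q = 0" using assms(3) by linarith
  then show ?thesis
  proof cases
    case 2 then show ?thesis using inverse_profile_mean_antimono[OF assms] by (simp add: extend_at_0_nonzero)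
  next
    case 3 then show ?thesis using assms
      by (auto simp: extend_at_0_nonzero extend_at_0_inverse_profile_mean(2) intro!: SUP_upper)
  next
    case 4 then show ?thesis using assms inverse_profile_mean_antimono[OF assms(1,2), of p]
      by (auto simp: extend_at_0_nonzero extend_at_0_inverse_profile_mean(2) intro!: SUP_least)
  qed simp
qed

lemma profile_mean_extended_finite:
  assumes M: "M > 0" and g: "profile M g" and R: "R > 0" "\<And>t. t > R \<Longrightarrow> g t = 0"
  shows "extended_mean M g p \<noteq> \<infinity>"
proof (cases "p = 0")
  case True
  have "extended_mean M g 0 \<le> ennreal R"
    using profile_mean_le_bound[OF M g R]
    by (intro tendsto_upperbound[OF profile_mean_tendsto_0[OF M g]]) (auto simp: eventually_at_filter)
  then show ?thesis using True by (auto simp: top_unique)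
next
  case False
  then show ?thesis using profile_mean_le_bound[OF M g R False] by (auto simp: extend_at_0_nonzero top_unique)
qed

text \<open>Multiplication on \<open>ennreal\<close> is discontinuous where one factor is 0 and the
  other infinite. Here \<open>fin\<close> keeps the first limit finite and the bounded support of
  \<open>g\<close> the second.\<close>

lemma extended_product_tendsto:
  assumes M: "M > 0" and g: "profile M g" and \<psi>: "profile M \<psi>"
    and R: "R > 0" "\<And>t. t > R \<Longrightarrow> g t = 0"
    and fin: "extended_const M \<psi> 0 \<noteq> \<infinity>"
  shows "((\<lambda>p. inverse (profile_mean M \<psi> p) * profile_mean M g p) \<longlongrightarrow>
      extended_const M \<psi> 0 * extended_mean M g 0) (at_right 0)"
  using extend_at_0_inverse_profile_mean[OF M \<psi>] profile_mean_tendsto_0[OF M g]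
    profile_mean_extended_finite[OF M g R, of 0] fin
  by (intro tendsto_mult_ennreal) auto

text \<open>When one exponent is 0, the inequality for nonzero exponents is passed to the right
  limit: in the smaller exponent for \<open>p = 0 < q\<close>, in the larger one for
  \<open>p < 0 = q\<close>.\<close>

lemma extended_ratio_antimono:
  assumes M: "M > 0" and g: "profile M g" and \<psi>: "profile M \<psi>"
    and cross: "dominates_from_right \<psi> g"
    and R: "R > 0" "\<And>t. t > R \<Longrightarrow> g t = 0" and r: "r > 0" "g r > 0"
    and van: "\<And>e. e > 0 \<Longrightarrow> \<exists>T>0. \<psi> T < e" and \<psi>0: "s > 0" "\<psi> s > 0"
    and pq: "p \<le> q" and fin: "extended_const M \<psi> p \<noteq> \<infinity>"
  shows "extended_const M \<psi> q * extended_mean M g q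
    \<le> extended_const M \<psi> p * extended_mean M g p"
proof -
  have *: "inverse (profile_mean M \<psi> b) * profile_mean M g b \<le> inverse (profile_mean M \<psi> a) * profile_mean M g a"
    if "a < b" "a \<noteq> 0" "b \<noteq> 0" "profile_mean M \<psi> a \<noteq> 0" for a b
    using profile_mean_ratio_antimono[OF M g \<psi> cross R r van that] by (simp add: mult.commute)
  have p0: "profile_mean M \<psi> a \<noteq> 0" if "a > 0" for a using profile_mean_pos[OF M \<psi> that \<psi>0] .
  consider "p = q" | "p < q" "p \<noteq> 0" "q \<noteq> 0" | "p = 0" "q > 0" | "p < 0" "q = 0" using pq by linarith
  then show ?thesis
  proof cases
    case 2 then show ?thesis using *[of p q] fin by (auto simp: extend_at_0_nonzero)
  next
    case 3
    have "inverse (profile_mean M \<psi> q) * profile_mean M g q \<le>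
      extended_const M \<psi> 0 * extended_mean M g 0"
    proof (rule tendsto_lowerbound[OF extended_product_tendsto[OF M g \<psi> R]])
      show "\<forall>\<^sub>F a in at_right 0. inverse (profile_mean M \<psi> q) * profile_mean M g q \<le> inverse (profile_mean M \<psi> a) * profile_mean M g a"
        using eventually_at_right_real[OF 3(2)] by eventually_elim (use 3 * p0 in auto)
    qed (use fin 3 in auto)
    then show ?thesis using 3 by (simp add: extend_at_0_nonzero)
  next
    case 4
    have f0: "extended_const M \<psi> 0 \<noteq> \<infinity>"
      using extended_const_antimono[OF M \<psi>, of p 0] fin 4 by (auto simp: top_unique)
    have "extended_const M \<psi> 0 * extended_mean M g 0 \<le>
      inverse (profile_mean M \<psi> p) * profile_mean M g p"
    proof (rule tendsto_upperbound[OF extended_product_tendsto[OF M g \<psi> R f0]])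
      show "\<forall>\<^sub>F a in at_right 0. inverse (profile_mean M \<psi> a) * profile_mean M g a \<le> inverse (profile_mean M \<psi> p) * profile_mean M g p"
        using eventually_at_right_less[of 0] by eventually_elim (use 4 fin * in \<open>auto simp: extend_at_0_nonzero\<close>)
    qed auto
    then show ?thesis using 4 by (simp add: extend_at_0_nonzero)
  qed simp
qed

lemma extended_ratio_le:
  assumes M: "M > 0" and g: "profile M g" and \<psi>: "profile M \<psi>"
    and R: "R > 0" "\<And>t. t > R \<Longrightarrow> g t = 0"
    and l: "l > 0" and le: "\<And>t. t > 0 \<Longrightarrow> g t \<le> \<psi> (t / l)"
    and fin: "extended_const M \<psi> p \<noteq> \<infinity>"
  shows "extended_const M \<psi> p * extended_mean M g p \<le> ennreal l"
proof -
  have *: "inverse (profile_mean M \<psi> a) * profile_mean M g a \<le> ennreal l" if "a \<noteq> 0" for a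
  proof -
    have "profile_mean M g a \<le> profile_mean M (\<lambda>t. \<psi> (t / l)) a"
      using le by (intro profile_mean_mono M g profile_scale \<psi> l that)
    also have "\<dots> = ennreal l * profile_mean M \<psi> a" by (rule profile_mean_scale[OF M \<psi> l that])
    finally have "inverse (profile_mean M \<psi> a) * profile_mean M g a \<le> inverse (profile_mean M \<psi> a) * (ennreal l * profile_mean M \<psi> a)"
      by (rule mult_left_mono) simp
    also have "\<dots> \<le> ennreal l" using l
      by (cases "profile_mean M \<psi> a" rule: ennreal_cases_pos)
        (auto simp: inverse_ennreal ennreal_mult'[symmetric])
    finally show ?thesis .
  qed
  show ?thesis
  proof (cases "p = 0")
    case True
    then show ?thesis using * fin
      by (auto intro!: tendsto_upperbound[OF extended_product_tendsto[OF M g \<psi> R]] simp: eventually_at_filter)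
  qed (use * in \<open>simp add: extend_at_0_nonzero\<close>)
qed

text \<open>Near 0 the weight times \<open>L * t\<close> is of order \<open>t powr p\<close>, which
  is integrable because \<open>-1 < p\<close>. The conclusion says that the inverse of the mean,
  that is the constant, is finite.\<close>

lemma profile_mean_neg_finite:
  assumes M: "M > 0" and \<psi>: "profile M \<psi>" and d: "d > 0" and L: "\<And>t. 0 < t \<Longrightarrow> t \<le> d \<Longrightarrow> M - \<psi> t \<le> L * t"
    and p: "-1 < p" "p < 0"
  shows "profile_mean M \<psi> p \<noteq> 0"
proof -
  have L0: "L \<ge> 0" using L[OF d order_refl] \<psi> d by (simp add: profile_def) (smt (verit) mult_neg_pos)
  have "weighted_int p (\<lambda>t. M - \<psi> t) \<le> weighted_int p (\<lambda>t. (if t \<le> d then L * t else 0) + max 0 (if t \<le> d then 0 else M))"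
    using L \<psi> M by (intro weighted_int_mono) (auto simp: profile_def)
  also have "\<dots> = weighted_int p (\<lambda>t. if t \<le> d then L * t else 0) + weighted_int p (\<lambda>t. if t \<le> d then 0 else M)"
    by (rule weighted_int_add[symmetric]) (use L0 in \<open>auto simp: set_borel_measurable_def\<close>)
  also have "weighted_int p (\<lambda>t. if t \<le> d then L * t else 0) = weighted_int (p + 1) (\<lambda>t. if t \<le> d then L else 0)"
    unfolding weighted_int_def
    by (intro nn_integral_cong) (use L0 in \<open>auto simp: indicator_def ennreal_mult'[symmetric] powr_diff\<close>)
  also have "\<dots> + weighted_int p (\<lambda>t. if t \<le> d then 0 else M) < \<infinity>"
    using p d L0 M by (simp add: weighted_int_step weighted_int_tail)
  finally show ?thesis using assms by (auto simp: profile_mean_eq_0_iff)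
qed

text \<open>A power of \<open>f x\<close> is the integral of its derivative over the levels up to
  \<open>f x\<close> if \<open>p > 0\<close>, and over the levels above \<open>f x\<close> with
  factor \<open>- p\<close> if \<open>p < 0\<close>. Interchanging the integrals leaves the measures
  of level sets.\<close>

lemma nn_integral_epowr_layer_cake:
  fixes N :: "'a measure" and f :: "'a \<Rightarrow> ennreal"
  assumes "finite_measure N" and [measurable]: "f \<in> borel_measurable N"
    and f: "AE x in N. 0 < f x \<and> f x < \<infinity>" and M: "M = measure N (space N)" "M > 0" and p: "p \<noteq> 0"
  shows "profile M (\<lambda>t. measure N {x\<in>space N. ennreal t \<le> f x})"
    and "(\<integral>\<^sup>+x. epowr (f x) p \<partial>N) / emeasure N (space N) = moment_int M (\<lambda>t. measure N {x\<in>space N. ennreal t \<le> f x}) p"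
proof -
  interpret finite_measure N by fact
  interpret P: pair_sigma_finite lborel N by standard
  define g where "g t = measure N {x\<in>space N. ennreal t \<le> f x}" for t
  show prof: "profile M (\<lambda>t. measure N {x\<in>space N. ennreal t \<le> f x})"
    unfolding profile_def M(1)
  proof safe
    fix s t :: real assume "0 < s" "s \<le> t"
    then show "measure N {x \<in> space N. ennreal t \<le> f x} \<le> measure N {x \<in> space N. ennreal s \<le> f x}"
      by (intro finite_measure_mono) (auto intro: order_trans ennreal_leI)
  qed (auto intro!: finite_measure_mono bounded_measure)
  \<comment> \<open>\<open>Q\<close> is here the relation between a level and a value:
    \<open>\<le>\<close> for positive exponents, the reversed strict one for negative exponents. One
    application of Fubini's theorem serves both.\<close>
  have swap: "(\<integral>\<^sup>+x. (\<integral>\<^sup>+t\<in>{0<..}. ennreal (t powr (p - 1)) * (indicator (S t) x) \<partial>lborel) \<partial>N) =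
      (\<integral>\<^sup>+t\<in>{0<..}. ennreal (t powr (p - 1)) * emeasure N (S t) \<partial>lborel)"
    if S: "\<And>t. S t = {x\<in>space N. Q (ennreal t) (f x)}" "Measurable.pred (lborel \<Otimes>\<^sub>M N) (\<lambda>y. Q (ennreal (fst y)) (f (snd y)))" for S and Q :: "ennreal \<Rightarrow> ennreal \<Rightarrow> bool"
  proof -
    have [measurable]: "{y \<in> space (lborel \<Otimes>\<^sub>M N). Q (ennreal (fst y)) (f (snd y))} \<in> sets (lborel \<Otimes>\<^sub>M N)"
      using S(2) unfolding pred_def by simp
    have St [measurable]: "S t \<in> sets N" for t
    proof -
      have "Measurable.pred N (\<lambda>x. Q (ennreal (fst (t, x))) (f (snd (t, x))))"
        by (rule measurable_compose[OF _ S(2)]) simp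
      then show ?thesis unfolding S(1) by simp
    qed
    have ind: "indicator (S t) x = (indicator {y \<in> space (lborel \<Otimes>\<^sub>M N). Q (ennreal (fst y)) (f (snd y))} (t, x) :: ennreal)"
      if "x \<in> space N" for t x using that by (auto simp: S(1) space_pair_measure split: split_indicator)
    have "(\<integral>\<^sup>+x. (\<integral>\<^sup>+t\<in>{0<..}. ennreal (t powr (p - 1)) * (indicator (S t) x) \<partial>lborel) \<partial>N) =
      (\<integral>\<^sup>+x. (\<integral>\<^sup>+t. ennreal (t powr (p - 1)) * indicator {y \<in> space (lborel \<Otimes>\<^sub>M N). Q (ennreal (fst y)) (f (snd y))} (t, x) * indicator {0<..} t \<partial>lborel) \<partial>N)"
      by (intro nn_integral_cong) (simp add: ind)
    also have "\<dots> = (\<integral>\<^sup>+t. (\<integral>\<^sup>+x. ennreal (t powr (p - 1)) * indicator {y \<in> space (lborel \<Otimes>\<^sub>M N). Q (ennreal (fst y)) (f (snd y))} (t, x) * indicator {0<..} t \<partial>N) \<partial>lborel)"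
      by (rule P.Fubini') measurable
    also have "\<dots> = (\<integral>\<^sup>+t. (\<integral>\<^sup>+x. ennreal (t powr (p - 1)) * indicator {0<..} t * indicator (S t) x \<partial>N) \<partial>lborel)"
      by (intro nn_integral_cong) (simp add: ind mult_ac)
    also have "\<dots> = (\<integral>\<^sup>+t\<in>{0<..}. ennreal (t powr (p - 1)) * emeasure N (S t) \<partial>lborel)"
      by (intro nn_integral_cong, subst nn_integral_cmult) (simp_all add: mult_ac)
    finally show ?thesis .
  qed
  have eN: "emeasure N (space N) = ennreal M" by (simp add: M emeasure_eq_measure)
  have "(\<integral>\<^sup>+x. epowr (f x) p \<partial>N) = ennreal M * moment_int M g p"
  proof (cases "p > 0")
    case True
    define S where "S t = {x\<in>space N. ennreal t \<le> f x}" for t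
    have "(\<integral>\<^sup>+x. epowr (f x) p \<partial>N) = (\<integral>\<^sup>+x. ennreal p * (\<integral>\<^sup>+t\<in>{0<..}. ennreal (t powr (p - 1)) * (indicator (S t) x) \<partial>lborel) \<partial>N)"
    proof (rule nn_integral_cong_AE, rule AE_mp[OF f], rule AE_I2, rule impI)
      fix x assume x: "x \<in> space N" and fx: "0 < f x \<and> f x < \<infinity>"
      then obtain a where a: "f x = ennreal a" "a > 0" by (cases "f x" rule: ennreal_cases_pos) auto
      have "epowr (f x) p = ennreal p * weighted_int p (\<lambda>t. if t \<le> a then 1 else 0)"
        using a True by (simp add: weighted_int_step epowr_ennreal ennreal_mult'[symmetric])
      also have "weighted_int p (\<lambda>t. if t \<le> a then 1 else 0) = (\<integral>\<^sup>+t\<in>{0<..}. ennreal (t powr (p - 1)) * (indicator (S t) x) \<partial>lborel)"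
        unfolding weighted_int_def S_def using a x by (intro nn_integral_cong) (auto simp: indicator_def)
      finally show "epowr (f x) p = ennreal p * (\<integral>\<^sup>+t\<in>{0<..}. ennreal (t powr (p - 1)) * (indicator (S t) x) \<partial>lborel)" .
    qed
    also have "\<dots> = ennreal p * (\<integral>\<^sup>+x. (\<integral>\<^sup>+t\<in>{0<..}. ennreal (t powr (p - 1)) * (indicator (S t) x) \<partial>lborel) \<partial>N)"
      unfolding S_def by (intro nn_integral_cmult) measurable
    also have "(\<integral>\<^sup>+x. (\<integral>\<^sup>+t\<in>{0<..}. ennreal (t powr (p - 1)) * (indicator (S t) x) \<partial>lborel) \<partial>N) = weighted_int p g"
      by (subst swap[of S "(\<le>)"]) (simp_all add: weighted_int_def g_def S_def emeasure_eq_measure)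
    also have "ennreal p * weighted_int p g = ennreal M * moment_int M g p"
      using True M(2) prof by (simp add: moment_int_pos profile_measurable g_def[abs_def] mult.assoc[symmetric] ennreal_mult'[symmetric])
    finally show ?thesis .
  next
    case False
    then have pn: "p < 0" using p by simp
    define S where "S t = {x\<in>space N. f x < ennreal t}" for t
    have "(\<integral>\<^sup>+x. epowr (f x) p \<partial>N) = (\<integral>\<^sup>+x. ennreal (- p) * (\<integral>\<^sup>+t\<in>{0<..}. ennreal (t powr (p - 1)) * (indicator (S t) x) \<partial>lborel) \<partial>N)"
    proof (rule nn_integral_cong_AE, rule AE_mp[OF f], rule AE_I2, rule impI)
      fix x assume x: "x \<in> space N" and fx: "0 < f x \<and> f x < \<infinity>"
      then obtain a where a: "f x = ennreal a" "a > 0" by (cases "f x" rule: ennreal_cases_pos) auto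
      have "ennreal (- p) * weighted_int p (\<lambda>t. if t \<le> a then 0 else 1) = ennreal ((- p) * (1 * a powr p / (- p)))"
        using a pn by (simp only: weighted_int_tail zero_le_one) (subst ennreal_mult', simp_all)
      then have "epowr (f x) p = ennreal (- p) * weighted_int p (\<lambda>t. if t \<le> a then 0 else 1)"
        using a pn by (simp add: epowr_ennreal)
      also have "weighted_int p (\<lambda>t. if t \<le> a then 0 else 1) = (\<integral>\<^sup>+t\<in>{0<..}. ennreal (t powr (p - 1)) * (indicator (S t) x) \<partial>lborel)"
        unfolding weighted_int_def S_def using a x by (intro nn_integral_cong) (auto simp: indicator_def ennreal_less_iff)
      finally show "epowr (f x) p = ennreal (- p) * (\<integral>\<^sup>+t\<in>{0<..}. ennreal (t powr (p - 1)) * (indicator (S t) x) \<partial>lborel)" .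
    qed
    also have "\<dots> = ennreal (- p) * (\<integral>\<^sup>+x. (\<integral>\<^sup>+t\<in>{0<..}. ennreal (t powr (p - 1)) * (indicator (S t) x) \<partial>lborel) \<partial>N)"
      unfolding S_def by (intro nn_integral_cmult) measurable
    also have "(\<integral>\<^sup>+x. (\<integral>\<^sup>+t\<in>{0<..}. ennreal (t powr (p - 1)) * (indicator (S t) x) \<partial>lborel) \<partial>N) = weighted_int p (\<lambda>t. M - g t)"
    proof -
      have "emeasure N (S t) = ennreal (M - g t)" for t
      proof -
        have "S t = space N - {x\<in>space N. ennreal t \<le> f x}" by (auto simp: S_def)
        then have "measure N (S t) = M - g t" unfolding M(1) g_def by (simp add: finite_measure_compl)
        then show ?thesis by (simp add: emeasure_eq_measure)
      qed
      then show ?thesis by (subst swap[of S "\<lambda>t y. y < t"]) (simp_all add: weighted_int_def S_def)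
    qed
    also have "ennreal (- p) * weighted_int p (\<lambda>t. M - g t) = ennreal M * moment_int M g p"
    proof -
      have "- p = M * (- p / M)" "0 \<le> - p / M" using M(2) pn by (auto simp: divide_nonpos_pos)
      then have "ennreal (- p) = ennreal M * ennreal (- p / M)" using M(2) by (metis ennreal_mult'' )
      then show ?thesis
        using M(2) prof by (simp add: moment_int_neg[OF pn] profile_measurable g_def[abs_def] mult.assoc)
    qed
    finally show ?thesis .
  qed
  then show "(\<integral>\<^sup>+x. epowr (f x) p \<partial>N) / emeasure N (space N) = moment_int M (\<lambda>t. measure N {x\<in>space N. ennreal t \<le> f x}) p"
    using M(2) unfolding eN g_def[abs_def] by (simp add: ennreal_mult_divide_eq mult.commute[of "ennreal M"])
qed

text \<open>The layer cake formula replaces integration by parts: for the exponential distribution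
  the moment is \<open>Gamma (1 + p)\<close> and the survival function is \<open>exp (- t)\<close>.
  This profile is the one belonging to \<open>Q = ln\<close>.\<close>

lemma moment_int_exp:
  assumes M: "M > 0" and p: "-1 < p" "p \<noteq> 0"
  shows "profile M (\<lambda>t. M * exp (- t))" and "moment_int M (\<lambda>t. M * exp (- t)) p = ennreal (Gamma (1 + p))"
proof -
  show prof: "profile M (\<lambda>t. M * exp (- t))" using M by (auto simp: profile_def)
  define N where "N = density lborel (\<lambda>t. ennreal (M * exp (- t)) * indicator {0<..} t)"
  have tail: "emeasure N {x\<in>space N. ennreal t \<le> ennreal x} = ennreal (M * exp (- t))" if "t \<ge> 0" for t
  proof -
    have [measurable]: "{x. ennreal t \<le> ennreal x} \<in> sets borel" by measurable
    have "((\<lambda>x. exp (- 1 * x) * M) has_integral exp (- 1 * t) / 1 * M) {t..}"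
      by (intro has_integral_mult_left has_integral_exp_minus_to_infinity) simp
    from nn_integral_has_integral_lebesgue'[OF _ this] M
    have "(\<integral>\<^sup>+x. ennreal (exp (- 1 * x) * M) * indicator {t..} x \<partial>lborel) = ennreal (M * exp (- t))"
      by (simp add: mult_ac)
    also have "(\<integral>\<^sup>+x. ennreal (exp (- 1 * x) * M) * indicator {t..} x \<partial>lborel) = emeasure N {x\<in>space N. ennreal t \<le> ennreal x}"
      unfolding N_def using that
      by (subst emeasure_density, simp, simp, intro nn_integral_cong_AE AE_mp[OF AE_lborel_singleton[of 0] AE_I2])
        (auto simp: indicator_def mult_ac ennreal_le_iff2)
    finally show ?thesis .
  qed
  have eN: "emeasure N (space N) = ennreal M" using tail[of 0] by simp
  interpret finite_measure N by standard (simp add: eN)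
  have MN: "M = measure N (space N)" using eN M by (simp add: measure_def)
  have "AE x in N. 0 < ennreal x \<and> ennreal x < \<infinity>"
    unfolding N_def by (subst AE_density) (auto simp: indicator_def)
  note lc = nn_integral_epowr_layer_cake[OF finite_measure_axioms _ this MN M p(2)]
  have "(\<integral>\<^sup>+x. epowr (ennreal x) p \<partial>N) = ennreal M * ennreal (Gamma (1 + p))"
  proof -
    have [measurable]: "(\<lambda>x. epowr (ennreal x) p) \<in> borel_measurable borel"
    proof -
      have "(\<lambda>x. epowr (ennreal x) p) = (\<lambda>x. if 0 < x then ennreal (x powr p) else epowr 0 p)"
        by (auto simp: epowr_ennreal ennreal_neg fun_eq_iff)
      then show ?thesis by simp
    qed
    have "(\<integral>\<^sup>+x. epowr (ennreal x) p \<partial>N) = (\<integral>\<^sup>+x. ennreal (x powr (1 + p - 1) / exp x * M) * indicator {0..} x \<partial>lborel)"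
      unfolding N_def
      by (subst nn_integral_density, simp, simp, intro nn_integral_cong_AE AE_mp[OF AE_lborel_singleton[of 0] AE_I2])
        (use M in \<open>auto simp: indicator_def epowr_ennreal ennreal_mult'[symmetric] exp_minus divide_inverse mult_ac\<close>)
    also have "\<dots> = ennreal (Gamma (1 + p) * M)"
      using M p by (intro nn_integral_has_integral_lebesgue' has_integral_mult_left Gamma_integral_real) auto
    finally show ?thesis using M by (simp add: ennreal_mult'[symmetric] mult.commute)
  qed
  then have "moment_int M (\<lambda>t. measure N {x\<in>space N. ennreal t \<le> ennreal x}) p = ennreal (Gamma (1 + p))"
    using lc(2) M unfolding eN by (simp add: N_def ennreal_mult_divide_eq mult.commute[of "ennreal M"])
  moreover have "moment_int M (\<lambda>t. measure N {x\<in>space N. ennreal t \<le> ennreal x}) p = moment_int M (\<lambda>t. M * exp (- t)) p"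
  proof -
    have "measure N {x\<in>space N. ennreal t \<le> ennreal x} = M * exp (- t)" if "t > 0" for t
      using tail[of t] that M by (simp add: measure_def)
    then show ?thesis unfolding moment_int_def
      by (auto intro!: nn_integral_cong simp: indicator_def)
  qed
  ultimately show "moment_int M (\<lambda>t. M * exp (- t)) p = ennreal (Gamma (1 + p))" by simp
qed

section \<open>The extended inverse of an increasing function\<close>

lemma Q_inv_apply:
  assumes "strict_mono_on {0<..M} Q" "0 < m" "m \<le> M"
  shows "Q_inv Q M (Q m) = m"
  using assms strict_mono_on_imp_inj_on[OF assms(1)] by (auto simp: Q_inv_def)

lemma Q_inv_bounds: "M > 0 \<Longrightarrow> 0 \<le> Q_inv Q M u \<and> Q_inv Q M u \<le> M"
  using inv_into_into[of u Q "{0<..M}"] by (auto simp: Q_inv_def)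

context
  fixes Q :: "real \<Rightarrow> real" and M :: real
  assumes Qmono: "strict_mono_on {0<..M} Q" and Qcont: "continuous_on {0<..M} Q" and M0: "0 < M"
begin

text \<open>Continuity fills the range of \<open>Q\<close> up to \<open>Q M\<close>, so for
  arguments up to \<open>Q M\<close> the default value 0 of \<open>Q_inv\<close> occurs only below
  the range.\<close>

lemma Q_range_upward:
  assumes "0 < m" "m \<le> M" "Q m \<le> u" "u \<le> Q M"
  obtains m' where "m \<le> m'" "m' \<le> M" "Q m' = u"
proof -
  have "continuous_on {m..M} Q" using Qcont by (rule continuous_on_subset) (use assms in auto)
  then show thesis using IVT'[of Q m u M] assms that by auto
qed

lemma le_Q_inv:
  assumes "0 < m" "m \<le> M" "Q m \<le> u" "u \<le> Q M"
  shows "m \<le> Q_inv Q M u"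
proof -
  obtain m' where m': "m \<le> m'" "m' \<le> M" "Q m' = u" using Q_range_upward[OF assms] .
  then show ?thesis using Q_inv_apply[OF Qmono, of m'] assms by auto
qed

lemma Q_Q_inv:
  assumes "Q_inv Q M u > 0" shows "Q (Q_inv Q M u) = u"
proof -
  have "u \<in> Q ` {0<..M}" using assms by (auto simp: Q_inv_def split: if_splits)
  then obtain m where "0 < m" "m \<le> M" "Q m = u" by auto
  then show ?thesis using Q_inv_apply[OF Qmono, of m] by auto
qed

lemma Q_inv_mono:
  assumes "u \<le> v" "v \<le> Q M" shows "Q_inv Q M u \<le> Q_inv Q M v"
proof (cases "Q_inv Q M u > 0")
  case True
  then show ?thesis using Q_Q_inv[OF True] Q_inv_bounds[OF M0, of Q u] assms
    by (intro le_Q_inv) auto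
next
  case False
  then show ?thesis using Q_inv_bounds[OF M0, of Q u] Q_inv_bounds[OF M0, of Q v] by auto
qed

lemma Q_inv_less:
  assumes "0 < m" "m \<le> M" "u < Q m" shows "Q_inv Q M u < m"
proof (rule ccontr)
  assume "\<not> Q_inv Q M u < m"
  then have *: "m \<le> Q_inv Q M u" by simp
  then have "Q m \<le> Q (Q_inv Q M u)"
    using strict_mono_on_leD[OF Qmono, of m] Q_inv_bounds[OF M0, of Q u] assms by auto
  then show False using Q_Q_inv[of u] * assms by auto
qed

lemma profile_Q_inv: "profile M (\<lambda>t. Q_inv Q M (Q M - t))"
  using Q_inv_bounds[OF M0] Q_inv_mono by (auto simp: profile_def)

lemma Q_inv_vanishes: "e > 0 \<Longrightarrow> \<exists>T>0. Q_inv Q M (Q M - T) < e"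
proof -
  assume e: "e > 0"
  define m where "m = min e M"
  have m: "0 < m" "m \<le> M" "m \<le> e" using e M0 by (auto simp: m_def)
  \<comment> \<open>The argument lies at least 1 below \<open>Q m\<close>, so the value is less than
    \<open>m\<close> whether or not the argument is still in the range of \<open>Q\<close>.\<close>
  have "Q_inv Q M (Q M - (max 0 (Q M - Q m) + 1)) < m" using m by (intro Q_inv_less) auto
  then show ?thesis using m by (intro exI[of _ "max 0 (Q M - Q m) + 1"]) auto
qed

lemma Q_inv_near:
  assumes "0 < m" "m < M" shows "\<forall>\<^sub>F t in at_right 0. m \<le> Q_inv Q M (Q M - t)"
proof -
  have "Q m < Q M" using Qmono assms by (auto simp: strict_mono_on_def)
  then have "\<forall>\<^sub>F t in at_right 0. t < Q M - Q m" by (intro eventually_at_right_real[THEN eventually_mono]) auto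
  with eventually_at_right_less[of "0::real"] show ?thesis
    by eventually_elim (use assms in \<open>auto intro!: le_Q_inv\<close>)
qed

lemma Q_inv_positive_somewhere: "\<exists>s>0. Q_inv Q M (Q M - s) > 0"
proof -
  have "\<forall>\<^sub>F t in at_right 0. 0 < t \<and> M / 2 \<le> Q_inv Q M (Q M - t)"
    using Q_inv_near[of "M / 2"] eventually_at_right_less[of "0::real"] M0 by (auto simp: eventually_conj_iff)
  then obtain t where "0 < t" "M / 2 \<le> Q_inv Q M (Q M - t)"
    using eventually_happens[of _ "at_right (0::real)"] by auto
  then show ?thesis using M0 by (intro exI[of _ t]) auto
qed

text \<open>Under \<open>Q\<close> the dilate becomes the line \<open>Q M - t / l\<close>. The bound
  in \<open>conc\<close> interpolates linearly between \<open>Q M\<close> at 0 and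
  \<open>Q (g s)\<close> at \<open>s\<close>; if the line is not above \<open>Q (g s)\<close> at
  \<open>s\<close>, it is not above this bound at \<open>r\<close>.\<close>

lemma dominates_from_right_Q_inv:
  assumes g: "profile M g"
    and conc: "\<And>r s. 0 < r \<Longrightarrow> r < s \<Longrightarrow> 0 < g s \<Longrightarrow>
      Q_inv Q M (r / s * Q (g s) + (1 - r / s) * Q M) \<le> g r"
  shows "dominates_from_right (\<lambda>t. Q_inv Q M (Q M - t)) g"
  unfolding dominates_from_right_def
proof (intro allI impI)
  fix l r s :: real assume *: "l > 0" "r > 0" "r < s" "Q_inv Q M (Q M - s / l) < g s"
  have gs: "0 < g s" "g s \<le> M"
    using * Q_inv_bounds[OF M0, of Q "Q M - s / l"] g by (auto simp: profile_def)
  have QM: "Q (g s) \<le> Q M" using strict_mono_on_leD[OF Qmono, of "g s" M] gs M0 by auto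
  have "Q M - s / l \<le> Q (g s)"
  proof (rule ccontr)
    assume "\<not> Q M - s / l \<le> Q (g s)"
    then have "g s \<le> Q_inv Q M (Q M - s / l)" using gs * by (intro le_Q_inv) auto
    then show False using * by simp
  qed
  then have "r / s * (Q M - s / l) + (1 - r / s) * Q M \<le> r / s * Q (g s) + (1 - r / s) * Q M"
    using * by (intro add_right_mono mult_left_mono) auto
  moreover have "r / s * (Q M - s / l) + (1 - r / s) * Q M = Q M - r / l"
    using * by (simp add: field_simps)
  moreover have "r / s * Q (g s) + (1 - r / s) * Q M \<le> r / s * Q M + (1 - r / s) * Q M"
    using * QM by (intro add_right_mono mult_left_mono) auto
  ultimately have "Q_inv Q M (Q M - r / l) \<le> Q_inv Q M (r / s * Q (g s) + (1 - r / s) * Q M)"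
    by (intro Q_inv_mono) (auto simp: algebra_simps)
  then show "Q_inv Q M (Q M - r / l) \<le> g r" using conc[of r s] * gs by linarith
qed

text \<open>Derivative of an inverse function at an endpoint. For small \<open>t\<close> the value
  \<open>Q_inv Q M (Q M - t)\<close> is positive, so \<open>Q\<close> maps it back to
  \<open>Q M - t\<close>; the quotient is then the reciprocal of a difference quotient of
  \<open>Q\<close> at a point tending to \<open>M\<close> from the left.\<close>

lemma Q_inv_slope:
  assumes D: "(Q has_real_derivative D) (at_left M)" "D > 0"
  shows "((\<lambda>t. (M - Q_inv Q M (Q M - t)) / t) \<longlongrightarrow> 1 / D) (at_right 0)"
proof -
  let ?\<psi> = "\<lambda>t. Q_inv Q M (Q M - t)"
  have pos: "\<forall>\<^sub>F t in at_right 0. 0 < t \<and> 0 < ?\<psi> t"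
    using Q_inv_near[of "M / 2"] eventually_at_right_less[of "0::real"] M0
    by (auto simp: eventually_conj_iff elim: eventually_mono)
  have lt: "?\<psi> t < M" if "t > 0" for t using that M0 by (intro Q_inv_less) auto
  have "filterlim ?\<psi> (at_left M) (at_right 0)"
  proof (rule filterlim_at_withinI)
    show "(?\<psi> \<longlongrightarrow> M) (at_right 0)"
    proof (rule order_tendstoI)
      fix a assume "a < M"
      then have "0 < (max a 0 + M) / 2" "(max a 0 + M) / 2 < M" "a < (max a 0 + M) / 2" using M0 by auto
      with Q_inv_near[of "(max a 0 + M) / 2"] show "\<forall>\<^sub>F t in at_right 0. a < ?\<psi> t"
        by (auto elim: eventually_mono)
    next
      fix a assume "M < a"
      then show "\<forall>\<^sub>F t in at_right 0. ?\<psi> t < a" using Q_inv_bounds[OF M0]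
        by (intro always_eventually allI) (meson le_less_trans)
    qed
    show "\<forall>\<^sub>F t in at_right 0. ?\<psi> t \<in> {..<M} - {M}"
      using eventually_at_right_less[of "0::real"] by eventually_elim (use lt in force)
  qed
  moreover have "((\<lambda>y. (Q y - Q M) / (y - M)) \<longlongrightarrow> D) (at_left M)"
    using D(1) by (simp add: has_field_derivative_iff)
  ultimately have "((\<lambda>t. (Q (?\<psi> t) - Q M) / (?\<psi> t - M)) \<longlongrightarrow> D) (at_right 0)"
    by (rule filterlim_compose[rotated])
  then have "((\<lambda>t. inverse ((Q (?\<psi> t) - Q M) / (?\<psi> t - M))) \<longlongrightarrow> inverse D) (at_right 0)"
    using D(2) by (intro tendsto_inverse) auto
  moreover have "\<forall>\<^sub>F t in at_right 0. inverse ((Q (?\<psi> t) - Q M) / (?\<psi> t - M)) = (M - ?\<psi> t) / t"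
    using pos by eventually_elim (use Q_Q_inv in \<open>auto simp: field_simps\<close>)
  ultimately show ?thesis using D(2)
    by (simp add: filterlim_cong inverse_eq_divide)
qed

lemma Q_inv_linear_bound:
  assumes D: "(Q has_real_derivative D) (at_left M)" "D > 0"
  shows "\<exists>d>0. \<forall>t. 0 < t \<longrightarrow> t \<le> d \<longrightarrow> M - Q_inv Q M (Q M - t) \<le> (1 / D + 1) * t"
proof -
  have "\<forall>\<^sub>F t in at_right 0. (M - Q_inv Q M (Q M - t)) / t < 1 / D + 1"
    using order_tendstoD(2)[OF Q_inv_slope[OF D]] by simp
  then obtain b where "b > 0" "\<And>t. 0 < t \<Longrightarrow> t < b \<Longrightarrow> (M - Q_inv Q M (Q M - t)) / t < 1 / D + 1"
    unfolding eventually_at_right_field by blast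
  then show ?thesis
    by (intro exI[of _ "b / 2"]) (force simp: field_simps)
qed

text \<open>If the bound failed at \<open>t\<close>, single crossing would put the dilate below
  \<open>g\<close> on all of (0, t). The dilate leaves \<open>M\<close> with slope
  \<open>D * c * (1 / D) = c\<close>, so \<open>M - g\<close> could not decay at the larger rate
  \<open>c'\<close> along \<open>1 / k\<close>.\<close>

lemma le_Q_inv_of_slope:
  assumes D: "(Q has_real_derivative D) (at_left M)" "D > 0"
    and dom: "dominates_from_right (\<lambda>t. Q_inv Q M (Q M - t)) g"
    and c: "0 < c" "c < c'" "\<forall>\<^sub>F k in sequentially. c' \<le> real k * (M - g (1 / real k))"
    and t: "t > 0"
  shows "g t \<le> Q_inv Q M (Q M - t / (1 / (D * c)))"
proof (rule ccontr)
  let ?\<psi> = "\<lambda>t. Q_inv Q M (Q M - t)"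
  assume "\<not> g t \<le> ?\<psi> (t / (1 / (D * c)))"
  then have below: "?\<psi> (r * (D * c)) \<le> g r" if "0 < r" "r < t" for r
    using dom[unfolded dominates_from_right_def, rule_format, of "1 / (D * c)" r t] that c D t by auto
  have "(\<lambda>k. D * c * (1 / real k)) \<longlonglongrightarrow> D * c * 0" by (intro tendsto_intros lim_1_over_n)
  then have lim0: "(\<lambda>k. D * c * (1 / real k)) \<longlonglongrightarrow> 0" by (simp only: mult_zero_right)
  have "\<forall>\<^sub>F k in sequentially. D * c * (1 / real k) \<in> {0<..} \<and> D * c * (1 / real k) \<noteq> 0"
    using eventually_gt_at_top[of 0] by eventually_elim (use D c in auto)
  then have "filterlim (\<lambda>k. D * c * (1 / real k)) (at_right 0) sequentially"
    unfolding filterlim_at using lim0 by (rule conjI)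
  then have "(\<lambda>k. (M - ?\<psi> (D * c * (1 / real k))) / (D * c * (1 / real k))) \<longlonglongrightarrow> 1 / D"
    by (rule filterlim_compose[OF Q_inv_slope[OF D]])
  then have "(\<lambda>k. D * c * ((M - ?\<psi> (D * c * (1 / real k))) / (D * c * (1 / real k)))) \<longlonglongrightarrow> D * c * (1 / D)"
    by (rule tendsto_mult_left)
  then have "\<forall>\<^sub>F k in sequentially. D * c * ((M - ?\<psi> (D * c * (1 / real k))) / (D * c * (1 / real k))) < c'"
    using c D by (intro order_tendstoD(2)[where y = "D * c * (1 / D)"]) auto
  moreover have "\<forall>\<^sub>F k in sequentially. 1 / real k < t"
    using order_tendstoD(2)[OF lim_1_over_n t] .
  ultimately have "\<forall>\<^sub>F k in sequentially. False"
    using c(3) eventually_gt_at_top[of 0]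
  proof eventually_elim
    case (elim k)
    have "real k * (M - g (1 / real k)) \<le> real k * (M - ?\<psi> (D * c * (1 / real k)))"
      using below[of "1 / real k"] elim by (intro mult_left_mono) (auto simp: mult_ac)
    moreover have "D * c * ((M - ?\<psi> (D * c * (1 / real k))) / (D * c * (1 / real k))) = real k * (M - ?\<psi> (D * c * (1 / real k)))"
      using c D elim by (simp add: field_simps)
    ultimately show False using elim by linarith
  qed
  then show False by simp
qed

end

section \<open>Lines entering a convex body\<close>

lemma nn_integral_lborel_translate:
  fixes f :: "'a::euclidean_space \<Rightarrow> ennreal"
  assumes [measurable]: "f \<in> borel_measurable borel"
  shows "(\<integral>\<^sup>+x. f (x + v) \<partial>lborel) = (\<integral>\<^sup>+x. f x \<partial>lborel)"
proof -
  have "(\<integral>\<^sup>+x. f x \<partial>lborel) = (\<integral>\<^sup>+x. f x \<partial>distr lborel borel ((+) v))" by (simp add: lborel_distr_plus)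
  also have "\<dots> = (\<integral>\<^sup>+x. f (v + x) \<partial>lborel)" by (rule nn_integral_distr) measurable
  finally show ?thesis by (simp add: add.commute)
qed

text \<open>The sets \<^term>\<open>{x \<in> \<Omega>. - r < F x \<and> F x \<le> 0}\<close> are fundamental domains for the translations by
  multiples of \<^term>\<open>r *\<^sub>R \<theta>\<close>. This replaces Fubini's theorem in the direction \<open>\<theta>\<close>.\<close>

definition slab :: "'a set \<Rightarrow> ('a \<Rightarrow> real) \<Rightarrow> real \<Rightarrow> 'a set" where
  "slab \<Omega> F r = {x \<in> \<Omega>. - r < F x \<and> F x \<le> 0}"

text \<open>\<open>F\<close> is thought of as the signed time still to be travelled in direction
  \<theta> to a reference surface, hence the minus sign.\<close>

definition along :: "'a::real_vector set \<Rightarrow> 'a \<Rightarrow> ('a \<Rightarrow> real) \<Rightarrow> bool" where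
  "along \<Omega> \<theta> F \<longleftrightarrow> (\<forall>x\<in>\<Omega>. \<forall>t. x + t *\<^sub>R \<theta> \<in> \<Omega> \<and> F (x + t *\<^sub>R \<theta>) = F x - t)"

lemma slab_measurable [measurable]:
  assumes [measurable]: "\<Omega> \<in> sets borel" "F \<in> borel_measurable borel"
  shows "slab \<Omega> F r \<in> sets borel"
  unfolding slab_def by measurable

text \<open>The first slab is cut according to the integer multiple of
  \<open>r *\<^sub>R \<theta>\<close> that separates a point from the second slab. Each piece
  \<open>A j\<close> is a translate of \<open>B j\<close>, and \<open>f\<close> does not notice the
  translation.\<close>

lemma nn_integral_slab_eq:
  fixes f :: "'a::euclidean_space \<Rightarrow> ennreal"
  assumes [measurable]: "\<Omega> \<in> sets borel" "F \<in> borel_measurable borel" "G \<in> borel_measurable borel" "f \<in> borel_measurable borel"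
    and F: "along \<Omega> \<theta> F" and G: "along \<Omega> \<theta> G" and f: "\<And>x t. x \<in> \<Omega> \<Longrightarrow> f (x + t *\<^sub>R \<theta>) = f x" and r: "r > 0"
  shows "(\<integral>\<^sup>+x\<in>slab \<Omega> F r. f x \<partial>lborel) = (\<integral>\<^sup>+x\<in>slab \<Omega> G r. f x \<partial>lborel)"
proof -
  define A where "A j = {x \<in> \<Omega>. - r < F x \<and> F x \<le> 0 \<and> - r < G x + of_int j * r \<and> G x + of_int j * r \<le> 0}" for j :: int
  define B where "B j = {x \<in> \<Omega>. - r < F x - of_int j * r \<and> F x - of_int j * r \<le> 0 \<and> - r < G x \<and> G x \<le> 0}" for j :: int
  have [measurable]: "A j \<in> sets borel" "B j \<in> sets borel" for j unfolding A_def B_def by measurable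
  have ex: "\<exists>j::int. - r < c + of_int j * r \<and> c + of_int j * r \<le> 0" for c
  proof (intro exI conjI)
    have "of_int \<lfloor>- c / r\<rfloor> \<le> - c / r" "- c / r < of_int \<lfloor>- c / r\<rfloor> + 1" by linarith+
    then have "of_int \<lfloor>- c / r\<rfloor> * r \<le> - c / r * r" "- c / r * r < (of_int \<lfloor>- c / r\<rfloor> + 1) * r"
      using r by (simp_all only: mult_right_mono[OF _ less_imp_le[OF r]] mult_strict_right_mono[OF _ r])
    then show "- r < c + of_int \<lfloor>- c / r\<rfloor> * r" "c + of_int \<lfloor>- c / r\<rfloor> * r \<le> 0"
      using r by (simp_all add: algebra_simps)
  qed
  have uniq: "i = j" if "- r < c + of_int i * r" "c + of_int i * r \<le> 0" "- r < c + of_int j * r" "c + of_int j * r \<le> 0"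
    for c and i j :: int
  proof -
    have "of_int (i - j) * r < 1 * r" "of_int (j - i) * r < 1 * r" using that by (auto simp: algebra_simps)
    then have "of_int (i - j) < (1::real)" "of_int (j - i) < (1::real)" using r by (meson mult_less_cancel_right_pos)+
    then show ?thesis by linarith
  qed
  have UA: "slab \<Omega> F r = (\<Union>j. A j)" unfolding A_def slab_def using ex by blast
  have "\<exists>j::int. - r < c - of_int j * r \<and> c - of_int j * r \<le> 0" for c
  proof -
    obtain j :: int where "- r < c + of_int j * r \<and> c + of_int j * r \<le> 0" using ex by blast
    then show ?thesis by (intro exI[of _ "- j"]) simp
  qed
  then have UB: "slab \<Omega> G r = (\<Union>j. B j)" unfolding B_def slab_def by blast
  have dA: "disjoint_family A" unfolding disjoint_family_on_def A_def using uniq by blast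
  have "i = j" if "- r < c - of_int i * r" "c - of_int i * r \<le> 0" "- r < c - of_int j * r" "c - of_int j * r \<le> 0"
    for c and i j :: int using uniq[of c "- i" "- j"] that by simp
  then have dB: "disjoint_family B" unfolding disjoint_family_on_def B_def by blast
  let ?M = "density lborel f"
  have eq: "emeasure ?M (A j) = emeasure ?M (B j)" for j
  proof -
    let ?v = "(of_int j * r) *\<^sub>R \<theta>"
    have AB: "x + ?v \<in> A j \<longleftrightarrow> x \<in> B j" for x
    proof
      assume "x \<in> B j" then show "x + ?v \<in> A j" using F G by (auto simp: along_def A_def B_def)
    next
      assume *: "x + ?v \<in> A j"
      then have "x + ?v + (- of_int j * r) *\<^sub>R \<theta> \<in> \<Omega>" using F unfolding along_def A_def by blast
      then have "x \<in> \<Omega>" by (simp add: algebra_simps)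
      then show "x \<in> B j" using * F G by (auto simp: along_def A_def B_def)
    qed
    have "emeasure ?M (A j) = (\<integral>\<^sup>+x. f x * indicator (A j) x \<partial>lborel)" by (simp add: emeasure_density)
    also have "\<dots> = (\<integral>\<^sup>+x. f (x + ?v) * indicator (A j) (x + ?v) \<partial>lborel)"
      by (rule nn_integral_lborel_translate[symmetric]) measurable
    also have "\<dots> = (\<integral>\<^sup>+x. f x * indicator (B j) x \<partial>lborel)"
      using f by (intro nn_integral_cong) (auto simp: indicator_def AB, auto simp: B_def)
    also have "\<dots> = emeasure ?M (B j)" by (simp add: emeasure_density)
    finally show ?thesis .
  qed
  have "emeasure ?M (slab \<Omega> F r) = (\<integral>\<^sup>+j. emeasure ?M (A j) \<partial>count_space UNIV)"
    unfolding UA using dA by (intro emeasure_UN_countable) auto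
  also have "\<dots> = (\<integral>\<^sup>+j. emeasure ?M (B j) \<partial>count_space UNIV)" by (simp only: eq)
  also have "\<dots> = emeasure ?M (slab \<Omega> G r)"
    unfolding UB using dB by (intro emeasure_UN_countable[symmetric]) auto
  finally show ?thesis by (simp add: emeasure_density)
qed

text \<open>\<open>k\<close> translates of the slab of thickness \<open>r\<close> are stacked. This
  relates thickness \<open>1 / j\<close> to thickness 1, and is the reason why only such thicknesses
  are used for shells.\<close>

lemma nn_integral_slab_mult:
  fixes f :: "'a::euclidean_space \<Rightarrow> ennreal"
  assumes [measurable]: "\<Omega> \<in> sets borel" "F \<in> borel_measurable borel" "f \<in> borel_measurable borel"
    and F: "along \<Omega> \<theta> F" and f: "\<And>x t. x \<in> \<Omega> \<Longrightarrow> f (x + t *\<^sub>R \<theta>) = f x" and r: "r > 0"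
  shows "(\<integral>\<^sup>+x\<in>slab \<Omega> F (real k * r). f x \<partial>lborel) = of_nat k * (\<integral>\<^sup>+x\<in>slab \<Omega> F r. f x \<partial>lborel)"
proof (induction k)
  case 0
  have "slab \<Omega> F 0 = {}" by (auto simp: slab_def)
  then show ?case by simp
next
  case (Suc k)
  define B where "B = {x \<in> \<Omega>. - (real k + 1) * r < F x \<and> F x \<le> - real k * r}"
  have [measurable]: "B \<in> sets borel" unfolding B_def by measurable
  have eq: "indicator (slab \<Omega> F (real (Suc k) * r)) x = (indicator (slab \<Omega> F (real k * r)) x + indicator B x :: ennreal)" for x
    using r by (auto simp: indicator_def slab_def B_def algebra_simps)
      (smt (verit) mult_nonneg_nonneg of_nat_0_le_iff)
  let ?v = "(real k * r) *\<^sub>R \<theta>"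
  have Fv: "F (x + ?v) = F x - real k * r" "x + ?v \<in> \<Omega>" if "x \<in> \<Omega>" for x
    using F that unfolding along_def by blast+
  have AB: "x + ?v \<in> B \<longleftrightarrow> x \<in> slab \<Omega> F r" for x
  proof
    assume "x \<in> slab \<Omega> F r" then show "x + ?v \<in> B" using Fv[of x] by (simp add: slab_def B_def algebra_simps)
  next
    assume *: "x + ?v \<in> B"
    then have "x + ?v + (- real k * r) *\<^sub>R \<theta> \<in> \<Omega>" using F unfolding along_def B_def by blast
    then have "x \<in> \<Omega>" by (simp add: algebra_simps)
    then show "x \<in> slab \<Omega> F r" using * Fv[of x] by (simp add: slab_def B_def algebra_simps)
  qed
  have "(\<integral>\<^sup>+x\<in>B. f x \<partial>lborel) = (\<integral>\<^sup>+x. f (x + ?v) * indicator B (x + ?v) \<partial>lborel)"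
    by (rule nn_integral_lborel_translate[symmetric]) measurable
  also have "\<dots> = (\<integral>\<^sup>+x\<in>slab \<Omega> F r. f x \<partial>lborel)"
    using f by (intro nn_integral_cong) (auto simp: indicator_def AB, auto simp: slab_def)
  finally have B: "(\<integral>\<^sup>+x\<in>B. f x \<partial>lborel) = (\<integral>\<^sup>+x\<in>slab \<Omega> F r. f x \<partial>lborel)" .
  have "(\<integral>\<^sup>+x\<in>slab \<Omega> F (real (Suc k) * r). f x \<partial>lborel) =
      (\<integral>\<^sup>+x. f x * indicator (slab \<Omega> F (real k * r)) x + f x * indicator B x \<partial>lborel)"
    by (intro nn_integral_cong) (simp only: eq distrib_left)
  also have "\<dots> = (\<integral>\<^sup>+x\<in>slab \<Omega> F (real k * r). f x \<partial>lborel) + (\<integral>\<^sup>+x\<in>B. f x \<partial>lborel)"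
    by (rule nn_integral_add) measurable
  finally show ?case using Suc by (simp add: B algebra_simps)
qed

section \<open>Entry time and entry point of a line\<close>

definition enter_dom :: "'a::euclidean_space set \<Rightarrow> 'a \<Rightarrow> 'a set" where
  "enter_dom K \<theta> = {x. \<exists>t. x + t *\<^sub>R \<theta> \<in> interior K}"

text \<open>The value 0 off the open set \<^term>\<open>enter_dom K \<theta>\<close> makes this a Borel function on the whole space.\<close>

definition enter_time :: "'a::euclidean_space set \<Rightarrow> 'a \<Rightarrow> 'a \<Rightarrow> real" where
  "enter_time K \<theta> x = (if x \<in> enter_dom K \<theta> then Inf {t. x + t *\<^sub>R \<theta> \<in> K} else 0)"

definition enter_pt :: "'a::euclidean_space set \<Rightarrow> 'a \<Rightarrow> 'a \<Rightarrow> 'a" where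
  "enter_pt K \<theta> x = x + enter_time K \<theta> x *\<^sub>R \<theta>"

text \<open>The points through which the lines of \<open>enter_dom\<close> enter. Asking the line to
  reach the interior discards lines that only touch \<open>K\<close>, and makes
  \<open>enter_dom\<close> open.\<close>

definition transversal :: "'a::euclidean_space set \<Rightarrow> 'a \<Rightarrow> 'a set" where
  "transversal K \<theta> = {y \<in> frontier K. \<exists>t>0. y + t *\<^sub>R \<theta> \<in> interior K}"

locale convex_direction =
  fixes K :: "'a::euclidean_space set" and \<theta> :: 'a
  assumes compact_K: "compact K" and convex_K: "convex K" and \<theta>: "\<theta> \<noteq> 0"
begin

abbreviation "\<Omega> \<equiv> enter_dom K \<theta>"
abbreviation "F \<equiv> enter_time K \<theta>"
abbreviation "\<pi> \<equiv> enter_pt K \<theta>"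
abbreviation "T \<equiv> transversal K \<theta>"

lemma enter_dom_translate: "x \<in> \<Omega> \<Longrightarrow> x + t *\<^sub>R \<theta> \<in> \<Omega>"
proof -
  assume "x \<in> \<Omega>"
  then obtain s where "x + s *\<^sub>R \<theta> \<in> interior K" by (auto simp: enter_dom_def)
  then have "(x + t *\<^sub>R \<theta>) + (s - t) *\<^sub>R \<theta> \<in> interior K" by (simp add: algebra_simps)
  then show ?thesis unfolding enter_dom_def by blast
qed

lemma enter_time_props:
  assumes "x \<in> \<Omega>"
  shows "\<pi> x \<in> K" and "\<And>t. x + t *\<^sub>R \<theta> \<in> K \<Longrightarrow> F x \<le> t"
proof -
  let ?S = "{t. x + t *\<^sub>R \<theta> \<in> K}"
  have ne: "?S \<noteq> {}" using assms interior_subset by (auto simp: enter_dom_def)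
  obtain B where B: "\<And>y. y \<in> K \<Longrightarrow> norm y \<le> B" using compact_imp_bounded[OF compact_K] by (auto simp: bounded_iff)
  have bdd: "bdd_below ?S"
  proof (rule bdd_belowI)
    fix t assume "t \<in> ?S"
    then have "norm (t *\<^sub>R \<theta>) \<le> B + norm x"
      using B[of "x + t *\<^sub>R \<theta>"] norm_triangle_ineq4[of "x + t *\<^sub>R \<theta>" x] by simp
    then have "\<bar>t\<bar> \<le> (B + norm x) / norm \<theta>" using \<theta> by (simp add: field_simps)
    then show "- ((B + norm x) / norm \<theta>) \<le> t" by linarith
  qed
  have "closed ((\<lambda>t. x + t *\<^sub>R \<theta>) -` K)"
    by (intro closed_vimage compact_imp_closed compact_K continuous_intros)
  then have "closed ?S" by (simp add: vimage_def)
  from closed_contains_Inf[OF ne bdd this] show "\<pi> x \<in> K" using assms by (simp add: enter_pt_def enter_time_def)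
  fix t assume "x + t *\<^sub>R \<theta> \<in> K"
  then show "F x \<le> t" using cInf_lower[OF _ bdd, of t] assms by (simp add: enter_time_def)
qed

lemma enter_time_translate:
  assumes "x \<in> \<Omega>" shows "F (x + t *\<^sub>R \<theta>) = F x - t"
proof (rule antisym)
  have "(x + t *\<^sub>R \<theta>) + (F x - t) *\<^sub>R \<theta> \<in> K"
    using enter_time_props(1)[OF assms] by (simp add: enter_pt_def algebra_simps)
  then show "F (x + t *\<^sub>R \<theta>) \<le> F x - t" by (rule enter_time_props(2)[OF enter_dom_translate[OF assms]])
  have "x + (t + F (x + t *\<^sub>R \<theta>)) *\<^sub>R \<theta> \<in> K"
    using enter_time_props(1)[OF enter_dom_translate[OF assms, of t]] by (simp add: enter_pt_def algebra_simps)
  then have "F x \<le> t + F (x + t *\<^sub>R \<theta>)" by (rule enter_time_props(2)[OF assms])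
  then show "F x - t \<le> F (x + t *\<^sub>R \<theta>)" by simp
qed

lemma along_enter_time: "along \<Omega> \<theta> F"
  unfolding along_def using enter_dom_translate enter_time_translate by blast

lemma enter_pt_translate: "x \<in> \<Omega> \<Longrightarrow> \<pi> (x + t *\<^sub>R \<theta>) = \<pi> x"
  by (simp add: enter_pt_def enter_time_translate algebra_simps)

lemma open_enter_dom: "open \<Omega>"
proof -
  have "\<Omega> = (\<Union>t. (\<lambda>x. x + t *\<^sub>R \<theta>) -` interior K)" by (auto simp: enter_dom_def)
  also have "open \<dots>" by (intro open_UN ballI open_vimage continuous_intros) auto
  finally show ?thesis .
qed

lemma convex_enter_dom: "convex \<Omega>"
proof (rule convexI)
  fix x y u v assume *: "x \<in> \<Omega>" "y \<in> \<Omega>" "0 \<le> (u::real)" "0 \<le> v" "u + v = 1"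
  then obtain s t where "x + s *\<^sub>R \<theta> \<in> interior K" "y + t *\<^sub>R \<theta> \<in> interior K" by (auto simp: enter_dom_def)
  then have "u *\<^sub>R (x + s *\<^sub>R \<theta>) + v *\<^sub>R (y + t *\<^sub>R \<theta>) \<in> interior K"
    using convexD[OF convex_interior[OF convex_K]] * by blast
  then have "(u *\<^sub>R x + v *\<^sub>R y) + (u * s + v * t) *\<^sub>R \<theta> \<in> interior K" by (simp add: algebra_simps)
  then show "u *\<^sub>R x + v *\<^sub>R y \<in> \<Omega>" unfolding enter_dom_def by blast
qed

lemma convex_on_enter_time: "convex_on \<Omega> F"
proof (rule convex_onI)
  fix t :: real and x y assume t: "0 < t" "t < 1" and xy: "x \<in> \<Omega>" "y \<in> \<Omega>"
  have dom: "(1 - t) *\<^sub>R x + t *\<^sub>R y \<in> \<Omega>" using convexD[OF convex_enter_dom xy, of "1 - t" t] t by simp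
  have "(1 - t) *\<^sub>R \<pi> x + t *\<^sub>R \<pi> y \<in> K"
    using convexD[OF convex_K enter_time_props(1)[OF xy(1)] enter_time_props(1)[OF xy(2)], of "1 - t" t] t by simp
  then have "((1 - t) *\<^sub>R x + t *\<^sub>R y) + ((1 - t) * F x + t * F y) *\<^sub>R \<theta> \<in> K"
    by (simp add: enter_pt_def algebra_simps)
  then show "F ((1 - t) *\<^sub>R x + t *\<^sub>R y) \<le> (1 - t) * F x + t * F y"
    by (rule enter_time_props(2)[OF dom])
qed (rule convex_enter_dom)

lemma continuous_on_enter_time: "continuous_on \<Omega> F"
  by (rule convex_on_continuous[OF open_enter_dom convex_on_enter_time])

lemma enter_dom_measurable [measurable]: "\<Omega> \<in> sets borel"
  using open_enter_dom by simp

lemma enter_time_measurable [measurable]: "F \<in> borel_measurable borel"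
proof -
  have "(\<lambda>x. indicator \<Omega> x *\<^sub>R F x) \<in> borel_measurable borel"
    by (rule borel_measurable_continuous_on_indicator[OF _ continuous_on_enter_time]) simp
  also have "(\<lambda>x. indicator \<Omega> x *\<^sub>R F x) = F" by (auto simp: indicator_def enter_time_def)
  finally show ?thesis .
qed

lemma enter_pt_measurable [measurable]: "\<pi> \<in> borel_measurable borel"
  unfolding enter_pt_def[abs_def] by measurable

lemma enter_pt_transversal:
  assumes "x \<in> \<Omega>" shows "\<pi> x \<in> T"
proof -
  obtain t where t: "x + t *\<^sub>R \<theta> \<in> interior K" using assms by (auto simp: enter_dom_def)
  have shrink: "\<exists>e>0. z - e *\<^sub>R \<theta> \<in> K" if z: "z \<in> interior K" for z
  proof -
    obtain e where e: "e > 0" "cball z e \<subseteq> K" using z unfolding mem_interior_cball by blast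
    then have "z - (e / norm \<theta>) *\<^sub>R \<theta> \<in> K" using \<theta> by (auto simp: subset_iff dist_norm)
    then show ?thesis using e \<theta> by (intro exI[of _ "e / norm \<theta>"]) auto
  qed
  have lt: "F x < s" if s: "x + s *\<^sub>R \<theta> \<in> interior K" for s
  proof -
    obtain e where "e > 0" "x + s *\<^sub>R \<theta> - e *\<^sub>R \<theta> \<in> K" using shrink[OF s] by blast
    then have "x + (s - e) *\<^sub>R \<theta> \<in> K" by (simp add: algebra_simps)
    then show ?thesis using enter_time_props(2)[OF assms, of "s - e"] \<open>e > 0\<close> by simp
  qed
  have "\<pi> x \<notin> interior K" using lt[of "F x"] by (auto simp: enter_pt_def)
  then have "\<pi> x \<in> frontier K"
    using enter_time_props(1)[OF assms] closure_subset by (auto simp: frontier_def)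
  moreover have "\<pi> x + (t - F x) *\<^sub>R \<theta> \<in> interior K" using t by (simp add: enter_pt_def algebra_simps)
  ultimately show ?thesis unfolding transversal_def using lt[OF t] by (auto intro!: exI[of _ "t - F x"])
qed

lemma frontier_subset_K: "frontier K \<subseteq> K"
  using compact_imp_closed[OF compact_K] frontier_subset_closed by blast

lemma transversal_enter_time:
  assumes "y \<in> T" shows "y \<in> \<Omega>" "F y = 0" "\<pi> y = y"
proof -
  obtain t where t: "t > 0" "y + t *\<^sub>R \<theta> \<in> interior K" and y: "y \<in> frontier K" using assms by (auto simp: transversal_def)
  show \<Omega>: "y \<in> \<Omega>" using t by (auto simp: enter_dom_def)
  have yK: "y \<in> K" using y frontier_subset_K by blast
  show "F y = 0"
  proof (rule ccontr)
    assume "F y \<noteq> 0"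
    then have neg: "F y < 0" using enter_time_props(2)[OF \<Omega>, of 0] yK by simp
    define e where "e = - F y / (t - F y)"
    have e: "0 < e" "e \<le> 1" using neg t by (auto simp: e_def field_simps)
    have "\<pi> y - e *\<^sub>R (\<pi> y - (y + t *\<^sub>R \<theta>)) \<in> interior K"
      by (rule mem_interior_convex_shrink[OF convex_K t(2) enter_time_props(1)[OF \<Omega>] e])
    also have "\<pi> y - e *\<^sub>R (\<pi> y - (y + t *\<^sub>R \<theta>)) = y + (F y + e * (t - F y)) *\<^sub>R \<theta>"
      by (simp add: enter_pt_def algebra_simps)
    also have "F y + e * (t - F y) = 0" using neg t by (simp add: e_def)
    finally show False using y by (simp add: frontier_def)
  qed
  then show "\<pi> y = y" by (simp add: enter_pt_def)
qed

text \<open>The hull of \<open>y\<close> and the ball about \<open>y + t *\<^sub>R \<theta>\<close>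
  gives the upper bound with slope \<open>t / d\<close>. For the lower bound, the segment from the
  entry point over \<open>y + w\<close> to the opposite point of the sphere meets the line through
  \<open>y\<close>, and cannot do so before \<open>y\<close>.\<close>

lemma enter_time_slope:
  assumes y: "y \<in> T" and t: "t > 0" and d: "d > 0" "cball (y + t *\<^sub>R \<theta>) d \<subseteq> K" and w: "norm w < d"
  shows "y + w \<in> \<Omega>" "\<bar>F (y + w)\<bar> \<le> t / d * norm w"
proof -
  have yK: "y \<in> K" using y frontier_subset_K by (auto simp: transversal_def)
  have "y + w + t *\<^sub>R \<theta> \<in> ball (y + t *\<^sub>R \<theta>) d" using w by (simp add: dist_norm norm_minus_commute)
  moreover have "ball (y + t *\<^sub>R \<theta>) d \<subseteq> interior K"
    by (rule interior_maximal) (use d ball_subset_cball in blast, simp)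
  ultimately show \<Omega>: "y + w \<in> \<Omega>" unfolding enter_dom_def by blast
  show "\<bar>F (y + w)\<bar> \<le> t / d * norm w"
  proof (cases "w = 0")
    case True then show ?thesis using transversal_enter_time[OF y] by simp
  next
    case False
    define l where "l = norm w / d"
    have l: "0 < l" "l \<le> 1" "norm (w /\<^sub>R l) = d" using False w d by (auto simp: l_def)
    have in1: "y + t *\<^sub>R \<theta> + w /\<^sub>R l \<in> K" "y + t *\<^sub>R \<theta> - w /\<^sub>R l \<in> K"
      using d l(3) by (auto intro!: subsetD[OF d(2)] simp: dist_norm)
    have "(1 - l) *\<^sub>R y + l *\<^sub>R (y + t *\<^sub>R \<theta> + w /\<^sub>R l) \<in> K"
      using l by (intro convexD[OF convex_K yK in1(1)]) auto
    also have "(1 - l) *\<^sub>R y + l *\<^sub>R (y + t *\<^sub>R \<theta> + w /\<^sub>R l) = (y + w) + (l * t) *\<^sub>R \<theta>"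
      using l by (simp add: algebra_simps)
    finally have up: "F (y + w) \<le> l * t" by (rule enter_time_props(2)[OF \<Omega>])
    have "(1 / (1 + l)) *\<^sub>R \<pi> (y + w) + (l / (1 + l)) *\<^sub>R (y + t *\<^sub>R \<theta> - w /\<^sub>R l) \<in> K"
      using l by (intro convexD[OF convex_K enter_time_props(1)[OF \<Omega>] in1(2)]) (auto simp: field_simps)
    also have "(1 / (1 + l)) *\<^sub>R \<pi> (y + w) + (l / (1 + l)) *\<^sub>R (y + t *\<^sub>R \<theta> - w /\<^sub>R l) =
        (1 / (1 + l)) *\<^sub>R (\<pi> (y + w) + (l *\<^sub>R (y + t *\<^sub>R \<theta>) - w))"
      using l by (simp add: scaleR_add_right scaleR_diff_right)
    also have "\<pi> (y + w) + (l *\<^sub>R (y + t *\<^sub>R \<theta>) - w) = (1 + l) *\<^sub>R y + (F (y + w) + l * t) *\<^sub>R \<theta>"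
      by (simp add: enter_pt_def algebra_simps)
    also have "(1 / (1 + l)) *\<^sub>R \<dots> = y + ((F (y + w) + l * t) / (1 + l)) *\<^sub>R \<theta>"
      using l by (simp add: scaleR_add_right)
    finally have "0 \<le> (F (y + w) + l * t) / (1 + l)"
      using enter_time_props(2)[OF transversal_enter_time(1)[OF y]] transversal_enter_time(2)[OF y] by metis
    then have "- (l * t) \<le> F (y + w)" using l by (simp add: zero_le_divide_iff)
    then show ?thesis using up by (simp add: l_def mult.commute)
  qed
qed

text \<open>The slab consists of the half-open segments \<open>y + [0, 1) \<theta>\<close> over
  transversal points \<open>y\<close>, so the image measure of a boundary set is the volume of the
  cylinder over it.\<close>

definition \<nu> :: "'a measure" where
  "\<nu> = distr (density lborel (indicator (slab \<Omega> F 1))) borel \<pi>"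

lemma sets_\<nu> [simp, measurable_cong]: "sets \<nu> = sets borel" and space_\<nu> [simp]: "space \<nu> = UNIV"
  by (simp_all add: \<nu>_def)

lemma slab_enter_time_measurable [measurable]: "slab \<Omega> F r \<in> sets borel"
  by (rule slab_measurable) measurable

lemma nn_integral_\<nu>:
  assumes [measurable]: "f \<in> borel_measurable borel"
  shows "(\<integral>\<^sup>+y. f y \<partial>\<nu>) = (\<integral>\<^sup>+x\<in>slab \<Omega> F 1. f (\<pi> x) \<partial>lborel)"
  unfolding \<nu>_def
  by (subst nn_integral_distr, simp, simp, subst nn_integral_density) (auto simp: mult.commute)

lemma emeasure_\<nu>:
  assumes [measurable]: "A \<in> sets borel"
  shows "emeasure \<nu> A = (\<integral>\<^sup>+x\<in>slab \<Omega> F 1. indicator A (\<pi> x) \<partial>lborel)"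
  using nn_integral_\<nu>[of "indicator A"] by simp

lemma finite_measure_\<nu>: "finite_measure \<nu>"
proof
  obtain B where B: "\<And>y. y \<in> K \<Longrightarrow> norm y \<le> B" using compact_imp_bounded[OF compact_K] by (auto simp: bounded_iff)
  have sub: "slab \<Omega> F 1 \<subseteq> cball 0 (B + norm \<theta>)"
  proof
    fix x assume x: "x \<in> slab \<Omega> F 1"
    have "x = \<pi> x - F x *\<^sub>R \<theta>" by (simp add: enter_pt_def)
    then have "norm x \<le> norm (\<pi> x) + norm (F x *\<^sub>R \<theta>)" by (metis norm_triangle_ineq4)
    also have "\<dots> \<le> B + 1 * norm \<theta>"
      unfolding norm_scaleR using x B enter_time_props(1) by (intro add_mono mult_right_mono) (auto simp: slab_def)
    finally show "x \<in> cball 0 (B + norm \<theta>)" by simp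
  qed
  have "emeasure \<nu> (space \<nu>) = emeasure lborel (slab \<Omega> F 1)" by (simp add: emeasure_\<nu>)
  also have "\<dots> \<le> emeasure lborel (cball 0 (B + norm \<theta>) :: 'a set)" by (rule emeasure_mono[OF sub]) simp
  also have "\<dots> < \<infinity>" using emeasure_bounded_finite[OF bounded_cball] by (simp add: less_top)
  finally show "emeasure \<nu> (space \<nu>) \<noteq> \<infinity>" by simp
qed

end

text \<open>At a point of \<^term>\<open>D\<close> the difference quotients of step \<open>s\<close> to the right and to the left differ by at
  least \<^term>\<open>c\<close>. The left quotients are translates of the right ones by \<open>s b\<close>, so their integrals over a ball
  differ only by the contribution of a shell of width \<open>s\<close>, which tends to 0.\<close>

lemma kink_set_null:
  fixes F :: "'a::euclidean_space \<Rightarrow> real"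
  assumes \<Omega>: "open \<Omega>" and conv: "convex_on \<Omega> F" and [measurable]: "F \<in> borel_measurable borel"
    and b: "norm b \<le> 1" and c: "c > 0"
  defines "D \<equiv> {x\<in>\<Omega>. \<forall>m::nat. 0 < m \<longrightarrow> x + (1 / real m) *\<^sub>R b \<in> \<Omega> \<longrightarrow> x - (1 / real m) *\<^sub>R b \<in> \<Omega> \<longrightarrow>
      c * (1 / real m) \<le> F (x + (1 / real m) *\<^sub>R b) + F (x - (1 / real m) *\<^sub>R b) - 2 * F x}"
  shows "negligible D" and "D \<in> sets borel"
proof -
  have [measurable]: "\<Omega> \<in> sets borel" using \<Omega> by simp
  show Dm [measurable]: "D \<in> sets borel" unfolding D_def by measurable
  have cont: "continuous_on \<Omega> F" by (rule convex_on_continuous[OF \<Omega> conv])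
  have local: "\<exists>\<rho>>0. negligible (D \<inter> ball x0 \<rho>)" if x0: "x0 \<in> D" for x0
  proof -
    have "x0 \<in> \<Omega>" using x0 by (simp add: D_def)
    then obtain r where r: "r > 0" "cball x0 r \<subseteq> \<Omega>" using \<Omega> open_contains_cball by blast
    define \<rho> where "\<rho> = r / 3"
    have \<rho>: "\<rho> > 0" "cball x0 (3 * \<rho>) \<subseteq> \<Omega>" using r by (auto simp: \<rho>_def)
    have "compact (F ` cball x0 (3 * \<rho>))"
      by (intro compact_continuous_image continuous_on_subset[OF cont \<rho>(2)] compact_cball)
    then obtain A where A: "\<And>x. x \<in> cball x0 (3 * \<rho>) \<Longrightarrow> \<bar>F x\<bar> \<le> A"
      using compact_imp_bounded by (fastforce simp: bounded_iff)
    have A0: "0 \<le> A" using A[of x0] \<rho> by force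
    \<comment> \<open>Lipschitz bound for a convex function: the oscillation \<open>2 * A\<close>
      divided by the distance \<rho> by which a segment can still be prolonged.\<close>
    define L where "L = 2 * A / \<rho>"
    have L0: "L \<ge> 0" using A0 \<rho> by (simp add: L_def)
    have in3: "x + t *\<^sub>R b \<in> cball x0 (3 * \<rho>)" if "dist x0 x \<le> 2 * \<rho>" "\<bar>t\<bar> \<le> \<rho>" for x t
    proof -
      have "norm (t *\<^sub>R b) \<le> \<rho>" using that b mult_mono[of "\<bar>t\<bar>" \<rho> "norm b" 1] by simp
      then have "dist x0 (x + t *\<^sub>R b) \<le> 2 * \<rho> + \<rho>"
        using that dist_triangle_le[of x0 x "x + t *\<^sub>R b" "3 * \<rho>"] by (simp add: dist_norm)
      then show ?thesis by simp
    qed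
    define B where "B = ball x0 \<rho>"
    define q where "q s x = (F (x + s *\<^sub>R b) - F x) / s" for s x
    have qL: "\<bar>q s x\<bar> \<le> L" if s: "0 < s" "s \<le> \<rho>" and x: "dist x0 x \<le> 2 * \<rho>" for s x
    proof -
      note pts = in3[OF x, of s] in3[OF x, of \<rho>] in3[OF x, of "- \<rho>"] in3[OF x, of 0]
      have \<Omega>pts: "x + s *\<^sub>R b \<in> \<Omega>" "x + \<rho> *\<^sub>R b \<in> \<Omega>" "x - \<rho> *\<^sub>R b \<in> \<Omega>" "x \<in> \<Omega>"
        using pts s \<rho> by auto
      have "F (x + s *\<^sub>R b) \<le> (1 - s / \<rho>) * F x + (s / \<rho>) * F (x + \<rho> *\<^sub>R b)"
        using convex_onD[OF conv, of "s / \<rho>" x "x + \<rho> *\<^sub>R b"] \<Omega>pts s \<rho> by (simp add: algebra_simps)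
      then have "F (x + s *\<^sub>R b) - F x \<le> (s / \<rho>) * (F (x + \<rho> *\<^sub>R b) - F x)" by (simp add: algebra_simps)
      also have "\<dots> \<le> (s / \<rho>) * (2 * A)"
        using A[OF pts(2)] A[OF pts(4)] s \<rho> by (intro mult_left_mono) auto
      finally have up: "q s x \<le> L" using s by (simp add: q_def L_def field_simps)
      define l where "l = s / (s + \<rho>)"
      have l: "0 \<le> l" "l \<le> 1" using s \<rho> by (auto simp: l_def)
      have xx: "(1 - l) *\<^sub>R (x + s *\<^sub>R b) + l *\<^sub>R (x - \<rho> *\<^sub>R b) = x"
      proof -
        have "(1 - l) * s = l * \<rho>" using s \<rho> by (simp add: l_def field_simps)
        moreover have "(1 - l) *\<^sub>R (x + s *\<^sub>R b) + l *\<^sub>R (x - \<rho> *\<^sub>R b) = x + ((1 - l) * s - l * \<rho>) *\<^sub>R b"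
          by (simp add: algebra_simps)
        ultimately show ?thesis by simp
      qed
      have "F x \<le> (1 - l) * F (x + s *\<^sub>R b) + l * F (x - \<rho> *\<^sub>R b)"
        using convex_onD[OF conv l \<Omega>pts(1,3)] by (simp only: xx)
      then have "(s + \<rho>) * F x \<le> (s + \<rho>) * ((1 - l) * F (x + s *\<^sub>R b) + l * F (x - \<rho> *\<^sub>R b))"
        using s \<rho> by (intro mult_left_mono) auto
      also have "\<dots> = \<rho> * F (x + s *\<^sub>R b) + s * F (x - \<rho> *\<^sub>R b)"
      proof -
        have "(s + \<rho>) * (1 - l) = \<rho>" "(s + \<rho>) * l = s" using s \<rho> by (simp_all add: l_def field_simps)
        then show ?thesis by (simp only: distrib_left mult.assoc[symmetric])
      qed
      finally have "- (\<rho> * (F (x + s *\<^sub>R b) - F x)) \<le> s * (F (x - \<rho> *\<^sub>R b) - F x)" by (simp add: algebra_simps)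
      also have "\<dots> \<le> s * (2 * A)"
        using A[OF pts(3)] A[OF pts(4)] s by (intro mult_left_mono) auto
      finally have "- L \<le> q s x" using s \<rho> by (simp add: q_def L_def field_simps)
      with up show ?thesis by linarith
    qed
    \<comment> \<open>\<open>q s (x - s *\<^sub>R b)\<close> is the left difference quotient at
      \<open>x\<close>. It never exceeds the right one, and is smaller by at least \<open>c\<close>
      on \<open>D\<close>.\<close>
    have kink: "q s (x - s *\<^sub>R b) + c * indicator D x \<le> q s x" if s: "s = 1 / real m" "0 < m" "s \<le> \<rho>" and x: "x \<in> B" for s m x
    proof -
      have dx: "dist x0 x \<le> 2 * \<rho>" using x \<rho> by (simp add: B_def)
      have s0: "0 < s" using s by simp
      have pts: "x + s *\<^sub>R b \<in> \<Omega>" "x - s *\<^sub>R b \<in> \<Omega>"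
        using in3[OF dx, of s] in3[OF dx, of "- s"] s \<rho> by auto
      have "(1 - 1/2) *\<^sub>R (x + s *\<^sub>R b) + (1/2) *\<^sub>R (x - s *\<^sub>R b) = x" by (simp add: algebra_simps scaleR_2[symmetric])
      then have "F x \<le> (1 - 1/2) * F (x + s *\<^sub>R b) + (1/2) * F (x - s *\<^sub>R b)"
        using convex_onD[OF conv _ _ pts, of "1/2"] by simp
      then have "0 \<le> F (x + s *\<^sub>R b) + F (x - s *\<^sub>R b) - 2 * F x" by simp
      moreover have "c * s \<le> F (x + s *\<^sub>R b) + F (x - s *\<^sub>R b) - 2 * F x" if "x \<in> D"
        using that pts s(2) unfolding D_def s(1) by blast
      ultimately have "c * indicator D x * s \<le> F (x + s *\<^sub>R b) + F (x - s *\<^sub>R b) - 2 * F x"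
        by (auto simp: indicator_def)
      then have "c * indicator D x \<le> (F (x + s *\<^sub>R b) + F (x - s *\<^sub>R b) - 2 * F x) / s"
        using s0 by (simp add: field_simps)
      also have "\<dots> = q s x - q s (x - s *\<^sub>R b)" using s0 by (simp add: q_def field_simps)
      finally show ?thesis by simp
    qed
    \<comment> \<open>Adding \<open>L\<close> makes the quotients nonnegative. The integral
      \<open>?I\<close> of the translated quotient then appears on both sides, is finite and
      cancels, leaving only the shell of width \<open>s\<close>.\<close>
    have bound: "ennreal c * emeasure lborel (D \<inter> B) \<le> ennreal (2 * L) * emeasure lborel (ball x0 \<rho> - ball x0 (\<rho> - s))"
      if s: "s = 1 / real m" "0 < m" "s \<le> \<rho>" for s m
    proof -
      have s0: "0 < s" using s by simp
      define B' where "B' = {x. x + s *\<^sub>R b \<in> B}"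
      have [measurable]: "B \<in> sets borel" "B' \<in> sets borel" unfolding B_def B'_def mem_ball by measurable
      have [measurable]: "ball x0 \<rho> - ball x0 (\<rho> - s) \<in> sets borel" by auto
      have [measurable]: "(\<lambda>x. q s x) \<in> borel_measurable borel" unfolding q_def by measurable
      let ?I = "\<integral>\<^sup>+x\<in>B'. ennreal (q s x + L) \<partial>lborel"
      have B2: "dist x0 x \<le> 2 * \<rho>" if "x \<in> B'" for x
      proof -
        have "s * norm b \<le> s" using b s0 by (simp add: mult_left_le)
        moreover have "dist (x + s *\<^sub>R b) x = s * norm b" using s0 by (simp add: dist_norm)
        ultimately have "dist (x + s *\<^sub>R b) x \<le> \<rho>" using s(3) by linarith
        then show ?thesis using that dist_triangle[of x0 x "x + s *\<^sub>R b"] by (simp add: B'_def B_def)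
      qed
      have fin: "?I \<noteq> \<infinity>"
      proof -
        have "?I \<le> (\<integral>\<^sup>+x. ennreal (2 * L) * indicator (cball x0 (2 * \<rho>)) x \<partial>lborel)"
          using B2 qL[OF s0 s(3)] by (intro nn_integral_mono) (force simp: indicator_def intro!: ennreal_leI)
        also have "\<dots> < \<infinity>" using emeasure_bounded_finite[OF bounded_cball, of x0 "2 * \<rho>"]
          by (simp add: nn_integral_cmult_indicator ennreal_mult_less_top)
        finally show ?thesis by simp
      qed
      have "ennreal c * emeasure lborel (D \<inter> B) + ?I =
          (\<integral>\<^sup>+x. ennreal c * indicator (D \<inter> B) x \<partial>lborel) + (\<integral>\<^sup>+x. ennreal (q s (x - s *\<^sub>R b) + L) * indicator B x \<partial>lborel)"
      proof (intro arg_cong2[where f = "(+)"])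
        have "(\<integral>\<^sup>+x. ennreal (q s (x - s *\<^sub>R b) + L) * indicator B x \<partial>lborel) =
          (\<integral>\<^sup>+x. ennreal (q s (x + s *\<^sub>R b - s *\<^sub>R b) + L) * indicator B (x + s *\<^sub>R b) \<partial>lborel)"
          by (rule nn_integral_lborel_translate[symmetric]) measurable
        then show "?I = (\<integral>\<^sup>+x. ennreal (q s (x - s *\<^sub>R b) + L) * indicator B x \<partial>lborel)"
          by (simp add: B'_def indicator_def)
      qed (simp add: nn_integral_cmult)
      also have "\<dots> = (\<integral>\<^sup>+x. ennreal c * indicator (D \<inter> B) x + ennreal (q s (x - s *\<^sub>R b) + L) * indicator B x \<partial>lborel)"
        by (rule nn_integral_add[symmetric]) measurable
      also have "\<dots> \<le> (\<integral>\<^sup>+x. ennreal (q s x + L) * indicator B' x + ennreal (2 * L) * indicator (ball x0 \<rho> - ball x0 (\<rho> - s)) x \<partial>lborel)"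
      proof (rule nn_integral_mono)
        fix x
        show "ennreal c * indicator (D \<inter> B) x + ennreal (q s (x - s *\<^sub>R b) + L) * indicator B x \<le>
          ennreal (q s x + L) * indicator B' x + ennreal (2 * L) * indicator (ball x0 \<rho> - ball x0 (\<rho> - s)) x"
        proof (cases "x \<in> B")
          case True
          have dx: "dist x0 x \<le> 2 * \<rho>" using True \<rho> by (simp add: B_def)
          have "x - s *\<^sub>R b \<in> B'" using True by (simp add: B'_def)
          then have "\<bar>q s (x - s *\<^sub>R b)\<bar> \<le> L" using qL[OF s0 s(3)] B2 by blast
          then have "ennreal c * indicator (D \<inter> B) x + ennreal (q s (x - s *\<^sub>R b) + L) * indicator B x =
              ennreal (c * indicator D x + (q s (x - s *\<^sub>R b) + L))"
            using True c by (auto simp: indicator_def ennreal_plus[symmetric] simp del: ennreal_plus)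
          also have "\<dots> \<le> ennreal (q s x + L)" using kink[OF s True] by (intro ennreal_leI) auto
          also have "\<dots> \<le> ennreal (q s x + L) * indicator B' x + ennreal (2 * L) * indicator (ball x0 \<rho> - ball x0 (\<rho> - s)) x"
          proof (cases "x \<in> B'")
            case False
            have "x \<notin> ball x0 (\<rho> - s)"
            proof
              assume "x \<in> ball x0 (\<rho> - s)"
              moreover have "dist x (x + s *\<^sub>R b) \<le> s" using b s0 by (simp add: dist_norm mult_left_le)
              ultimately have "x + s *\<^sub>R b \<in> ball x0 \<rho>" using dist_triangle[of x0 "x + s *\<^sub>R b" x] by simp
              then show False using False by (simp add: B'_def B_def)
            qed
            then show ?thesis using True False qL[OF s0 s(3) dx] by (auto simp: B_def intro!: ennreal_leI)
          qed auto
          finally show ?thesis .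
        qed auto
      qed
      also have "\<dots> = ?I + ennreal (2 * L) * emeasure lborel (ball x0 \<rho> - ball x0 (\<rho> - s))"
        by (subst nn_integral_add) (measurable, simp add: nn_integral_cmult_indicator)
      finally show ?thesis using fin
        by (auto simp: ennreal_add_left_cancel_le add.commute[of "ennreal c * emeasure lborel (D \<inter> B)"])
    qed
    have "(\<lambda>m. \<rho> - 1 / real m) \<longlonglongrightarrow> \<rho> - 0" by (intro tendsto_intros lim_1_over_n)
    then have "(\<lambda>m. 2 * L * (unit_ball_vol DIM('a) * (\<rho> ^ DIM('a) - (\<rho> - 1 / real m) ^ DIM('a)))) \<longlonglongrightarrow>
        2 * L * (unit_ball_vol DIM('a) * (\<rho> ^ DIM('a) - (\<rho> - 0) ^ DIM('a)))"
      by (intro tendsto_intros)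
    then have lim: "(\<lambda>m. ennreal (2 * L * (unit_ball_vol DIM('a) * (\<rho> ^ DIM('a) - (\<rho> - 1 / real m) ^ DIM('a))))) \<longlonglongrightarrow> ennreal 0"
      by (intro tendsto_ennrealI) simp
    have ev: "\<forall>\<^sub>F m in sequentially. ennreal c * emeasure lborel (D \<inter> B) \<le>
        ennreal (2 * L * (unit_ball_vol DIM('a) * (\<rho> ^ DIM('a) - (\<rho> - 1 / real m) ^ DIM('a))))"
      using order_tendstoD(2)[OF lim_1_over_n[where 'a = real] \<rho>(1)] eventually_gt_at_top[of 0]
    proof eventually_elim
      case (elim m)
      have "emeasure lborel (ball x0 \<rho> - ball x0 (\<rho> - 1 / real m)) = emeasure lborel (ball x0 \<rho>) - emeasure lborel (ball x0 (\<rho> - 1 / real m))"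
        using elim by (intro emeasure_Diff) (auto simp: subset_ball emeasure_ball)
      also have "\<dots> = ennreal (unit_ball_vol DIM('a) * (\<rho> ^ DIM('a) - (\<rho> - 1 / real m) ^ DIM('a)))"
        using elim \<rho> by (simp add: emeasure_ball ennreal_minus right_diff_distrib)
      finally show ?case using bound[of "1 / real m" m] elim L0 \<rho>
        by (simp add: ennreal_mult'[symmetric])
    qed
    have "ennreal c * emeasure lborel (D \<inter> B) \<le> ennreal 0"
      using tendsto_lowerbound[OF lim ev] by simp
    then have "emeasure lborel (D \<inter> B) = 0" using c by simp
    then have "D \<inter> B \<in> null_sets lborel" by (intro null_setsI) (auto simp: B_def)
    then have "negligible (D \<inter> B)" by (simp add: negligible_iff_null_sets null_sets_completionI)
    then show ?thesis using \<rho> by (auto simp: B_def)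
  qed
  have "\<exists>U. openin (top_of_set D) U \<and> x \<in> U \<and> negligible U" if x: "x \<in> D" for x
  proof -
    obtain \<rho> where "\<rho> > 0" "negligible (D \<inter> ball x \<rho>)" using local[OF x] by blast
    then show ?thesis
      using x by (intro exI[of _ "D \<inter> ball x \<rho>"]) (auto intro: openin_open_Int)
  qed
  then show "negligible D" by (subst locally_negligible_alt) blast
qed

section \<open>Volumes of oblique cylinders\<close>

text \<open>The coordinate along \<open>b0\<close> is split off from the product measure. The cross
  section is a ball in the remaining coordinates, whose volume is
  \<open>emeasure_cball_aux\<close>.\<close>

lemma emeasure_axis_cylinder:
  fixes b0 :: "'a::euclidean_space"
  assumes b0: "b0 \<in> Basis" and \<rho>: "\<rho> > 0" and h: "h > 0"
  shows "emeasure lborel {z::'a. 0 \<le> z \<bullet> b0 \<and> z \<bullet> b0 < h \<and> norm (z - (z \<bullet> b0) *\<^sub>R b0) \<le> \<rho>} =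
    ennreal (unit_ball_vol (real (DIM('a) - 1)) * \<rho> ^ (DIM('a) - 1) * h)"
proof -
  interpret product_sigma_finite "\<lambda>_::'a. lborel :: real measure" by standard
  define A where "A = Basis - {b0}"
  have A: "finite A" "b0 \<notin> A" "Basis = insert b0 A" "card A = DIM('a) - 1" using b0 by (auto simp: A_def)
  let ?C = "{z::'a. 0 \<le> z \<bullet> b0 \<and> z \<bullet> b0 < h \<and> norm (z - (z \<bullet> b0) *\<^sub>R b0) \<le> \<rho>}"
  have [measurable]: "?C \<in> sets borel" by measurable
  define P where "P = {f. sqrt (\<Sum>b\<in>A. (f b)\<^sup>2) \<le> \<rho>} \<inter> space (\<Pi>\<^sub>M b\<in>A. (lborel :: real measure))"
  have P [measurable]: "P \<in> sets (\<Pi>\<^sub>M b\<in>A. lborel)"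
  proof -
    have "{f \<in> space (\<Pi>\<^sub>M b\<in>A. (lborel :: real measure)). sqrt (\<Sum>b\<in>A. (f b)\<^sup>2) \<le> \<rho>} \<in> sets (\<Pi>\<^sub>M b\<in>A. lborel)"
      by measurable
    then show ?thesis unfolding P_def by (simp add: Int_def conj_commute)
  qed
  have coord: "(\<Sum>b\<in>Basis. f b *\<^sub>R b) \<in> ?C \<longleftrightarrow> 0 \<le> f b0 \<and> f b0 < h \<and> sqrt (\<Sum>b\<in>A. (f b)\<^sup>2) \<le> \<rho>" for f :: "'a \<Rightarrow> real"
  proof -
    have 1: "(\<Sum>b\<in>Basis. f b *\<^sub>R b) \<bullet> c = f c" if "c \<in> Basis" for c using that by simp
    let ?z = "\<Sum>b\<in>Basis. f b *\<^sub>R b"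
    have "norm (?z - (?z \<bullet> b0) *\<^sub>R b0) = sqrt (\<Sum>b\<in>Basis. ((?z - (?z \<bullet> b0) *\<^sub>R b0) \<bullet> b)\<^sup>2)"
      by (subst norm_eq_sqrt_inner, subst euclidean_inner) (simp add: power2_eq_square)
    also have "(\<Sum>b\<in>Basis. ((?z - (?z \<bullet> b0) *\<^sub>R b0) \<bullet> b)\<^sup>2) = (\<Sum>b\<in>A. (f b)\<^sup>2)"
    proof (rule sum.mono_neutral_cong_right)
      show "\<forall>b\<in>Basis - A. ((?z - (?z \<bullet> b0) *\<^sub>R b0) \<bullet> b)\<^sup>2 = 0" using b0 1 by (auto simp: A_def inner_diff_left)
      show "((?z - (?z \<bullet> b0) *\<^sub>R b0) \<bullet> b)\<^sup>2 = (f b)\<^sup>2" if "b \<in> A" for b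
        using that b0 1[of b] by (auto simp: A_def inner_diff_left inner_not_same_Basis)
    qed (auto simp: A_def)
    finally show ?thesis using 1[OF b0] by simp
  qed
  have "emeasure lborel ?C = emeasure (distr (\<Pi>\<^sub>M b\<in>Basis. lborel) borel (\<lambda>f. \<Sum>b\<in>Basis. f b *\<^sub>R b)) ?C"
    by (subst lborel_eq[symmetric]) simp
  also have "\<dots> = emeasure (\<Pi>\<^sub>M b\<in>Basis. lborel) ((\<lambda>f. \<Sum>b\<in>Basis. f b *\<^sub>R b) -` ?C \<inter> space (\<Pi>\<^sub>M b\<in>Basis. lborel))"
    by (rule emeasure_distr) measurable
  also have "\<dots> = (\<integral>\<^sup>+f. indicator ?C (\<Sum>b\<in>Basis. f b *\<^sub>R b) \<partial>(\<Pi>\<^sub>M b\<in>Basis. lborel))"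
    by (subst nn_integral_indicator[symmetric], measurable, intro nn_integral_cong) (auto simp: indicator_def)
  also have "\<dots> = (\<integral>\<^sup>+y. \<integral>\<^sup>+x. indicator ?C (\<Sum>b\<in>Basis. (x(b0 := y)) b *\<^sub>R b) \<partial>(\<Pi>\<^sub>M b\<in>A. lborel) \<partial>lborel)"
    unfolding A(3) using A(1,2) by (intro product_nn_integral_insert_rev) measurable
  also have "\<dots> = (\<integral>\<^sup>+(y::real). \<integral>\<^sup>+x. indicator {0..<h} y * indicator P x \<partial>(\<Pi>\<^sub>M b\<in>A. lborel) \<partial>lborel)"
  proof (intro nn_integral_cong)
    fix y :: real and x :: "'a \<Rightarrow> real" assume x: "x \<in> space (\<Pi>\<^sub>M b\<in>A. lborel)"
    have "(\<Sum>b\<in>A. ((x(b0 := y)) b)\<^sup>2) = (\<Sum>b\<in>A. (x b)\<^sup>2)" using A(2) by (intro sum.cong) auto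
    then show "indicator ?C (\<Sum>b\<in>Basis. (x(b0 := y)) b *\<^sub>R b) = (indicator {0..<h} y * indicator P x :: ennreal)"
      using x coord[of "x(b0 := y)"] by (auto simp: indicator_def P_def)
  qed
  also have "\<dots> = (\<integral>\<^sup>+(y::real). indicator {0..<h} y * emeasure (\<Pi>\<^sub>M b\<in>A. lborel) P \<partial>lborel)"
    by (intro nn_integral_cong) (simp add: nn_integral_cmult)
  also have "\<dots> = ennreal h * emeasure (\<Pi>\<^sub>M b\<in>A. lborel) P"
    using h by (simp add: nn_integral_multc)
  also have "\<dots> = ennreal (unit_ball_vol (real (DIM('a) - 1)) * \<rho> ^ (DIM('a) - 1) * h)"
    unfolding P_def emeasure_cball_aux[OF A(1) \<rho>] A(4) using h by (subst ennreal_mult'[symmetric]) (simp_all add: mult.commute)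
  finally show ?thesis .
qed

section \<open>Volume under isometries and shears\<close>

lemma nn_integral_indicator_comp:
  assumes [measurable]: "f \<in> borel_measurable borel" "A \<in> sets borel"
  shows "(\<integral>\<^sup>+x. indicator A (f x) \<partial>lborel) = emeasure lborel {x. f x \<in> A}"
proof -
  have "{x. f x \<in> A} \<in> sets lborel" using measurable_sets[OF assms] by (simp add: vimage_def)
  moreover have "(\<lambda>x. indicator A (f x)) = (indicator {x. f x \<in> A} :: _ \<Rightarrow> ennreal)"
    by (auto simp: indicator_def fun_eq_iff)
  ultimately show ?thesis by simp
qed

text \<open>Fubini's theorem applied to \<^term>\<open>\<lambda>(x, y). indicator A (L x + y) * indicator B y\<close>, with the
  translation invariance used in both variables.\<close>

lemma emeasure_linear_vimage:
  fixes L L' :: "'a::euclidean_space \<Rightarrow> 'a"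
  assumes L: "linear L" and inv: "\<And>y. L (L' y) = y" and [measurable]: "A \<in> sets borel" "B \<in> sets borel"
  shows "emeasure lborel {x. L x \<in> A} * emeasure lborel B = emeasure lborel A * emeasure lborel {x. - L x \<in> B}"
proof -
  have [measurable]: "L \<in> borel_measurable borel"
    by (intro borel_measurable_continuous_onI linear_continuous_on linear_conv_bounded_linear[THEN iffD1] L)
  have trans: "(\<integral>\<^sup>+x. f (L x + y) \<partial>lborel) = (\<integral>\<^sup>+x. f (L x) \<partial>lborel)"
    if [measurable]: "f \<in> borel_measurable borel" for f :: "'a \<Rightarrow> ennreal" and y
  proof -
    have "(\<integral>\<^sup>+x. f (L x) \<partial>lborel) = (\<integral>\<^sup>+x. f (L (x + L' y)) \<partial>lborel)"
      by (rule nn_integral_lborel_translate[symmetric, where f = "\<lambda>x. f (L x)"]) measurable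
    then show ?thesis by (simp add: linear_add[OF L] inv)
  qed
  have "emeasure lborel {x. L x \<in> A} * emeasure lborel B =
      (\<integral>\<^sup>+y. (\<integral>\<^sup>+x. indicator A (L x) \<partial>lborel) * indicator B y \<partial>lborel)"
  proof -
    have "emeasure lborel {x. L x \<in> A} = (\<integral>\<^sup>+x. indicator A (L x) \<partial>lborel)"
      by (rule nn_integral_indicator_comp[symmetric]) measurable
    then show ?thesis by (simp add: nn_integral_cmult)
  qed
  also have "\<dots> = (\<integral>\<^sup>+y. (\<integral>\<^sup>+x. indicator A (L x + y) * indicator B y \<partial>lborel) \<partial>lborel)"
    using trans[of "indicator A"] by (intro nn_integral_cong) (simp add: nn_integral_multc)
  also have "\<dots> = (\<integral>\<^sup>+x. (\<integral>\<^sup>+y. indicator A (L x + y) * indicator B y \<partial>lborel) \<partial>lborel)"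
    by (rule lborel_pair.Fubini'[symmetric]) measurable
  also have "\<dots> = (\<integral>\<^sup>+x. (\<integral>\<^sup>+y. indicator A y * indicator B (y - L x) \<partial>lborel) \<partial>lborel)"
  proof (rule nn_integral_cong)
    fix x
    show "(\<integral>\<^sup>+y. indicator A (L x + y) * indicator B y \<partial>lborel) = (\<integral>\<^sup>+y. indicator A y * (indicator B (y - L x) :: ennreal) \<partial>lborel)"
      using nn_integral_lborel_translate[of "\<lambda>y. indicator A y * indicator B (y - L x)" "L x"]
      by (simp add: add.commute)
  qed
  also have "\<dots> = (\<integral>\<^sup>+y. (\<integral>\<^sup>+x. indicator A y * indicator B (y - L x) \<partial>lborel) \<partial>lborel)"
    by (rule lborel_pair.Fubini') measurable
  also have "\<dots> = (\<integral>\<^sup>+y. indicator A y * (\<integral>\<^sup>+x. indicator B (- L x) \<partial>lborel) \<partial>lborel)"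
  proof (rule nn_integral_cong)
    fix y
    have "(\<integral>\<^sup>+x. indicator B (- (L x + (- y))) \<partial>lborel) = (\<integral>\<^sup>+x. (indicator B (- L x) :: ennreal) \<partial>lborel)"
      by (rule trans[of "\<lambda>z. indicator B (- z)"]) measurable
    then show "(\<integral>\<^sup>+x. indicator A y * indicator B (y - L x) \<partial>lborel) = indicator A y * (\<integral>\<^sup>+x. (indicator B (- L x) :: ennreal) \<partial>lborel)"
      by (simp add: nn_integral_cmult)
  qed
  also have "\<dots> = emeasure lborel A * (\<integral>\<^sup>+x. indicator B (- L x) \<partial>lborel)"
    by (simp add: nn_integral_multc)
  also have "(\<integral>\<^sup>+x. indicator B (- L x) \<partial>lborel) = emeasure lborel {x. - L x \<in> B}"
    by (rule nn_integral_indicator_comp) measurable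
  finally show ?thesis .
qed

lemma emeasure_ball_pos_finite:
  "0 < emeasure lborel (ball (0::'a::euclidean_space) 1)" "emeasure lborel (ball (0::'a) 1) \<noteq> \<infinity>"
  by (auto simp: emeasure_ball)

text \<open>With the unit ball as test set \<open>B\<close>, which an isometry preserves, the
  unknown factor in \<open>emeasure_linear_vimage\<close> is 1.\<close>

lemma emeasure_isometry_vimage:
  fixes L L' :: "'a::euclidean_space \<Rightarrow> 'a"
  assumes L: "linear L" and inv: "\<And>y. L (L' y) = y" and iso: "\<And>x. norm (L x) = norm x" and A: "A \<in> sets borel"
  shows "emeasure lborel {x. L x \<in> A} = emeasure lborel A"
proof -
  have "{x. - L x \<in> ball 0 1} = ball 0 1" using iso by (auto simp: dist_norm)
  then show ?thesis using emeasure_linear_vimage[OF L inv A, of "ball 0 1"] emeasure_ball_pos_finite[where 'a = 'a]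
    by (auto simp: mult.commute[of _ "emeasure lborel (ball 0 1)"] ennreal_mult_cancel_left)
qed

definition reflect :: "'a::euclidean_space \<Rightarrow> 'a \<Rightarrow> 'a" where
  "reflect v x = x - (2 * (x \<bullet> v) / (v \<bullet> v)) *\<^sub>R v"

lemma reflect_props:
  assumes "v \<noteq> 0"
  shows "linear (reflect v)" "reflect v (reflect v x) = x" "norm (reflect v x) = norm x"
    and "reflect v x \<bullet> y = x \<bullet> reflect v y"
proof -
  have vv: "v \<bullet> v \<noteq> 0" using assms by simp
  show "linear (reflect v)"
    by (rule linearI) (auto simp: reflect_def inner_add_left add_divide_distrib algebra_simps)
  show adj: "reflect v x \<bullet> y = x \<bullet> reflect v y" for x y
    by (simp add: reflect_def inner_diff_left inner_diff_right inner_commute)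
  show rr: "reflect v (reflect v x) = x" for x
  proof -
    have "reflect v x \<bullet> v = - (x \<bullet> v)" using vv by (simp add: reflect_def inner_diff_left)
    then show ?thesis unfolding reflect_def[of v "reflect v x"] by (simp add: reflect_def)
  qed
  show "norm (reflect v x) = norm x"
    using adj[of x "reflect v x"] by (simp add: norm_eq_sqrt_inner rr)
qed

lemma reflect_exchange:
  assumes "norm a = norm b" "a \<noteq> b" shows "reflect (a - b) a = b"
proof -
  have "a \<bullet> a = b \<bullet> b" using assms(1) by (simp add: norm_eq)
  then have "(a - b) \<bullet> (a - b) = 2 * (a \<bullet> (a - b))"
    by (simp add: inner_diff_left inner_diff_right inner_commute)
  moreover have "(a - b) \<bullet> (a - b) \<noteq> 0" using assms(2) by simp
  ultimately have "2 * (a \<bullet> (a - b)) / ((a - b) \<bullet> (a - b)) = 1" by simp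
  then show ?thesis unfolding reflect_def by (simp only: scaleR_one) simp
qed

text \<open>The reflection in \<^term>\<open>v\<close> conjugates the shear into its inverse, so its determinant squares to 1.\<close>

lemma emeasure_shear_vimage:
  fixes v n :: "'a::euclidean_space"
  assumes vn: "v \<bullet> n = 0" and A: "A \<in> sets borel"
  shows "emeasure lborel {x. x + (x \<bullet> n) *\<^sub>R v \<in> A} = emeasure lborel A"
proof (cases "v = 0")
  case False
  define S where "S x = x + (x \<bullet> n) *\<^sub>R v" for x
  have S: "linear S" unfolding S_def by (rule linearI) (auto simp: inner_add_left algebra_simps)
  have [measurable]: "S \<in> borel_measurable borel" unfolding S_def by measurable
  have SS: "S (y - (y \<bullet> n) *\<^sub>R v) = y" for y using vn by (simp add: S_def inner_diff_left)
  let ?r = "reflect v"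
  note r = reflect_props[OF False]
  have [measurable]: "?r \<in> borel_measurable borel" unfolding reflect_def by measurable
  define b where "b = emeasure lborel (ball (0::'a) 1)"
  \<comment> \<open>The quotient of \<open>k\<close> and \<open>b\<close> is the factor by which
    taking preimages under \<open>S\<close> scales volume.\<close>
  define k where "k = emeasure lborel {x. S x \<in> ball 0 1}"
  have b: "b \<noteq> 0" "b \<noteq> \<infinity>" using emeasure_ball_pos_finite[where 'a = 'a] by (auto simp: b_def)
  have neg: "{x. - S x \<in> ball 0 1} = {x. S x \<in> ball 0 1}" by (auto simp: dist_norm)
  have main: "emeasure lborel {x. S x \<in> C} * b = emeasure lborel C * k" if "C \<in> sets borel" for C
    using emeasure_linear_vimage[OF S SS that, of "ball 0 1"] neg by (simp add: b_def k_def)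
  have rS: "?r (S (?r x)) = x - (x \<bullet> n) *\<^sub>R v" for x
  proof -
    have "?r v = - v" using False by (simp add: reflect_def scaleR_2)
    moreover have "?r n = n" using vn by (simp add: reflect_def inner_commute)
    then have "?r x \<bullet> n = x \<bullet> n" by (simp add: r(4))
    ultimately show ?thesis by (simp add: S_def linear_add[OF r(1)] linear_scale[OF r(1)] r(2))
  qed
  let ?C = "{x. S x \<in> ball 0 1}"
  have Cm [measurable]: "?C \<in> sets borel" unfolding mem_ball by measurable
  have C2m [measurable]: "{x. ?r x \<in> ?C} \<in> sets borel" unfolding mem_ball mem_Collect_eq by measurable
  have C3m [measurable]: "{x. S x \<in> {x. ?r x \<in> ?C}} \<in> sets borel" unfolding mem_ball mem_Collect_eq by measurable
  have "{x. ?r x \<in> {x. S x \<in> {x. ?r x \<in> ?C}}} = ball 0 1"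
    using rS SS by auto
  then have "b = emeasure lborel {x. ?r x \<in> {x. S x \<in> {x. ?r x \<in> ?C}}}" by (simp add: b_def)
  also have "\<dots> = emeasure lborel {x. S x \<in> {x. ?r x \<in> ?C}}"
    by (rule emeasure_isometry_vimage[OF r(1,2,3) C3m])
  finally have "b * b = emeasure lborel {x. ?r x \<in> ?C} * k" using main[OF C2m] by simp
  also have "emeasure lborel {x. ?r x \<in> ?C} = k"
    using emeasure_isometry_vimage[OF r(1,2,3) Cm] by (simp add: k_def)
  finally have bk: "b * b = k * k" .
  have "k = b"
  proof -
    have "k \<noteq> \<infinity>" using bk b by (auto simp: ennreal_mult_eq_top_iff)
    then obtain b' k' where "b = ennreal b'" "k = ennreal k'" "0 \<le> b'" "0 \<le> k'"
      using b by (metis ennreal_cases infinity_ennreal_def)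
    moreover from this have "b' * b' = k' * k'" using bk by (simp add: ennreal_mult'[symmetric])
    ultimately show ?thesis by (metis abs_of_nonneg real_sqrt_abs2)
  qed
  then show ?thesis using main[OF A] b
    by (auto simp: S_def mult.commute[of _ b] ennreal_mult_cancel_left)
qed simp

text \<open>The oblique cylinder is reduced to an axis-parallel one by a shear and a reflection.\<close>

lemma emeasure_oblique_cylinder_pos:
  fixes n \<theta> :: "'a::euclidean_space"
  assumes n: "norm n = 1" and \<theta>: "\<theta> \<bullet> n > 0" and \<rho>: "\<rho> > 0"
  shows "emeasure lborel {x. 0 \<le> (x \<bullet> n) / (\<theta> \<bullet> n) \<and> (x \<bullet> n) / (\<theta> \<bullet> n) < 1 \<and>
      norm (x - ((x \<bullet> n) / (\<theta> \<bullet> n)) *\<^sub>R \<theta>) \<le> \<rho>} =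
    ennreal (unit_ball_vol (real (DIM('a) - 1)) * \<rho> ^ (DIM('a) - 1) * (\<theta> \<bullet> n))"
    (is "emeasure lborel ?S = _")
proof -
  obtain e :: 'a where e: "e \<in> Basis" using nonempty_Basis by blast
  define a where "a = \<theta> \<bullet> n"
  have a: "a > 0" using \<theta> by (simp add: a_def)
  have nn: "n \<bullet> n = 1" using n by (simp add: norm_eq_1)
  \<comment> \<open>The shear along \<open>v\<close> fixes the hyperplane orthogonal to
    \<open>n\<close> and sends \<open>n\<close> to \<open>\<theta> /\<^sub>R a\<close>, so it
    carries the right cylinder about \<open>n\<close> to the oblique one.\<close>
  define v where "v = \<theta> /\<^sub>R a - n"
  have vn: "v \<bullet> n = 0" using a nn by (simp add: v_def inner_diff_left a_def)
  define C where "C u = {x::'a. 0 \<le> x \<bullet> u \<and> x \<bullet> u < a \<and> norm (x - (x \<bullet> u) *\<^sub>R u) \<le> \<rho>}" for u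
  have C [measurable]: "C u \<in> sets borel" for u unfolding C_def by measurable
  have "{x. x + (x \<bullet> n) *\<^sub>R v \<in> ?S} = C n"
  proof -
    have "norm (x + (x \<bullet> n) *\<^sub>R v - ((x \<bullet> n) / a) *\<^sub>R \<theta>) = norm (x - (x \<bullet> n) *\<^sub>R n)" for x
      by (simp add: v_def algebra_simps divide_inverse)
    moreover have "(x + (x \<bullet> n) *\<^sub>R v) \<bullet> n = x \<bullet> n" for x using vn by (simp add: inner_add_left)
    ultimately show ?thesis using a by (auto simp: C_def a_def[symmetric] zero_le_divide_iff divide_less_eq)
  qed
  then have "emeasure lborel ?S = emeasure lborel (C n)"
    using emeasure_shear_vimage[OF vn, of ?S] by simp
  also have "\<dots> = emeasure lborel (C e)"
  proof (cases "e = n")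
    case False
    have ne: "norm e = 1" using e by simp
    have d0: "e - n \<noteq> 0" using False by simp
    note r = reflect_props[OF d0]
    have re: "reflect (e - n) e = n" using reflect_exchange[of e n] ne n False by simp
    then have rn: "reflect (e - n) n = e" using r(2) by metis
    have "{x. reflect (e - n) x \<in> C n} = C e"
    proof -
      have 1: "reflect (e - n) x \<bullet> n = x \<bullet> e" for x by (simp add: r(4) rn)
      have "reflect (e - n) x - (x \<bullet> e) *\<^sub>R n = reflect (e - n) (x - (x \<bullet> e) *\<^sub>R e)" for x
        by (simp add: linear_diff[OF r(1)] linear_scale[OF r(1)] re)
      then show ?thesis by (simp add: C_def 1 r(3))
    qed
    then show ?thesis using emeasure_isometry_vimage[OF r(1-3) C, of n] by simp
  qed simp
  also have "\<dots> = ennreal (unit_ball_vol (real (DIM('a) - 1)) * \<rho> ^ (DIM('a) - 1) * a)"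
    unfolding C_def by (rule emeasure_axis_cylinder[OF e \<rho> a])
  finally show ?thesis by (simp add: a_def)
qed

lemma emeasure_oblique_cylinder:
  fixes n \<theta> :: "'a::euclidean_space"
  assumes n: "norm n = 1" and \<theta>: "\<theta> \<bullet> n \<noteq> 0" and \<rho>: "\<rho> > 0"
  shows "emeasure lborel {x. 0 \<le> (x \<bullet> n) / (\<theta> \<bullet> n) \<and> (x \<bullet> n) / (\<theta> \<bullet> n) < 1 \<and>
      norm (x - ((x \<bullet> n) / (\<theta> \<bullet> n)) *\<^sub>R \<theta>) \<le> \<rho>} =
    ennreal (unit_ball_vol (real (DIM('a) - 1)) * \<rho> ^ (DIM('a) - 1) * \<bar>\<theta> \<bullet> n\<bar>)"
proof (cases "\<theta> \<bullet> n > 0")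
  case True then show ?thesis using emeasure_oblique_cylinder_pos[OF n True \<rho>] by simp
next
  case False
  then show ?thesis using emeasure_oblique_cylinder_pos[of "- n" \<theta> \<rho>] n \<theta> \<rho> by simp
qed

section \<open>Hausdorff measure and lower densities\<close>

lemma hausdorff_pre_le:
  fixes U :: "nat \<Rightarrow> 'a::metric_space set"
  assumes "A \<subseteq> (\<Union>i. U i)" and "\<And>i. bounded (U i)" and "\<And>i. diameter (U i) \<le> \<delta>"
  shows "hausdorff_pre d \<delta> A \<le> (\<Sum>i. hausdorff_weight d (U i))"
  unfolding hausdorff_pre_def by (rule INF_lower) (use assms in auto)

text \<open>\<open>measure_of\<close> yields the outer measure where that is countably additive on
  Borel sets and 0 otherwise; the inequality covers both cases.\<close>

lemma emeasure_hausdorff_measure_le: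
  "emeasure (hausdorff_measure d) A \<le> hausdorff_outer d (A :: 'a::metric_space set)"
  unfolding hausdorff_measure_def emeasure_measure_of_conv by simp

lemma sets_hausdorff_measure [simp, measurable_cong]:
  "sets (hausdorff_measure d) = sets (borel :: 'a::metric_space measure)"
  unfolding hausdorff_measure_def by (metis sets_measure_of_conv sets.sigma_sets_eq sets.space_closed space_borel)

lemma space_hausdorff_measure [simp]: "space (hausdorff_measure d) = (UNIV :: 'a::metric_space set)"
  unfolding hausdorff_measure_def by (simp add: space_measure_of_conv)

lemma hausdorff_weight_cball:
  fixes a :: "'a::euclidean_space"
  assumes "r > 0"
  shows "hausdorff_weight d (cball a r) = ennreal (unit_ball_vol (real d) * r ^ d)"
  using assms by (simp add: hausdorff_weight_def)

text \<open>A Vitali cover exhausts the set up to finitely many balls enlarged by the factor 5; since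
  the total weight of the disjoint balls is finite, the enlarged tail is negligible, so the sharp
  constant survives.\<close>

lemma hausdorff_pre_le_of_density:
  fixes \<nu> :: "'a::euclidean_space measure"
  assumes sets: "sets \<nu> = sets borel" and fin: "emeasure \<nu> U \<noteq> \<infinity>" and U: "open U" "E \<subseteq> U"
    and c: "c > 0" and \<delta>: "\<delta> > 0"
    and dens: "\<And>y \<epsilon>. y \<in> E \<Longrightarrow> \<epsilon> > 0 \<Longrightarrow>
        \<exists>s. 0 < s \<and> s < \<epsilon> \<and> ennreal (c * unit_ball_vol (real d) * s ^ d) \<le> emeasure \<nu> (cball y s)"
  shows "ennreal c * hausdorff_pre d \<delta> E \<le> emeasure \<nu> U"
proof -
  \<comment> \<open>Radius at most \<open>\<delta> / 10\<close> ensures that the fivefold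
    enlargement has diameter at most \<delta>.\<close>
  define K where "K = {(y, s). y \<in> E \<and> 0 < s \<and> s \<le> \<delta> / 10 \<and> cball y s \<subseteq> U \<and>
      ennreal (c * unit_ball_vol (real d) * s ^ d) \<le> emeasure \<nu> (cball y s)}"
  have fine: "\<exists>s. (y, s) \<in> K \<and> s < \<epsilon>" if y: "y \<in> E" and \<epsilon>: "\<epsilon> > 0" for y \<epsilon>
  proof -
    obtain e where e: "e > 0" "cball y e \<subseteq> U"
      using y U open_contains_cball by blast
    have "Min {\<epsilon>, e, \<delta> / 10} > 0" using \<epsilon> e \<delta> by simp
    from dens[OF y this] obtain s where s: "0 < s" "s < Min {\<epsilon>, e, \<delta> / 10}"
      "ennreal (c * unit_ball_vol (real d) * s ^ d) \<le> emeasure \<nu> (cball y s)" by blast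
    then have "cball y s \<subseteq> cball y e" by (simp add: subset_cball)
    then show ?thesis using s e y unfolding K_def by (intro exI[of _ s]) auto
  qed
  have Kr: "0 < snd i \<and> snd i \<le> \<delta> / 10" if "i \<in> K" for i using that by (auto simp: K_def)
  obtain C where C: "countable C" "C \<subseteq> K"
     "pairwise (\<lambda>i j. disjnt (cball (fst i) (snd i)) (cball (fst j) (snd j))) C"
     "\<And>i. i \<in> K \<Longrightarrow> \<exists>j. j \<in> C \<and> \<not> disjnt (cball (fst i) (snd i)) (cball (fst j) (snd j)) \<and>
                        cball (fst i) (snd i) \<subseteq> ball (fst j) (5 * snd j)"
    by (rule Vitali_covering_lemma_cballs_balls[where K = K and r = snd and B = "\<delta> / 10" and a = fst, OF Kr]) (assumption, rule that, assumption+)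
  define e where "e = to_nat_on C"
  define J where "J = e ` C"
  define f where "f = from_nat_into C"
  have inj: "inj_on e C" unfolding e_def by (rule inj_on_to_nat_on[OF C(1)])
  have fe: "f (e x) = x" if "x \<in> C" for x using that C(1) by (simp add: e_def f_def)
  have fJ: "f n \<in> C" if "n \<in> J" for n using that fe by (auto simp: J_def)
  have fK: "fst (f n) \<in> E" "0 < snd (f n)" "snd (f n) \<le> \<delta>/10" "cball (fst (f n)) (snd (f n)) \<subseteq> U"
      "ennreal (c * unit_ball_vol (real d) * snd (f n) ^ d) \<le> emeasure \<nu> (cball (fst (f n)) (snd (f n)))"
    if n: "n \<in> J" for n
  proof -
    obtain y s where "f n = (y, s)" "(y, s) \<in> K" using fJ[OF n] C(2) by (cases "f n") auto
    then show "fst (f n) \<in> E" "0 < snd (f n)" "snd (f n) \<le> \<delta>/10" "cball (fst (f n)) (snd (f n)) \<subseteq> U"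
      "ennreal (c * unit_ball_vol (real d) * snd (f n) ^ d) \<le> emeasure \<nu> (cball (fst (f n)) (snd (f n)))"
      by (simp_all add: K_def)
  qed
  have injf: "inj_on f J" using fe by (auto simp: J_def inj_on_def)
  \<comment> \<open>Indices outside \<open>J\<close> receive the empty set, of Hausdorff weight 0,
    so that a finite family \<open>C\<close> needs no separate treatment.\<close>
  define B where "B n = (if n \<in> J then cball (fst (f n)) (snd (f n)) else {})" for n
  define v where "v n = (if n \<in> J then unit_ball_vol (real d) * snd (f n) ^ d else 0)" for n
  have v0: "v n \<ge> 0" for n using fK(2)[of n] by (auto simp: v_def intro!: mult_nonneg_nonneg)
  have Bdisj: "disjoint_family B"
  proof -
    have "cball (fst (f m)) (snd (f m)) \<inter> cball (fst (f n)) (snd (f n)) = {}"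
      if "m \<noteq> n" "m \<in> J" "n \<in> J" for m n
      using C(3) fJ[OF that(2)] fJ[OF that(3)] inj_onD[OF injf _ that(2,3)] that(1)
      unfolding pairwise_def disjnt_def by blast
    then show ?thesis unfolding disjoint_family_on_def B_def by auto
  qed
  have Bsets: "range B \<subseteq> sets \<nu>" unfolding B_def sets by auto
  have "(\<Sum>n. ennreal c * ennreal (v n)) \<le> (\<Sum>n. emeasure \<nu> (B n))"
  proof (rule suminf_le)
    fix n show "ennreal c * ennreal (v n) \<le> emeasure \<nu> (B n)"
      using fK(5)[of n] c v0[of n] by (auto simp: v_def B_def ennreal_mult'[symmetric] mult.assoc)
  qed auto
  also have "\<dots> = emeasure \<nu> (\<Union>n. B n)" by (rule suminf_emeasure[OF Bsets Bdisj])
  also have "\<dots> \<le> emeasure \<nu> U"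
    by (rule emeasure_mono) (use fK(4) U sets in \<open>auto simp: B_def split: if_splits\<close>)
  finally have le: "ennreal c * (\<Sum>n. ennreal (v n)) \<le> emeasure \<nu> U" by simp
  then have "(\<Sum>n. ennreal (v n)) \<noteq> \<infinity>"
    using c fin by (auto simp: ennreal_mult_top top_unique)
  then have summ: "summable v" using v0
    by (intro summable_suminf_not_top) auto
  have sumv: "(\<Sum>n. ennreal (v n)) = ennreal (suminf v)" using v0 summ by (rule suminf_ennreal_eq[OF _ summable_sums])
  have step: "hausdorff_pre d \<delta> E \<le> ennreal (suminf v + 5 ^ d * (\<Sum>n. v (n + N)))" for N
  proof -
    define W where "W n = (if n \<in> J then cball (fst (f n)) (if n < N then snd (f n) else 5 * snd (f n)) else {})" for n
    define w where "w n = (if n < N then v n else 5 ^ d * v n)" for n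
    have "hausdorff_pre d \<delta> E \<le> (\<Sum>n. hausdorff_weight d (W n))"
    proof (rule hausdorff_pre_le)
      show "bounded (W n)" for n by (auto simp: W_def)
      show "diameter (W n) \<le> \<delta>" for n using fK[of n] \<delta> by (auto simp: W_def)
      show "E \<subseteq> (\<Union>n. W n)"
      proof
        fix z assume z: "z \<in> E"
        show "z \<in> (\<Union>n. W n)"
        \<comment> \<open>Outside the first \<open>N\<close> closed balls, \<open>z\<close> has an
          admissible ball missing all of them. The chosen ball that meets and absorbs it has index
          at least \<open>N\<close>, so it enters the cover enlarged.\<close>
        proof (cases "z \<in> (\<Union>n<N. B n)")
          case True then show ?thesis by (auto simp: B_def W_def split: if_splits)
        next
          case False
          have "closed (\<Union>n<N. B n)" by (intro closed_UN) (auto simp: B_def)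
          then have "open (- (\<Union>n<N. B n))" by (rule open_Compl)
          then obtain e1 where e1: "e1 > 0" "cball z e1 \<subseteq> - (\<Union>n<N. B n)"
            using False unfolding open_contains_cball by (meson ComplI)
          obtain s where s: "(z, s) \<in> K" "s < e1" using fine[OF z e1(1)] by auto
          from C(4)[OF s(1)] obtain j where j: "j \<in> C" "\<not> disjnt (cball z s) (cball (fst j) (snd j))"
            "cball z s \<subseteq> ball (fst j) (5 * snd j)" by auto
          define n where "n = e j"
          have n: "n \<in> J" "f n = j" using j fe by (auto simp: n_def J_def)
          have "cball z s \<subseteq> cball z e1" using s by (simp add: subset_cball)
          then have "\<not> n < N" using j(2) e1(2) n by (auto simp: B_def disjnt_def)
          moreover have "z \<in> cball z s" using s by (auto simp: K_def)
          moreover have "z \<in> ball (fst j) (5 * snd j)"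
            using j(3) \<open>z \<in> cball z s\<close> by blast
          ultimately have "z \<in> W n" using n by (auto simp: W_def)
          then show ?thesis by blast
        qed
      qed
    qed
    also have "\<dots> \<le> (\<Sum>n. ennreal (w n))"
      using fK by (intro suminf_le) (auto simp: w_def v_def W_def hausdorff_weight_cball power_mult_distrib mult_ac hausdorff_weight_def)
    also have "\<dots> = ennreal (suminf v + (5 ^ d - 1) * (\<Sum>n. v (n + N)))"
    proof -
      have "summable (\<lambda>n. v (n + N))" using summ by (simp add: summable_iff_shift)
      then have "(\<lambda>n. 5 ^ d * v (n + N)) sums (5 ^ d * (\<Sum>n. v (n + N)))" by (intro sums_mult summable_sums)
      then have "(\<lambda>n. w (n + N)) sums (5 ^ d * (\<Sum>n. v (n + N)))" by (simp add: w_def)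
      then have "w sums (5 ^ d * (\<Sum>n. v (n + N)) + (\<Sum>i<N. w i))" by (simp add: sums_iff_shift)
      moreover have "(\<Sum>i<N. w i) = (\<Sum>i<N. v i)" by (simp add: w_def)
      moreover have "suminf v = (\<Sum>n. v (n + N)) + (\<Sum>i<N. v i)" by (rule suminf_split_initial_segment[OF summ])
      ultimately have "w sums (suminf v + (5 ^ d - 1) * (\<Sum>n. v (n + N)))" by (simp add: algebra_simps)
      moreover have "0 \<le> w n" for n by (simp add: w_def v0)
      ultimately show ?thesis by (intro suminf_ennreal_eq) auto
    qed
    also have "\<dots> \<le> ennreal (suminf v + 5 ^ d * (\<Sum>n. v (n + N)))"
      using summ v0 by (intro ennreal_leI add_left_mono mult_right_mono suminf_nonneg) (auto simp: summable_iff_shift)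
    finally show ?thesis .
  qed
  have "(\<lambda>N. ennreal (suminf v + 5 ^ d * (\<Sum>n. v (n + N)))) \<longlonglongrightarrow> ennreal (suminf v + 5 ^ d * 0)"
    using suminf_exist_split2[OF summ] by (intro tendsto_intros)
  then have "hausdorff_pre d \<delta> E \<le> ennreal (suminf v)"
    using step by (intro LIMSEQ_le_const[where X = "\<lambda>N. ennreal (suminf v + 5 ^ d * (\<Sum>n. v (n + N)))"]) auto
  then have "ennreal c * hausdorff_pre d \<delta> E \<le> ennreal c * (\<Sum>n. ennreal (v n))"
    unfolding sumv by (intro mult_left_mono) auto
  also note le
  finally show ?thesis .
qed

text \<open>Outer regularity of the finite measure \<nu> shrinks the open set in the preceding
  estimate to \<open>E\<close>.\<close>

lemma hausdorff_measure_le_of_density: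
  fixes \<nu> :: "'a::euclidean_space measure"
  assumes sets: "sets \<nu> = sets borel" and fin: "finite_measure \<nu>" and E: "E \<in> sets borel"
    and c: "c > 0"
    and dens: "\<And>y \<epsilon>. y \<in> E \<Longrightarrow> \<epsilon> > 0 \<Longrightarrow>
        \<exists>s. 0 < s \<and> s < \<epsilon> \<and> ennreal (c * unit_ball_vol (real d) * s ^ d) \<le> emeasure \<nu> (cball y s)"
  shows "ennreal c * emeasure (hausdorff_measure d) E \<le> emeasure \<nu> E"
proof -
  interpret finite_measure \<nu> by fact
  have "ennreal c * hausdorff_outer d E \<le> emeasure \<nu> E"
  proof -
    have "ennreal c * hausdorff_outer d E = (SUP \<delta>\<in>{0<..}. ennreal c * hausdorff_pre d \<delta> E)"
      unfolding hausdorff_outer_def by (rule SUP_mult_left_ennreal)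
    also have "\<dots> \<le> (INF U \<in> {U. E \<subseteq> U \<and> open U}. emeasure \<nu> U)"
      by (intro SUP_least INF_greatest hausdorff_pre_le_of_density[OF sets _ _ _ c _ dens]) auto
    also have "\<dots> = emeasure \<nu> E"
      using outer_regular[of \<nu> E] sets E by simp
    finally show ?thesis .
  qed
  then show ?thesis
    by (meson emeasure_hausdorff_measure_le mult_left_mono order_trans zero_le)
qed

section \<open>Normals and densities at boundary points\<close>

definition normals :: "'a::euclidean_space set \<Rightarrow> 'a \<Rightarrow> 'a set" where
  "normals K y = {u. norm u = 1 \<and> (\<forall>x\<in>K. u \<bullet> (x - y) \<le> 0)}"

definition nonsmooth :: "'a::euclidean_space set \<Rightarrow> 'a set" where
  "nonsmooth K = {y \<in> frontier K. \<exists>u\<in>normals K y. \<exists>u'\<in>normals K y. u \<noteq> u'}"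

text \<open>A hyperplane separates the interior from the open ray; as the ray starts at
  \<open>y\<close>, the hyperplane passes through \<open>y\<close>. The choice \<open>v = 0\<close>
  gives a normal at every boundary point.\<close>

lemma normal_of_ray:
  fixes K :: "'a::euclidean_space set"
  assumes K: "convex K" "interior K \<noteq> {}" and y: "y \<in> K"
    and ray: "\<And>t. t > 0 \<Longrightarrow> y + t *\<^sub>R v \<notin> interior K"
  shows "\<exists>u\<in>normals K y. 0 \<le> u \<bullet> v"
proof -
  define R where "R = (\<lambda>t. y + t *\<^sub>R v) ` {0<..}"
  have "convex R" unfolding R_def
  proof (rule convexI)
    fix a b u w assume ab: "a \<in> (\<lambda>t. y + t *\<^sub>R v) ` {0<..}" "b \<in> (\<lambda>t. y + t *\<^sub>R v) ` {0<..}"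
      and uw: "0 \<le> (u::real)" "0 \<le> w" "u + w = 1"
    obtain s t where st: "s > 0" "t > 0" "a = y + s *\<^sub>R v" "b = y + t *\<^sub>R v" using ab by auto
    have "u *\<^sub>R a + w *\<^sub>R b = (u + w) *\<^sub>R y + (u * s + w * t) *\<^sub>R v" by (simp add: st algebra_simps)
    moreover have "u * s + w * t > 0" using st uw
      by (cases "u = 0") (auto intro: add_pos_nonneg)
    ultimately show "u *\<^sub>R a + w *\<^sub>R b \<in> (\<lambda>t. y + t *\<^sub>R v) ` {0<..}" using uw by auto
  qed
  moreover have "interior K \<inter> R = {}" "R \<noteq> {}" using ray by (auto simp: R_def)
  ultimately obtain a b where ab: "a \<noteq> 0" "\<And>x. x \<in> interior K \<Longrightarrow> a \<bullet> x \<le> b" "\<And>x. x \<in> R \<Longrightarrow> b \<le> a \<bullet> x"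
    using separating_hyperplane_sets[of "interior K" R] K convex_interior by blast
  have ray': "b \<le> a \<bullet> y + t * (a \<bullet> v)" if "t > 0" for t
    using ab(3)[of "y + t *\<^sub>R v"] that by (auto simp: R_def inner_add_right)
  have "K \<subseteq> closure (interior K)" using K convex_closure_interior closure_subset by blast
  moreover have "closure (interior K) \<subseteq> {x. a \<bullet> x \<le> b}"
    by (rule closure_minimal) (use ab closed_halfspace_le in auto)
  ultimately have Kle: "a \<bullet> x \<le> b" if "x \<in> K" for x using that by blast
  have aby: "b \<le> a \<bullet> y"
  proof (rule ccontr)
    assume "\<not> b \<le> a \<bullet> y"
    then have e: "b - a \<bullet> y > 0" by simp
    define t where "t = (b - a \<bullet> y) / (2 * (\<bar>a \<bullet> v\<bar> + 1))"
    have t: "t > 0" using e by (simp add: t_def)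
    have "t * (a \<bullet> v) \<le> t * (\<bar>a \<bullet> v\<bar> + 1)" using t by (intro mult_left_mono) auto
    also have "\<dots> = (b - a \<bullet> y) / 2" by (simp add: t_def field_simps)
    finally have "t * (a \<bullet> v) \<le> (b - a \<bullet> y) / 2" .
    moreover have "b - a \<bullet> y \<le> t * (a \<bullet> v)" using ray'[OF t] by simp
    ultimately have "b - a \<bullet> y \<le> (b - a \<bullet> y) / 2" by (rule order_trans[rotated])
    then show False using e by simp
  qed
  have "0 \<le> a \<bullet> v" using ray'[of 1] Kle[OF y] by simp
  moreover have "a /\<^sub>R norm a \<in> normals K y"
    unfolding normals_def using ab(1) Kle aby by (force simp: inner_diff_right divide_simps)
  ultimately show ?thesis by (intro bexI[of _ "a /\<^sub>R norm a"]) auto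
qed

lemma normals_nonempty:
  assumes "compact K" "convex K" "interior K \<noteq> {}" "y \<in> frontier K"
  shows "normals K y \<noteq> {}"
proof -
  have "y \<in> K" "y \<notin> interior K" using assms compact_imp_closed[of K] by (auto simp: frontier_def)
  then show ?thesis using normal_of_ray[of K y 0] assms by auto
qed

lemma smooth_ray_interior:
  assumes "convex K" "interior K \<noteq> {}" "y \<in> K" "normals K y = {n}" "v \<bullet> n < 0"
  shows "\<exists>t>0. y + t *\<^sub>R v \<in> interior K"
  using normal_of_ray[of K y v] assms by (force simp: inner_commute)

lemma ray_interior_mono:
  fixes K :: "'a::euclidean_space set"
  assumes "convex K" "y \<in> K" "y + t *\<^sub>R v \<in> interior K" "0 < s" "s \<le> t"
  shows "y + s *\<^sub>R v \<in> interior K"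
proof -
  have "y - (s / t) *\<^sub>R (y - (y + t *\<^sub>R v)) \<in> interior K"
    by (rule mem_interior_convex_shrink[OF assms(1,3,2)]) (use assms(4,5) in auto)
  then show ?thesis using assms by simp
qed

text \<open>At a point with a single normal every direction with negative product with it enters the
  interior. The vectors \<open>u + \<eta> *\<^sub>R \<theta>\<close> with \<open>u\<close> in the
  tangent unit disc form a compact set of such directions, so one step length serves all of
  them.\<close>

lemma smooth_uniform_interior:
  assumes K: "convex K" "interior K \<noteq> {}" and y: "y \<in> K" and n: "normals K y = {n}"
    and \<theta>: "\<theta> \<bullet> n < 0" and \<eta>: "\<eta> > 0"
  shows "\<exists>s0>0. \<forall>s u. 0 < s \<longrightarrow> s \<le> s0 \<longrightarrow> u \<bullet> n = 0 \<longrightarrow> norm u \<le> s \<longrightarrow> y + u + (\<eta> * s) *\<^sub>R \<theta> \<in> interior K"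
proof -
  define D where "D = (\<lambda>u. u + \<eta> *\<^sub>R \<theta>) ` (cball 0 1 \<inter> {u. n \<bullet> u = 0})"
  define V where "V m = (\<lambda>v. y + (1 / real (Suc m)) *\<^sub>R v) -` interior K" for m
  have "compact D" unfolding D_def
    by (intro compact_continuous_image continuous_intros compact_Int_closed compact_cball closed_hyperplane)
  moreover have "open (V m)" for m unfolding V_def by (intro open_vimage continuous_intros) auto
  moreover have Vmono: "V m \<subseteq> V m'" if "m \<le> m'" for m m'
    unfolding V_def using that ray_interior_mono[OF K(1) y] by (auto simp: frac_le)
  moreover have "D \<subseteq> (\<Union>m. V m)"
  proof
    fix v assume "v \<in> D"
    then obtain u where "v = u + \<eta> *\<^sub>R \<theta>" "n \<bullet> u = 0" by (auto simp: D_def)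
    then have "v \<bullet> n = \<eta> * (\<theta> \<bullet> n)" by (simp add: inner_add_left inner_commute[of u])
    then have "v \<bullet> n < 0" using \<theta> \<eta> by (simp add: mult_pos_neg)
    then obtain t where t: "t > 0" "y + t *\<^sub>R v \<in> interior K" using smooth_ray_interior[OF K y n] by blast
    obtain m where "1 / real (Suc m) < t" using t(1) nat_approx_posE by blast
    then show "v \<in> (\<Union>m. V m)" using ray_interior_mono[OF K(1) y t(2), of "1 / real (Suc m)"] by (auto simp: V_def)
  qed
  ultimately obtain C where C: "finite C" "D \<subseteq> (\<Union>m\<in>C. V m)"
    by (metis compactE_image)
  define m where "m = (if C = {} then 0 else Max C)"
  have "D \<subseteq> V m"
  proof
    fix v assume "v \<in> D"
    then obtain m' where m': "m' \<in> C" "v \<in> V m'" using C(2) by blast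
    then have "m' \<le> m" using C(1) by (auto simp: m_def)
    then show "v \<in> V m" using Vmono m'(2) by blast
  qed
  have "y + u + (\<eta> * s) *\<^sub>R \<theta> \<in> interior K" if s: "0 < s" "s \<le> 1 / real (Suc m)" and u: "u \<bullet> n = 0" "norm u \<le> s" for s u
  proof -
    have "u /\<^sub>R s + \<eta> *\<^sub>R \<theta> \<in> D" unfolding D_def using s u
      by (intro imageI) (auto simp: inner_commute divide_simps)
    then have "y + (1 / real (Suc m)) *\<^sub>R (u /\<^sub>R s + \<eta> *\<^sub>R \<theta>) \<in> interior K" using \<open>D \<subseteq> V m\<close> by (auto simp: V_def)
    from ray_interior_mono[OF K(1) y this s] show ?thesis using s by (simp add: algebra_simps)
  qed
  then show ?thesis by (intro exI[of _ "1 / real (Suc m)"]) auto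
qed

lemma normal_graph_compact:
  assumes "compact (K :: 'a::euclidean_space set)"
  shows "compact {(y, u). y \<in> frontier K \<and> u \<in> normals K y}"
proof -
  have "{(y, u). y \<in> frontier K \<and> u \<in> normals K y} =
    (frontier K \<times> sphere 0 1) \<inter> (\<Inter>x\<in>K. {p. snd p \<bullet> (x - fst p) \<le> 0})"
    by (auto simp: normals_def)
  also have "compact \<dots>"
    by (intro compact_Int_closed compact_Times compact_frontier assms compact_sphere closed_INT ballI
        closed_Collect_le continuous_intros)
  finally show ?thesis .
qed

text \<open>Points having two normals at distance at least \<open>1 / Suc m\<close> form a compact
  set, by compactness of the graph of the normals; the set in question is their countable
  union.\<close>

lemma nonsmooth_measurable:
  assumes K: "compact (K :: 'a::euclidean_space set)"
  shows "nonsmooth K \<in> sets borel"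
proof -
  let ?G = "{(y, u). y \<in> frontier K \<and> u \<in> normals K y}"
  define Z where "Z m = (fst \<circ> fst) ` ((?G \<times> ?G) \<inter> {p. fst (fst p) = fst (snd p)} \<inter>
      {p. 1 / real (Suc m) \<le> norm (snd (fst p) - snd (snd p))})" for m
  have "compact (Z m)" for m unfolding Z_def
    by (intro compact_continuous_image compact_Int_closed compact_Times normal_graph_compact[OF K]
        closed_Collect_le closed_Collect_eq continuous_intros continuous_on_compose) auto
  then have "Z m \<in> sets borel" for m by (simp add: compact_imp_closed)
  moreover have "nonsmooth K = (\<Union>m. Z m)"
  proof (intro equalityI subsetI)
    fix y assume "y \<in> nonsmooth K"
    then obtain u u' where u: "y \<in> frontier K" "u \<in> normals K y" "u' \<in> normals K y" "u \<noteq> u'" by (auto simp: nonsmooth_def)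
    then obtain m where "1 / real (Suc m) < norm (u - u')" using nat_approx_posE[of "norm (u - u')"] by auto
    then have "((y, u), (y, u')) \<in> (?G \<times> ?G) \<inter> {p. fst (fst p) = fst (snd p)} \<inter>
      {p. 1 / real (Suc m) \<le> norm (snd (fst p) - snd (snd p))}" using u by auto
    then have "y \<in> Z m" unfolding Z_def by (rule rev_image_eqI) simp
    then show "y \<in> (\<Union>m. Z m)" by blast
  next
    fix y assume "y \<in> (\<Union>m. Z m)"
    then obtain m u u' where "y \<in> frontier K" "u \<in> normals K y" "u' \<in> normals K y" "1 / real (Suc m) \<le> norm (u - u')"
      by (auto simp: Z_def)
    moreover from this have "u \<noteq> u'" by (auto simp: field_simps)
    ultimately show "y \<in> nonsmooth K" by (auto simp: nonsmooth_def)
  qed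
  ultimately show ?thesis by auto
qed

section \<open>Lower densities of the cylinder measure\<close>

context convex_direction
begin

text \<open>The lines through a disc about \<open>y\<close> orthogonal to \<open>n\<close> are
  sliced in two ways. By the height \<open>G\<close> over the disc they form an oblique cylinder of
  known volume; by \<open>F\<close> they lie over boundary points in \<open>cball y s\<close>. Here
  \<open>n\<close> may be any unit vector not orthogonal to \<theta>: it will be the normal for the
  sharp density and the direction of \<theta> for a crude one.\<close>

lemma \<nu>_cball_ge:
  assumes n: "norm n = 1" "\<theta> \<bullet> n \<noteq> 0" and \<rho>: "\<rho> > 0"
    and near: "\<And>u. u \<bullet> n = 0 \<Longrightarrow> norm u \<le> \<rho> \<Longrightarrow> y + u \<in> \<Omega> \<and> norm (\<pi> (y + u) - y) \<le> s"
  shows "ennreal (unit_ball_vol (real (DIM('a) - 1)) * \<rho> ^ (DIM('a) - 1) * \<bar>\<theta> \<bullet> n\<bar>) \<le> emeasure \<nu> (cball y s)"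
proof -
  define G where "G x = - (((x - y) \<bullet> n) / (\<theta> \<bullet> n))" for x
  define \<Omega>' where "\<Omega>' = {x. norm (x - y + G x *\<^sub>R \<theta>) \<le> \<rho>}"
  have [measurable]: "G \<in> borel_measurable borel" unfolding G_def by measurable
  have \<Omega>'m [measurable]: "\<Omega>' \<in> sets borel" unfolding \<Omega>'_def by measurable
  have Gt: "G (x + t *\<^sub>R \<theta>) = G x - t" for x t
    using n(2) by (simp add: G_def inner_diff_left inner_add_left field_simps)
  have \<Omega>': "x \<in> \<Omega>" "norm (\<pi> x - y) \<le> s" if "x \<in> \<Omega>'" for x
  proof -
    define u where "u = x - y + G x *\<^sub>R \<theta>"
    have "u \<bullet> n = 0" using n(2) by (simp add: u_def inner_add_left inner_diff_left G_def field_simps)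
    moreover have "norm u \<le> \<rho>" using that by (simp add: \<Omega>'_def u_def)
    ultimately have *: "y + u \<in> \<Omega>" "norm (\<pi> (y + u) - y) \<le> s" using near by auto
    have x: "x = (y + u) + (- G x) *\<^sub>R \<theta>" by (simp add: u_def)
    show "x \<in> \<Omega>" using enter_dom_translate[OF *(1)] x by metis
    show "norm (\<pi> x - y) \<le> s" using enter_pt_translate[OF *(1)] x *(2) by metis
  qed
  have al: "along \<Omega>' \<theta> F" "along \<Omega>' \<theta> G"
    unfolding along_def using \<Omega>' enter_time_translate by (auto simp: \<Omega>'_def Gt algebra_simps)
  have "ennreal (unit_ball_vol (real (DIM('a) - 1)) * \<rho> ^ (DIM('a) - 1) * \<bar>\<theta> \<bullet> n\<bar>) =
     emeasure lborel {x. 0 \<le> (x \<bullet> n) / (\<theta> \<bullet> n) \<and> (x \<bullet> n) / (\<theta> \<bullet> n) < 1 \<and>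
      norm (x - ((x \<bullet> n) / (\<theta> \<bullet> n)) *\<^sub>R \<theta>) \<le> \<rho>}" (is "_ = emeasure lborel ?S")
    by (rule emeasure_oblique_cylinder[OF n \<rho>, symmetric])
  also have "\<dots> = (\<integral>\<^sup>+x. indicator ?S x \<partial>lborel)" by simp
  also have "\<dots> = (\<integral>\<^sup>+x. indicator ?S (x + (- y)) \<partial>lborel)" by (rule nn_integral_lborel_translate[symmetric]) simp
  also have "\<dots> = (\<integral>\<^sup>+x\<in>slab \<Omega>' G 1. 1 \<partial>lborel)"
    by (intro nn_integral_cong) (auto simp: indicator_def slab_def \<Omega>'_def G_def)
  also have "\<dots> = (\<integral>\<^sup>+x\<in>slab \<Omega>' F 1. 1 \<partial>lborel)"
    by (rule nn_integral_slab_eq[OF _ _ _ _ al(2,1)]) auto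
  also have "\<dots> \<le> (\<integral>\<^sup>+x\<in>slab \<Omega> F 1. indicator (cball y s) (\<pi> x) \<partial>lborel)"
    by (intro nn_integral_mono) (use \<Omega>' in \<open>auto simp: indicator_def slab_def dist_norm norm_minus_commute\<close>)
  also have "\<dots> = emeasure \<nu> (cball y s)" by (rule emeasure_\<nu>[symmetric]) simp
  finally show ?thesis .
qed

text \<open>Over a tangent disc of radius \<rho> the boundary lies within \<open>\<eta> * s\<close>
  in direction \<theta>, so \<rho> smaller than \<open>s\<close> by
  \<open>\<eta> * norm \<theta> * s\<close> keeps it in \<open>cball y s\<close>. The strict
  inequality between \<open>c\<close> and the sharp density absorbs the loss once \<eta> is
  small.\<close>

lemma density_smooth:
  assumes int: "interior K \<noteq> {}" and y: "y \<in> frontier K" and n: "normals K y = {n}"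
    and c: "0 < c" "c < - (\<theta> \<bullet> n)"
  shows "\<exists>s0>0. \<forall>s. 0 < s \<longrightarrow> s \<le> s0 \<longrightarrow>
    ennreal (c * unit_ball_vol (real (DIM('a) - 1)) * s ^ (DIM('a) - 1)) \<le> emeasure \<nu> (cball y s)"
proof -
  have yK: "y \<in> K" using y frontier_subset_K by blast
  have nn: "n \<in> normals K y" using n by simp
  then have n1: "norm n = 1" by (simp add: normals_def)
  let ?d = "DIM('a) - 1"
  have "((\<lambda>\<eta>. (1 - \<eta> * norm \<theta>) ^ ?d * - (\<theta> \<bullet> n)) \<longlongrightarrow> (1 - 0 * norm \<theta>) ^ ?d * - (\<theta> \<bullet> n)) (at_right 0)"
    by (intro tendsto_intros)
  then have "\<forall>\<^sub>F \<eta> in at_right 0. c < (1 - \<eta> * norm \<theta>) ^ ?d * - (\<theta> \<bullet> n)"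
    using c by (intro order_tendstoD(1)) auto
  moreover have "\<forall>\<^sub>F \<eta> in at_right 0. \<eta> < 1 / norm \<theta>"
    using \<theta> by (intro eventually_at_right_real[THEN eventually_mono]) auto
  ultimately have "\<forall>\<^sub>F \<eta> in at_right 0. 0 < \<eta> \<and> \<eta> < 1 / norm \<theta> \<and> c < (1 - \<eta> * norm \<theta>) ^ ?d * - (\<theta> \<bullet> n)"
    using eventually_at_right_less[of "0::real"] by eventually_elim auto
  then obtain \<eta> where \<eta>: "0 < \<eta>" "\<eta> < 1 / norm \<theta>" "c < (1 - \<eta> * norm \<theta>) ^ ?d * - (\<theta> \<bullet> n)"
    using eventually_happens[of _ "at_right (0::real)"] by auto
  have \<eta>1: "0 < 1 - \<eta> * norm \<theta>" using \<eta>(2) \<theta> by (simp add: field_simps)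
  have neg: "\<theta> \<bullet> n < 0" using c by simp
  obtain s0 where s0: "s0 > 0" "\<And>s u. 0 < s \<Longrightarrow> s \<le> s0 \<Longrightarrow> u \<bullet> n = 0 \<Longrightarrow> norm u \<le> s \<Longrightarrow> y + u + (\<eta> * s) *\<^sub>R \<theta> \<in> interior K"
    using smooth_uniform_interior[OF convex_K int yK n neg \<eta>(1)] by blast
  have "ennreal (c * unit_ball_vol (real ?d) * s ^ ?d) \<le> emeasure \<nu> (cball y s)" if s: "0 < s" "s \<le> s0" for s
  proof -
    define \<rho> where "\<rho> = (1 - \<eta> * norm \<theta>) * s"
    have \<rho>: "\<rho> > 0" "\<rho> \<le> s" using \<eta>1 \<eta>(1) s by (auto simp: \<rho>_def mult_le_cancel_right1)
    have near: "y + u \<in> \<Omega> \<and> norm (\<pi> (y + u) - y) \<le> s" if u: "u \<bullet> n = 0" "norm u \<le> \<rho>" for u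
    proof -
      have in1: "y + u + (\<eta> * s) *\<^sub>R \<theta> \<in> interior K" using s0(2)[OF s u(1)] u(2) \<rho> by simp
      then have \<Omega>: "y + u \<in> \<Omega>" by (auto simp: enter_dom_def)
      have up: "F (y + u) \<le> \<eta> * s" using enter_time_props(2)[OF \<Omega>] in1 interior_subset by blast
      \<comment> \<open>The entry point stays on the inner side of the supporting hyperplane, so the
        entry time is nonnegative and needs only an upper bound.\<close>
      have "n \<bullet> (\<pi> (y + u) - y) \<le> 0" using nn enter_time_props(1)[OF \<Omega>] by (auto simp: normals_def)
      then have "F (y + u) * (\<theta> \<bullet> n) \<le> 0" using u(1) by (simp add: enter_pt_def inner_add_right inner_commute)
      then have low: "0 \<le> F (y + u)" using neg by (simp add: mult_le_0_iff)
      have "norm (\<pi> (y + u) - y) \<le> norm u + norm (F (y + u) *\<^sub>R \<theta>)"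
        using norm_triangle_ineq[of u "F (y + u) *\<^sub>R \<theta>"] by (simp add: enter_pt_def add.assoc)
      also have "\<dots> \<le> \<rho> + (\<eta> * s) * norm \<theta>"
        using u(2) up low by (auto intro!: add_mono mult_right_mono)
      also have "\<dots> = s" by (simp add: \<rho>_def algebra_simps)
      finally show ?thesis using \<Omega> by simp
    qed
    have "c * unit_ball_vol (real ?d) * s ^ ?d \<le> ((1 - \<eta> * norm \<theta>) ^ ?d * - (\<theta> \<bullet> n)) * unit_ball_vol (real ?d) * s ^ ?d"
      using \<eta>(3) s by (intro mult_right_mono) auto
    also have "\<dots> = unit_ball_vol (real ?d) * \<rho> ^ ?d * \<bar>\<theta> \<bullet> n\<bar>"
      using neg by (simp add: \<rho>_def power_mult_distrib)
    finally have "ennreal (c * unit_ball_vol (real ?d) * s ^ ?d) \<le> ennreal (unit_ball_vol (real ?d) * \<rho> ^ ?d * \<bar>\<theta> \<bullet> n\<bar>)"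
      by (rule ennreal_leI)
    also have "\<dots> \<le> emeasure \<nu> (cball y s)"
      using \<nu>_cball_ge[OF n1 _ \<rho>(1) near] neg by auto
    finally show ?thesis .
  qed
  then show ?thesis using s0(1) by blast
qed

text \<open>Compact pieces of the transversal set with uniform geometry: step
  \<open>1 / Suc k\<close> and its square as radius make \<open>F\<close> have slope at most
  \<open>Suc k\<close> near every point of the piece.\<close>

definition T_part :: "nat \<Rightarrow> 'a set" where
  "T_part k = {y \<in> frontier K. cball (y + (1 / real (Suc k)) *\<^sub>R \<theta>) (1 / real (Suc k) ^ 2) \<subseteq> K}"

lemma T_part_subset: "T_part k \<subseteq> T"
proof
  fix y assume y: "y \<in> T_part k"
  then have "y + (1 / real (Suc k)) *\<^sub>R \<theta> \<in> interior K"
    unfolding mem_interior_cball T_part_def by (auto intro!: exI[of _ "1 / real (Suc k) ^ 2"])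
  then show "y \<in> T" using y by (auto simp: transversal_def T_part_def intro!: exI[of _ "1 / real (Suc k)"])
qed

lemma compact_T_part: "compact (T_part k)"
proof -
  let ?v = "(1 / real (Suc k)) *\<^sub>R \<theta>"
  have "T_part k = frontier K \<inter> (\<Inter>w\<in>cball 0 (1 / real (Suc k) ^ 2). (\<lambda>y. y + (?v + w)) -` K)"
  proof -
    have "cball (y + ?v) r \<subseteq> K \<longleftrightarrow> (\<forall>w\<in>cball 0 r. y + (?v + w) \<in> K)" for y r
    proof -
      have "cball (y + ?v) r = (\<lambda>w. (y + ?v) + w) ` cball 0 r" by (simp add: image_add_cball)
      then show ?thesis by (auto simp: add.assoc)
    qed
    then show ?thesis by (auto simp: T_part_def)
  qed
  also have "compact \<dots>"
    by (intro compact_Int_closed compact_frontier compact_K closed_INT ballI closed_vimage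
        compact_imp_closed continuous_intros)
  finally show ?thesis .
qed

text \<open>Contraction with centre \<open>y\<close> and ratio \<open>b / t\<close> maps the given
  ball into \<open>K\<close> by convexity.\<close>

lemma cball_ray_shrink:
  assumes yK: "y \<in> K" and sub: "cball (y + t *\<^sub>R \<theta>) d \<subseteq> K" and b: "0 < b" "b \<le> t" and r: "r * t \<le> b * d"
  shows "cball (y + b *\<^sub>R \<theta>) r \<subseteq> K"
proof
  fix z assume "z \<in> cball (y + b *\<^sub>R \<theta>) r"
  then have z: "norm (z - (y + b *\<^sub>R \<theta>)) \<le> r" by (simp add: dist_norm norm_minus_commute)
  define x where "x = y + (t / b) *\<^sub>R (z - y)"
  have "x - (y + t *\<^sub>R \<theta>) = (t / b) *\<^sub>R (z - (y + b *\<^sub>R \<theta>))" using b by (simp add: x_def algebra_simps)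
  then have "norm (x - (y + t *\<^sub>R \<theta>)) = (t / b) * norm (z - (y + b *\<^sub>R \<theta>))" using b by simp
  also have "\<dots> \<le> (t / b) * r" using z b by (intro mult_left_mono) auto
  also have "\<dots> \<le> d" using b r by (simp add: field_simps)
  finally have "x \<in> K" using sub by (auto simp: dist_norm norm_minus_commute)
  then have "(1 - b / t) *\<^sub>R y + (b / t) *\<^sub>R x \<in> K" using b by (intro convexD[OF convex_K yK]) auto
  moreover have "(1 - b / t) *\<^sub>R y + (b / t) *\<^sub>R x = z" using b by (simp add: x_def algebra_simps)
  ultimately show "z \<in> K" by simp
qed

lemma T_part_mono: assumes "k \<le> l" shows "T_part k \<subseteq> T_part l"
proof
  fix y assume y: "y \<in> T_part k"
  then have yK: "y \<in> K" using frontier_subset_K by (auto simp: T_part_def)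
  define a b where "a = 1 / real (Suc k)" and "b = 1 / real (Suc l)"
  have ab: "0 < b" "b \<le> a" "0 < a" using assms by (auto simp: a_def b_def frac_le)
  have "cball (y + a *\<^sub>R \<theta>) (a ^ 2) \<subseteq> K" using y by (simp add: T_part_def a_def power_divide)
  then have "cball (y + b *\<^sub>R \<theta>) (b ^ 2) \<subseteq> K"
    by (rule cball_ray_shrink[OF yK _ ab(1,2)])
      (use ab in \<open>simp add: power2_eq_square mult.assoc mult_left_mono mult_right_mono\<close>)
  then show "y \<in> T_part l" using y by (simp add: T_part_def b_def power_divide)
qed

lemma T_eq_UN: "T = (\<Union>k. T_part k)"
proof (intro equalityI subsetI)
  fix y assume y: "y \<in> T"
  then obtain t where t: "t > 0" "y + t *\<^sub>R \<theta> \<in> interior K" and yf: "y \<in> frontier K" by (auto simp: transversal_def)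
  then have yK: "y \<in> K" using frontier_subset_K by blast
  obtain d where d: "d > 0" "cball (y + t *\<^sub>R \<theta>) d \<subseteq> K" using t(2) by (auto simp: mem_interior_cball)
  have "min t (d / t) > 0" using t d by simp
  then obtain k where k: "1 / real (Suc k) < min t (d / t)" using nat_approx_posE by blast
  define b where "b = 1 / real (Suc k)"
  have b: "0 < b" "b \<le> t" "b * t \<le> d" using k t by (auto simp: b_def field_simps)
  have "cball (y + b *\<^sub>R \<theta>) (b ^ 2) \<subseteq> K"
    by (rule cball_ray_shrink[OF yK d(2) b(1,2)]) (use b in \<open>simp add: power2_eq_square mult.assoc mult_left_mono\<close>)
  then have "y \<in> T_part k" using yf by (simp add: T_part_def b_def power_divide)
  then show "y \<in> (\<Union>k. T_part k)" by blast
qed (use T_part_subset in blast)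

lemma T_part_slope:
  assumes y: "y \<in> T_part k" and w: "norm w < 1 / real (Suc k) ^ 2"
  shows "y + w \<in> \<Omega>" "\<bar>F (y + w)\<bar> \<le> real (Suc k) * norm w"
proof -
  have "y \<in> T" using y T_part_subset by blast
  note * = enter_time_slope[OF this, of "1 / real (Suc k)" "1 / real (Suc k) ^ 2" w]
  have eq: "1 / real (Suc k) / (1 / real (Suc k) ^ 2) = real (Suc k)" by (simp add: power2_eq_square del: of_nat_Suc)
  show "y + w \<in> \<Omega>" "\<bar>F (y + w)\<bar> \<le> real (Suc k) * norm w"
    using * y w unfolding eq by (auto simp: T_part_def simp del: of_nat_Suc)
qed

text \<open>The constant is not sharp, but holds at smooth and nonsmooth points alike: with slope at
  most \<open>Suc k\<close>, the entry points over a disc of radius \<open>s / \<kappa>\<close>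
  orthogonal to \<theta> lie in \<open>cball y s\<close>. It transfers null sets of \<nu> to
  Hausdorff measure.\<close>

lemma density_T_part:
  "\<exists>c>0. \<forall>y\<in>T_part k. \<exists>s0>0. \<forall>s. 0 < s \<longrightarrow> s \<le> s0 \<longrightarrow>
    ennreal (c * unit_ball_vol (real (DIM('a) - 1)) * s ^ (DIM('a) - 1)) \<le> emeasure \<nu> (cball y s)"
proof -
  define n where "n = \<theta> /\<^sub>R norm \<theta>"
  have n: "norm n = 1" "\<theta> \<bullet> n = norm \<theta>" using \<theta> by (auto simp: n_def dot_square_norm power2_eq_square)
  define \<kappa> where "\<kappa> = 1 + real (Suc k) * norm \<theta>"
  have \<kappa>: "\<kappa> \<ge> 1" by (simp add: \<kappa>_def)
  let ?d = "DIM('a) - 1"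
  have "ennreal (norm \<theta> / \<kappa> ^ ?d * unit_ball_vol (real ?d) * s ^ ?d) \<le> emeasure \<nu> (cball y s)"
    if y: "y \<in> T_part k" and s: "0 < s" "s \<le> 1 / real (Suc k) ^ 2 / 2" for y s
  proof -
    have "s / \<kappa> \<le> s / 1" using \<kappa> s by (intro divide_left_mono) auto
    then have small: "s / \<kappa> < 1 / real (Suc k) ^ 2" using s by (simp del: of_nat_Suc)
    have near: "y + u \<in> \<Omega> \<and> norm (\<pi> (y + u) - y) \<le> s" if u: "norm u \<le> s / \<kappa>" for u
    proof -
      note * = T_part_slope[OF y, of u]
      have nu: "norm u < 1 / real (Suc k) ^ 2" using u small by linarith
      have "norm (\<pi> (y + u) - y) \<le> norm u + norm (F (y + u) *\<^sub>R \<theta>)"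
        using norm_triangle_ineq[of u "F (y + u) *\<^sub>R \<theta>"] by (simp add: enter_pt_def add.assoc)
      also have "\<dots> \<le> norm u + (real (Suc k) * norm u) * norm \<theta>"
        unfolding norm_scaleR using *(2)[OF nu] by (intro add_left_mono mult_right_mono) auto
      also have "\<dots> = norm u * \<kappa>" by (simp add: \<kappa>_def algebra_simps)
      also have "\<dots> \<le> s / \<kappa> * \<kappa>" using u \<kappa> by (intro mult_right_mono) auto
      finally show ?thesis using \<kappa> *(1)[OF nu] by simp
    qed
    have "ennreal (unit_ball_vol (real ?d) * (s / \<kappa>) ^ ?d * \<bar>\<theta> \<bullet> n\<bar>) \<le> emeasure \<nu> (cball y s)"
      using \<nu>_cball_ge[OF n(1), of "s / \<kappa>" y s] near s \<kappa> n(2) \<theta> by auto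
    then show ?thesis using n(2) by (simp add: power_divide mult_ac)
  qed
  moreover have "norm \<theta> / \<kappa> ^ ?d > 0" "1 / real (Suc k) ^ 2 / 2 > 0" using \<theta> \<kappa> by auto
  ultimately show ?thesis by blast
qed

text \<open>Two normals at \<^term>\<open>\<pi> x\<close> yield two subgradients of the convex function \<^term>\<open>F\<close> at \<^term>\<open>x\<close>, hence a
  kink of \<^term>\<open>F\<close> along some basis vector.\<close>

lemma \<nu>_nonsmooth: "emeasure \<nu> (nonsmooth K) = 0"
proof -
  have [measurable]: "nonsmooth K \<in> sets borel" by (rule nonsmooth_measurable[OF compact_K])
  define D where "D b m = {x\<in>\<Omega>. \<forall>j::nat. 0 < j \<longrightarrow> x + (1 / real j) *\<^sub>R b \<in> \<Omega> \<longrightarrow> x - (1 / real j) *\<^sub>R b \<in> \<Omega> \<longrightarrow>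
      (1 / real (Suc m)) * (1 / real j) \<le> F (x + (1 / real j) *\<^sub>R b) + F (x - (1 / real j) *\<^sub>R b) - 2 * F x}" for b m
  have D: "D b m \<in> null_sets lborel" if "b \<in> Basis" for b m
    using kink_set_null[OF open_enter_dom convex_on_enter_time enter_time_measurable, of b "1 / real (Suc m)"] that
    unfolding D_def[symmetric] by (simp add: negligible_iff_null_sets null_sets_completion_iff)
  have "x \<in> (\<Union>b\<in>Basis. \<Union>m. D b m)" if x: "x \<in> \<Omega>" "\<pi> x \<in> nonsmooth K" for x
  proof -
    obtain u u' where u: "u \<in> normals K (\<pi> x)" "u' \<in> normals K (\<pi> x)" "u \<noteq> u'" using x(2) by (auto simp: nonsmooth_def)
    obtain t where t: "t > 0" "\<pi> x + t *\<^sub>R \<theta> \<in> interior K" using enter_pt_transversal[OF x(1)] by (auto simp: transversal_def)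
    have neg: "u \<bullet> \<theta> < 0" if "u \<in> normals K (\<pi> x)" for u
    proof -
      obtain e where e: "e > 0" "cball (\<pi> x + t *\<^sub>R \<theta>) e \<subseteq> K" using t(2) by (auto simp: mem_interior_cball)
      have nu: "norm u = 1" using that by (simp add: normals_def)
      then have "\<pi> x + t *\<^sub>R \<theta> + e *\<^sub>R u \<in> K" using e by (intro subsetD[OF e(2)]) (simp add: dist_norm)
      then have "u \<bullet> (\<pi> x + t *\<^sub>R \<theta> + e *\<^sub>R u - \<pi> x) \<le> 0" using that by (auto simp: normals_def)
      then have "t * (u \<bullet> \<theta>) + e \<le> 0" using nu by (simp add: inner_add_right dot_square_norm)
      then have "t * (u \<bullet> \<theta>) < 0" using e by linarith
      then show ?thesis using t by (simp add: mult_less_0_iff)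
    qed
    have sub: "(u \<bullet> z) / - (u \<bullet> \<theta>) \<le> F (x + z) - F x" if "u \<in> normals K (\<pi> x)" "x + z \<in> \<Omega>" for u z
    proof -
      have "u \<bullet> (\<pi> (x + z) - \<pi> x) \<le> 0" using that enter_time_props(1) by (auto simp: normals_def)
      then have "u \<bullet> z + (F (x + z) - F x) * (u \<bullet> \<theta>) \<le> 0"
        by (simp add: enter_pt_def inner_add_right inner_diff_right algebra_simps)
      then show ?thesis using neg[OF that(1)] by (simp add: field_simps)
    qed
    define g g' where "g = u /\<^sub>R - (u \<bullet> \<theta>)" and "g' = u' /\<^sub>R - (u' \<bullet> \<theta>)"
    have gsub: "g \<bullet> z \<le> F (x + z) - F x" "g' \<bullet> z \<le> F (x + z) - F x" if "x + z \<in> \<Omega>" for z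
      using sub[OF u(1) that] sub[OF u(2) that] by (auto simp: g_def g'_def divide_inverse mult.commute)
    \<comment> \<open>Since \<open>u\<close> and \<open>u'\<close> are unit vectors, equality of the
      rescaled vectors forces equal factors and then \<open>u = u'\<close>.\<close>
    have "g \<noteq> g'"
    proof
      assume "g = g'"
      then have "norm g = norm g'" by simp
      then have "inverse (- (u \<bullet> \<theta>)) = inverse (- (u' \<bullet> \<theta>))"
        using u(1,2) neg[OF u(1)] neg[OF u(2)] by (auto simp: g_def g'_def normals_def)
      then have "u \<bullet> \<theta> = u' \<bullet> \<theta>" by simp
      then show False using \<open>g = g'\<close> u(3) neg[OF u(2)] by (simp add: g_def g'_def)
    qed
    then obtain b where b: "b \<in> Basis" "g \<bullet> b \<noteq> g' \<bullet> b" using euclidean_eqI by blast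
    then obtain m where m: "1 / real (Suc m) < \<bar>g \<bullet> b - g' \<bullet> b\<bar>" using nat_approx_posE[of "\<bar>g \<bullet> b - g' \<bullet> b\<bar>"] by auto
    have "x \<in> D b m" unfolding D_def
    proof (intro CollectI conjI allI impI x(1))
      fix j :: nat assume j: "0 < j" and pts: "x + (1 / real j) *\<^sub>R b \<in> \<Omega>" "x - (1 / real j) *\<^sub>R b \<in> \<Omega>"
      let ?t = "1 / real j"
      have "?t * (g \<bullet> b) \<le> F (x + ?t *\<^sub>R b) - F x" "?t * (g' \<bullet> b) \<le> F (x + ?t *\<^sub>R b) - F x"
        using gsub[OF pts(1)] by auto
      moreover have "- (?t * (g \<bullet> b)) \<le> F (x - ?t *\<^sub>R b) - F x" "- (?t * (g' \<bullet> b)) \<le> F (x - ?t *\<^sub>R b) - F x"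
        using gsub[of "- (?t *\<^sub>R b)"] pts(2) by auto
      moreover have "\<bar>?t * (g \<bullet> b) - ?t * (g' \<bullet> b)\<bar> = ?t * \<bar>g \<bullet> b - g' \<bullet> b\<bar>"
        unfolding right_diff_distrib[symmetric] abs_mult by simp
      moreover have "(1 / real (Suc m)) * ?t \<le> ?t * \<bar>g \<bullet> b - g' \<bullet> b\<bar>"
        using m by (subst mult.commute, intro mult_left_mono) auto
      ultimately show "(1 / real (Suc m)) * ?t \<le> F (x + ?t *\<^sub>R b) + F (x - ?t *\<^sub>R b) - 2 * F x"
        by linarith
    qed
    then show ?thesis using b(1) by blast
  qed
  moreover have "(\<Union>b\<in>Basis. \<Union>m. D b m) \<in> null_sets lborel"
    by (intro null_sets_UN' null_sets_UN countable_finite finite_Basis D)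
  ultimately have AE0: "AE x in lborel. \<not> (x \<in> \<Omega> \<and> \<pi> x \<in> nonsmooth K)"
    by (auto intro!: AE_I'[of "\<Union>b\<in>Basis. \<Union>m. D b m"])
  have "(\<integral>\<^sup>+x\<in>slab \<Omega> F 1. indicator (nonsmooth K) (\<pi> x) \<partial>lborel) = (\<integral>\<^sup>+x. 0 \<partial>(lborel :: 'a measure))"
  proof (rule nn_integral_cong_AE)
    show "AE x in lborel. indicator (nonsmooth K) (\<pi> x) * indicator (slab \<Omega> F 1) x = (0 :: ennreal)"
      using AE0 by eventually_elim (auto simp: slab_def indicator_def)
  qed
  then show ?thesis by (simp add: emeasure_\<nu>)
qed

end

text \<open>Each boundary point is transversal for some direction in a countable dense set. On each
  piece for such a direction the crude density bounds Hausdorff measure by \<nu>, for which the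
  nonsmooth points are null.\<close>

lemma hausdorff_nonsmooth:
  fixes K :: "'a::euclidean_space set"
  assumes K: "compact K" "convex K" "interior K \<noteq> {}"
  shows "emeasure (hausdorff_measure (DIM('a) - 1)) (nonsmooth K) = 0"
proof -
  let ?d = "DIM('a) - 1"
  let ?H = "hausdorff_measure ?d :: 'a measure"
  have [measurable]: "nonsmooth K \<in> sets borel" by (rule nonsmooth_measurable[OF K(1)])
  obtain \<Theta> :: "'a set" where \<Theta>: "countable \<Theta>" "\<And>X. open X \<Longrightarrow> X \<noteq> {} \<Longrightarrow> \<exists>d\<in>\<Theta>. d \<in> X"
    using countable_dense_exists by metis
  define N where "N \<theta> k = nonsmooth K \<inter> convex_direction.T_part K \<theta> k" for \<theta> k
  have "N \<theta> k \<in> null_sets ?H" if "\<theta> \<noteq> 0" for \<theta> k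
  proof -
    interpret convex_direction K \<theta> using K that by unfold_locales
    have Nm: "N \<theta> k \<in> sets borel"
      unfolding N_def using compact_imp_closed[OF compact_T_part] by (intro sets.Int) auto
    obtain c where c: "c > 0" "\<And>y. y \<in> T_part k \<Longrightarrow> \<exists>s0>0. \<forall>s. 0 < s \<longrightarrow> s \<le> s0 \<longrightarrow>
        ennreal (c * unit_ball_vol (real ?d) * s ^ ?d) \<le> emeasure \<nu> (cball y s)"
      using density_T_part[of k] by blast
    have "ennreal c * emeasure ?H (N \<theta> k) \<le> emeasure \<nu> (N \<theta> k)"
    proof (rule hausdorff_measure_le_of_density[OF sets_\<nu> finite_measure_\<nu> Nm c(1)])
      fix y and \<epsilon> :: real assume y: "y \<in> N \<theta> k" and \<epsilon>: "\<epsilon> > 0"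
      obtain s0 where s0: "s0 > 0" "\<And>s. 0 < s \<Longrightarrow> s \<le> s0 \<Longrightarrow> ennreal (c * unit_ball_vol (real ?d) * s ^ ?d) \<le> emeasure \<nu> (cball y s)"
        using c(2)[of y] y by (auto simp: N_def)
      then show "\<exists>s>0. s < \<epsilon> \<and> ennreal (c * unit_ball_vol (real ?d) * s ^ ?d) \<le> emeasure \<nu> (cball y s)"
        using \<epsilon> by (intro exI[of _ "min s0 (\<epsilon> / 2)"]) auto
    qed
    also have "\<dots> \<le> emeasure \<nu> (nonsmooth K)" by (rule emeasure_mono) (auto simp: N_def)
    also have "\<dots> = 0" by (rule \<nu>_nonsmooth)
    finally show ?thesis using c(1) Nm by (auto simp: null_sets_def)
  qed
  then have null: "(\<Union>\<theta>\<in>\<Theta> - {0}. \<Union>k. N \<theta> k) \<in> null_sets ?H"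
    using \<Theta>(1) by (intro null_sets_UN') auto
  have sub: "nonsmooth K \<subseteq> (\<Union>\<theta>\<in>\<Theta> - {0}. \<Union>k. N \<theta> k)"
  proof
    fix y assume y: "y \<in> nonsmooth K"
    have yi: "y \<in> frontier K" "y \<notin> interior K" using y by (auto simp: nonsmooth_def frontier_def)
    have "open ((\<lambda>v. y + v) -` interior K)" by (intro open_vimage continuous_intros) auto
    moreover have "(\<lambda>v. y + v) -` interior K \<noteq> {}"
    proof -
      obtain z where "z \<in> interior K" using K(3) by blast
      then have "z - y \<in> (\<lambda>v. y + v) -` interior K" by simp
      then show ?thesis by blast
    qed
    ultimately obtain v where v: "v \<in> \<Theta>" "y + v \<in> interior K" using \<Theta>(2) by blast
    have v0: "v \<noteq> 0" using v(2) yi by auto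
    interpret convex_direction K v using K v0 by unfold_locales
    have "y \<in> T" using v yi by (auto simp: transversal_def intro!: exI[of _ 1])
    then show "y \<in> (\<Union>\<theta>\<in>\<Theta> - {0}. \<Union>k. N \<theta> k)" using y v v0 by (auto simp: N_def T_eq_UN)
  qed
  have "nonsmooth K \<in> null_sets ?H" by (rule null_sets_subset[OF null _ sub]) simp
  then show ?thesis by auto
qed

section \<open>Boundary integrals and shells\<close>

context convex_direction
begin

definition proj :: "'a \<Rightarrow> 'a" where
  "proj z = z - ((z \<bullet> \<theta>) / (\<theta> \<bullet> \<theta>)) *\<^sub>R \<theta>"

lemma linear_proj: "linear proj"
  unfolding proj_def by (rule linearI) (auto simp: inner_add_left add_divide_distrib algebra_simps)

lemma proj_\<theta>: "proj (t *\<^sub>R \<theta>) = 0"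
  using \<theta> by (simp add: proj_def)

lemma proj_translate: "proj (x + t *\<^sub>R \<theta>) = proj x"
  by (simp add: linear_add[OF linear_proj] proj_\<theta>)

lemma proj_measurable [measurable]: "proj \<in> borel_measurable borel"
  unfolding proj_def[abs_def] by measurable

lemma proj_enter_pt: "proj (z - \<pi> x) = proj (z - x)"
proof -
  have "z - x = (z - \<pi> x) + F x *\<^sub>R \<theta>" by (simp add: enter_pt_def)
  then show ?thesis by (metis proj_translate)
qed

text \<open>Volume of the tube of radius \<open>r\<close> about a line in direction \<theta>, per
  translation by \<theta>; this is the reason for the factor \<open>norm \<theta>\<close>.\<close>

definition tube_vol :: "real \<Rightarrow> real" where
  "tube_vol r = unit_ball_vol (real (DIM('a) - 1)) * r ^ (DIM('a) - 1) * norm \<theta>"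

lemma tube_vol_pos: "r > 0 \<Longrightarrow> tube_vol r > 0"
  using \<theta> by (simp add: tube_vol_def)

abbreviation height :: "'a \<Rightarrow> 'a \<Rightarrow> real" where
  "height y x \<equiv> - (((x - y) \<bullet> \<theta>) / (\<theta> \<bullet> \<theta>))"

lemma tube_volume:
  assumes "r > 0"
  shows "(\<integral>\<^sup>+x\<in>slab {x. norm (proj (x - y)) \<le> r} (height y) 1. 1 \<partial>lborel) = ennreal (tube_vol r)"
proof -
  define n where "n = \<theta> /\<^sub>R norm \<theta>"
  have n: "norm n = 1" "\<theta> \<bullet> n \<noteq> 0" "\<bar>\<theta> \<bullet> n\<bar> = norm \<theta>"
    using \<theta> by (auto simp: n_def dot_square_norm power2_eq_square)
  have q: "(x \<bullet> n) / (\<theta> \<bullet> n) = (x \<bullet> \<theta>) / (\<theta> \<bullet> \<theta>)" for x using \<theta> by (simp add: n_def)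
  let ?S = "{x. 0 \<le> (x \<bullet> n) / (\<theta> \<bullet> n) \<and> (x \<bullet> n) / (\<theta> \<bullet> n) < 1 \<and> norm (x - ((x \<bullet> n) / (\<theta> \<bullet> n)) *\<^sub>R \<theta>) \<le> r}"
  have "(\<integral>\<^sup>+x\<in>slab {x. norm (proj (x - y)) \<le> r} (height y) 1. 1 \<partial>lborel) = (\<integral>\<^sup>+x. indicator ?S (x + (- y)) \<partial>lborel)"
    unfolding q by (intro nn_integral_cong) (auto simp: indicator_def slab_def proj_def)
  also have "\<dots> = (\<integral>\<^sup>+x. indicator ?S x \<partial>lborel)" by (rule nn_integral_lborel_translate) simp
  also have "\<dots> = emeasure lborel ?S" by simp
  also have "\<dots> = ennreal (tube_vol r)"
    unfolding tube_vol_def using emeasure_oblique_cylinder[OF n(1,2) assms] n(3) by simp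
  finally show ?thesis .
qed

lemma along_height: "along {x. norm (proj (x - y)) \<le> r} \<theta> (height y)"
proof -
  have "proj (x + t *\<^sub>R \<theta> - y) = proj (x - y)" for x t
    using proj_translate[of "x - y" t] by (simp add: algebra_simps)
  then show ?thesis unfolding along_def using \<theta>
    by (auto simp: inner_diff_left inner_add_left add_divide_distrib diff_divide_distrib)
qed

lemma tube_in_dom:
  assumes y: "y \<in> T_part k" and r: "r < 1 / real (Suc k) ^ 2" and x: "norm (proj (x - y)) \<le> r"
  defines "t \<equiv> ((x - y) \<bullet> \<theta>) / (\<theta> \<bullet> \<theta>)" and "w \<equiv> proj (x - y)"
  shows "x = y + w + t *\<^sub>R \<theta>" "y + w \<in> \<Omega>" "x \<in> \<Omega>" "\<bar>F (y + w)\<bar> \<le> real (Suc k) * r" "F x = F (y + w) - t"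
proof -
  show eq: "x = y + w + t *\<^sub>R \<theta>" by (simp add: w_def t_def proj_def)
  have nw: "norm w < 1 / real (Suc k) ^ 2" using x r by (simp add: w_def)
  note * = T_part_slope[OF y nw]
  show \<Omega>: "y + w \<in> \<Omega>" by (rule *(1))
  show "x \<in> \<Omega>" using enter_dom_translate[OF \<Omega>, of t] by (subst eq) simp
  have "real (Suc k) * norm w \<le> real (Suc k) * r" using x by (intro mult_left_mono) (auto simp: w_def)
  then show "\<bar>F (y + w)\<bar> \<le> real (Suc k) * r" using *(2) by linarith
  show "F x = F (y + w) - t" using enter_time_translate[OF \<Omega>, of t] by (subst eq) simp
qed

text \<open>A point of the shell in the tube differs from \<open>y\<close> by a transversal part of
  norm at most \<open>r\<close> and a multiple of \<theta> by at most
  \<open>(Suc k + 1) * r\<close>: slope times \<open>r\<close>, plus the thickness. The summand 2 in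
  place of 1 makes the estimate strict.\<close>

definition near_const :: "nat \<Rightarrow> real" where
  "near_const k = 2 + (real (Suc k) + 1) * norm \<theta>"

lemma tube_slab_near:
  assumes y: "y \<in> T_part k" and r: "0 < r" "r < 1 / real (Suc k) ^ 2" and x: "norm (proj (x - y)) \<le> r"
    and F: "- r < F x" "F x \<le> 0"
  shows "norm (x - y) < near_const k * r"
proof -
  note * = tube_in_dom[OF y r(2) x]
  let ?t = "((x - y) \<bullet> \<theta>) / (\<theta> \<bullet> \<theta>)"
  have "\<bar>?t\<bar> \<le> (real (Suc k) + 1) * r" using *(4,5) F by (simp add: algebra_simps del: of_nat_Suc)
  then have "norm (?t *\<^sub>R \<theta>) \<le> (real (Suc k) + 1) * r * norm \<theta>"
    unfolding norm_scaleR by (intro mult_right_mono) auto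
  moreover have "x - y = proj (x - y) + ?t *\<^sub>R \<theta>" by (simp add: proj_def)
  then have "norm (x - y) \<le> norm (proj (x - y)) + norm (?t *\<^sub>R \<theta>)" by (metis norm_triangle_ineq)
  ultimately have "norm (x - y) \<le> r + (real (Suc k) + 1) * r * norm \<theta>" using x by linarith
  also have "\<dots> < near_const k * r" using r by (simp add: near_const_def algebra_simps del: of_nat_Suc)
  finally show ?thesis .
qed

text \<open>Averages of the density over the part of the shell \<^term>\<open>slab \<Omega> F r\<close> near \<^term>\<open>y\<close>, a region
  contained in a ball about \<^term>\<open>y\<close> of comparable volume, so that they converge at Lebesgue points.\<close>

definition shell_avg :: "('a \<Rightarrow> real) \<Rightarrow> real \<Rightarrow> 'a \<Rightarrow> ennreal" where
  "shell_avg \<phi> r y = ennreal (1 / (r * tube_vol r)) *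
     (\<integral>\<^sup>+x\<in>slab \<Omega> F r. ennreal (\<phi> x) * indicator {x. norm (proj (x - y)) \<le> r} x \<partial>lborel)"

text \<open>\<open>j\<close> stacked copies form a slab of thickness 1, which may be sliced by
  \<open>height y\<close> in place of \<open>F\<close>. The volume is therefore exact, whatever the
  shape of the boundary.\<close>

lemma shell_tube_volume:
  assumes y: "y \<in> T_part k" and j: "j > 0" "1 / real j < 1 / real (Suc k) ^ 2"
  shows "emeasure lborel (slab {x. norm (proj (x - y)) \<le> 1 / real j} F (1 / real j)) = ennreal (1 / real j * tube_vol (1 / real j))"
proof -
  define r where "r = 1 / real j"
  have r: "0 < r" "r < 1 / real (Suc k) ^ 2" "real j * r = 1" using j by (auto simp: r_def)
  let ?\<Omega> = "{x. norm (proj (x - y)) \<le> r}"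
  have sub: "?\<Omega> \<subseteq> \<Omega>" using tube_in_dom(3)[OF y r(2)] by blast
  have al: "along ?\<Omega> \<theta> F"
    unfolding along_def
  proof (intro ballI allI conjI)
    fix x t assume x: "x \<in> ?\<Omega>"
    then show "x + t *\<^sub>R \<theta> \<in> ?\<Omega>" using along_height[of y r] unfolding along_def by blast
    show "F (x + t *\<^sub>R \<theta>) = F x - t" using x sub by (intro enter_time_translate) auto
  qed
  have [measurable]: "?\<Omega> \<in> sets borel" by measurable
  have "of_nat j * (\<integral>\<^sup>+x\<in>slab ?\<Omega> F r. 1 \<partial>lborel) = (\<integral>\<^sup>+x\<in>slab ?\<Omega> F (real j * r). 1 \<partial>lborel)"
    by (rule nn_integral_slab_mult[OF _ _ _ al, symmetric]) (use r in auto)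
  also have "\<dots> = (\<integral>\<^sup>+x\<in>slab ?\<Omega> F 1. 1 \<partial>lborel)" using r by simp
  also have "\<dots> = (\<integral>\<^sup>+x\<in>slab ?\<Omega> (height y) 1. 1 \<partial>lborel)"
    by (rule nn_integral_slab_eq[OF _ _ _ _ al along_height]) auto
  also have "\<dots> = ennreal (tube_vol r)" by (rule tube_volume[OF r(1)])
  finally have eq: "of_nat j * emeasure lborel (slab ?\<Omega> F r) = ennreal (tube_vol r)" by simp
  have "emeasure lborel (slab ?\<Omega> F r) = ennreal r * (of_nat j * emeasure lborel (slab ?\<Omega> F r))"
  proof -
    have "ennreal r * of_nat j = 1" using r by (simp add: ennreal_of_nat_eq_real_of_nat ennreal_mult'[symmetric] mult.commute)
    then show ?thesis by (simp add: mult.assoc[symmetric])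
  qed
  also have "\<dots> = ennreal (r * tube_vol r)" unfolding eq using r by (simp add: ennreal_mult')
  finally show ?thesis by (simp add: r_def)
qed

text \<open>\<open>\<phi> y \<le> \<phi> x + \<bar>\<phi> x - \<phi> y\<bar>\<close> is integrated
  over the shell piece, which lies in the ball of radius \<open>C * r\<close>. The error is a fixed
  multiple of the mean oscillation over that ball and tends to 0 at a Lebesgue point.\<close>

lemma shell_avg_lower:
  assumes y: "y \<in> T_part k" and leb: "y \<in> lebesgue_set \<phi>"
    and [measurable]: "\<phi> \<in> borel_measurable borel" and \<phi>0: "\<And>x. 0 \<le> \<phi> x"
    and loc: "\<And>C. compact C \<Longrightarrow> set_integrable lborel C \<phi>"
  shows "ennreal (\<phi> y) \<le> liminf (\<lambda>j. shell_avg \<phi> (1 / real (Suc j)) y)"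
proof -
  define C where "C = near_const k"
  have C: "C > 0" by (auto simp: C_def near_const_def add_pos_nonneg)
  let ?n = "DIM('a)"
  \<comment> \<open>The volume of the ball of radius \<open>C * r\<close> divided by the volume
    \<open>r * tube_vol r\<close> of the shell piece; the powers of \<open>r\<close> cancel.\<close>
  define E where "E = unit_ball_vol (real ?n) * C ^ ?n / (unit_ball_vol (real (?n - 1)) * norm \<theta>)"
  have E: "E \<ge> 0" using C \<theta> by (simp add: E_def)
  define av where "av r = (LINT z:ball y r|lborel. \<bar>\<phi> z - \<phi> y\<bar>) / measure lborel (ball y r)" for r
  have av0: "(av \<longlongrightarrow> 0) (at_right 0)" using leb unfolding lebesgue_set_def av_def by simp
  have bound: "ennreal (\<phi> y) \<le> shell_avg \<phi> r y + ennreal (E * av (C * r))"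
    if r: "r = 1 / real (Suc j)" "r < 1 / real (Suc k) ^ 2" for r j
  proof -
    have r0: "0 < r" using r by simp
    define S where "S = slab {x. norm (proj (x - y)) \<le> r} F r"
    have [measurable]: "S \<in> sets borel" unfolding S_def by (rule slab_measurable) measurable
    have S\<Omega>: "indicator S x = (indicator (slab \<Omega> F r) x * indicator {x. norm (proj (x - y)) \<le> r} x :: ennreal)" for x
      using tube_in_dom(3)[OF y r(2), of x] by (auto simp: S_def slab_def indicator_def)
    have Sb: "x \<in> ball y (C * r)" if "x \<in> S" for x
      using tube_slab_near[OF y r0 r(2), of x] that by (auto simp: S_def slab_def C_def dist_norm norm_minus_commute)
    have vol: "emeasure lborel S = ennreal (r * tube_vol r)"
      using shell_tube_volume[OF y, of "Suc j"] r unfolding S_def by simp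
    have c: "r * tube_vol r > 0" using r0 tube_vol_pos by simp
    have int: "set_integrable lborel (ball y (C * r)) (\<lambda>z. \<bar>\<phi> z - \<phi> y\<bar>)"
    proof -
      have "emeasure lborel (cball y (C * r)) < \<infinity>" by (rule emeasure_bounded_finite) simp
      then have "set_integrable lborel (cball y (C * r)) (\<lambda>_. \<phi> y)"
        unfolding set_integrable_def by (intro integrable_scaleR_left integrable_real_indicator) auto
      then have "set_integrable lborel (cball y (C * r)) (\<lambda>z. \<bar>\<phi> z - \<phi> y\<bar>)"
        by (intro set_integrable_abs set_integral_diff loc compact_cball)
      then show ?thesis by (rule set_integrable_subset) auto
    qed
    have [measurable]: "(\<lambda>x. indicator (ball y (C * r)) x * \<bar>\<phi> x - \<phi> y\<bar>) \<in> borel_measurable borel"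
      by (intro borel_measurable_times borel_measurable_abs borel_measurable_diff borel_measurable_indicator) auto
    have "ennreal (\<phi> y) * ennreal (r * tube_vol r) = (\<integral>\<^sup>+x. ennreal (\<phi> y) * indicator S x \<partial>lborel)"
      by (simp add: nn_integral_cmult_indicator vol)
    also have "\<dots> \<le> (\<integral>\<^sup>+x. ennreal (\<phi> x) * indicator S x + ennreal (indicator (ball y (C * r)) x * \<bar>\<phi> x - \<phi> y\<bar>) \<partial>lborel)"
    proof (rule nn_integral_mono)
      fix x
      have "ennreal (\<phi> y) \<le> ennreal (\<phi> x + \<bar>\<phi> x - \<phi> y\<bar>)" by (rule ennreal_leI) linarith
      also have "\<dots> = ennreal (\<phi> x) + ennreal \<bar>\<phi> x - \<phi> y\<bar>" using \<phi>0 by (intro ennreal_plus) auto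
      finally show "ennreal (\<phi> y) * indicator S x \<le> ennreal (\<phi> x) * indicator S x + ennreal (indicator (ball y (C * r)) x * \<bar>\<phi> x - \<phi> y\<bar>)"
        using Sb[of x] by (auto simp: indicator_def)
    qed
    also have "\<dots> = (\<integral>\<^sup>+x. ennreal (\<phi> x) * indicator S x \<partial>lborel) + (\<integral>\<^sup>+x. ennreal (indicator (ball y (C * r)) x * \<bar>\<phi> x - \<phi> y\<bar>) \<partial>lborel)"
      by (rule nn_integral_add) measurable
    also have "(\<integral>\<^sup>+x. ennreal (indicator (ball y (C * r)) x * \<bar>\<phi> x - \<phi> y\<bar>) \<partial>lborel) = ennreal (LINT z:ball y (C * r)|lborel. \<bar>\<phi> z - \<phi> y\<bar>)"
      using int unfolding set_integrable_def set_lebesgue_integral_def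
      by (subst nn_integral_eq_integral) auto
    also have "(LINT z:ball y (C * r)|lborel. \<bar>\<phi> z - \<phi> y\<bar>) = av (C * r) * measure lborel (ball y (C * r))"
      using content_ball_pos[OF mult_pos_pos[OF C r0], of y] by (simp add: av_def)
    also have "(\<integral>\<^sup>+x. ennreal (\<phi> x) * indicator S x \<partial>lborel) =
        (\<integral>\<^sup>+x\<in>slab \<Omega> F r. ennreal (\<phi> x) * indicator {x. norm (proj (x - y)) \<le> r} x \<partial>lborel)"
      by (intro nn_integral_cong) (simp only: S\<Omega> mult_ac)
    finally have "ennreal (1 / (r * tube_vol r)) * (ennreal (\<phi> y) * ennreal (r * tube_vol r)) \<le>
        ennreal (1 / (r * tube_vol r)) * ((\<integral>\<^sup>+x\<in>slab \<Omega> F r. ennreal (\<phi> x) * indicator {x. norm (proj (x - y)) \<le> r} x \<partial>lborel) +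
          ennreal (av (C * r) * measure lborel (ball y (C * r))))"
      by (rule mult_left_mono) simp
    also have "\<dots> = shell_avg \<phi> r y + ennreal (1 / (r * tube_vol r) * (av (C * r) * measure lborel (ball y (C * r))))"
    proof -
      have "ennreal (1 / (r * tube_vol r) * (av (C * r) * measure lborel (ball y (C * r)))) =
        ennreal (1 / (r * tube_vol r)) * ennreal (av (C * r) * measure lborel (ball y (C * r)))"
        by (rule ennreal_mult') (use c in simp)
      then show ?thesis by (simp only: shell_avg_def distrib_left)
    qed
    also have "1 / (r * tube_vol r) * (av (C * r) * measure lborel (ball y (C * r))) = E * av (C * r)"
    proof -
      have "measure lborel (ball y (C * r)) = unit_ball_vol (real ?n) * C ^ ?n * (r * r ^ (?n - 1))"
        using C r0 by (simp add: content_ball power_mult_distrib power_Suc[symmetric] del: power_Suc)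
      then show ?thesis using r0 \<theta> by (simp add: E_def tube_vol_def field_simps)
    qed
    also have "ennreal (1 / (r * tube_vol r)) * (ennreal (\<phi> y) * ennreal (r * tube_vol r)) = ennreal (\<phi> y)"
    proof -
      have "ennreal (\<phi> y) * ennreal (r * tube_vol r) = ennreal (\<phi> y * (r * tube_vol r))"
        by (rule ennreal_mult'[symmetric, OF \<phi>0])
      moreover have "ennreal (1 / (r * tube_vol r)) * ennreal (\<phi> y * (r * tube_vol r)) = ennreal (1 / (r * tube_vol r) * (\<phi> y * (r * tube_vol r)))"
        by (rule ennreal_mult'[symmetric]) (use c in simp)
      ultimately show ?thesis using r0 tube_vol_pos[OF r0] by simp
    qed
    finally show ?thesis .
  qed
  show ?thesis
  proof (rule ennreal_le_epsilon)
    fix e :: real assume e: "e > 0"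
    have lim: "(\<lambda>j. 1 / real (Suc j)) \<longlonglongrightarrow> 0" using LIMSEQ_inverse_real_of_nat by (simp add: inverse_eq_divide)
    have "(\<lambda>j. C * (1 / real (Suc j))) \<longlonglongrightarrow> C * 0" by (intro tendsto_intros lim)
    then have "(\<lambda>j. C * (1 / real (Suc j))) \<longlonglongrightarrow> 0" by (simp only: mult_zero_right)
    moreover have "\<forall>\<^sub>F j in sequentially. C * (1 / real (Suc j)) \<in> {0<..} \<and> C * (1 / real (Suc j)) \<noteq> 0" using C by simp
    ultimately have "filterlim (\<lambda>j. C * (1 / real (Suc j))) (at_right 0) sequentially"
      unfolding filterlim_at by blast
    then have "(\<lambda>j. av (C * (1 / real (Suc j)))) \<longlonglongrightarrow> 0" by (rule filterlim_compose[OF av0])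
    then have "(\<lambda>j. E * av (C * (1 / real (Suc j)))) \<longlonglongrightarrow> E * 0" by (intro tendsto_intros)
    then have "\<forall>\<^sub>F j in sequentially. E * av (C * (1 / real (Suc j))) < e" using e by (intro order_tendstoD(2)) auto
    moreover have "\<forall>\<^sub>F j in sequentially. 1 / real (Suc j) < 1 / real (Suc k) ^ 2"
      using order_tendstoD(2)[OF lim] by simp
    ultimately have "\<forall>\<^sub>F j in sequentially. ennreal (\<phi> y) - ennreal e \<le> shell_avg \<phi> (1 / real (Suc j)) y"
    proof eventually_elim
      case (elim j)
      have "ennreal (\<phi> y) \<le> shell_avg \<phi> (1 / real (Suc j)) y + ennreal (E * av (C * (1 / real (Suc j))))"
        using bound[OF refl elim(2)] .
      also have "\<dots> \<le> shell_avg \<phi> (1 / real (Suc j)) y + ennreal e"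
        using elim(1) by (intro add_left_mono ennreal_leI) simp
      finally show ?case by (simp add: ennreal_minus_le_iff add.commute)
    qed
    then have "ennreal (\<phi> y) - ennreal e \<le> liminf (\<lambda>j. shell_avg \<phi> (1 / real (Suc j)) y)"
      by (rule Liminf_bounded)
    then show "ennreal (\<phi> y) \<le> liminf (\<lambda>j. shell_avg \<phi> (1 / real (Suc j)) y) + ennreal e"
      by (simp add: ennreal_minus_le_iff add.commute)
  qed
qed

text \<open>The part of the shell that averages at points of \<open>E\<close> can reach. Its
  closeness to \<open>E\<close> later makes the parts for different directions disjoint.\<close>

definition shell_over :: "'a set \<Rightarrow> real \<Rightarrow> 'a set" where
  "shell_over E r = {x \<in> slab \<Omega> F r. \<exists>y\<in>E. norm (proj (x - y)) \<le> r}"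

lemma shell_over_measurable:
  assumes "compact E" shows "shell_over E r \<in> sets borel"
proof -
  have "closed {z. norm (proj z) \<le> r}"
    by (intro closed_Collect_le continuous_intros linear_continuous_on linear_conv_bounded_linear[THEN iffD1] linear_proj)
  then have "closed (\<Union>y\<in>E. \<Union>z\<in>{z. norm (proj z) \<le> r}. {y + z})" by (rule closed_compact_sums[rotated, OF assms, THEN subst[of _ _ closed, rotated]]) auto
  also have "(\<Union>y\<in>E. \<Union>z\<in>{z. norm (proj z) \<le> r}. {y + z}) = {x. \<exists>y\<in>E. norm (proj (x - y)) \<le> r}"
    by (force simp: algebra_simps)
  finally have "slab \<Omega> F r \<inter> {x. \<exists>y\<in>E. norm (proj (x - y)) \<le> r} \<in> sets borel" by (intro sets.Int) auto
  moreover have "slab \<Omega> F r \<inter> {x. \<exists>y\<in>E. norm (proj (x - y)) \<le> r} = shell_over E r" by (auto simp: shell_over_def)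
  ultimately show ?thesis by simp
qed

text \<open>After interchanging the integrals, a shell point \<open>z\<close> is counted by those
  \<open>x\<close> of the unit slab that lie in the tube about \<open>z\<close>. Slicing this tube
  by \<open>height z\<close> bounds their volume by \<open>tube_vol r\<close>, which cancels the
  normalization up to \<open>1 / r\<close>.\<close>

lemma shell_avg_integral_le:
  assumes E: "compact E" and [measurable]: "\<phi> \<in> borel_measurable borel" and r: "r > 0"
  shows "(\<integral>\<^sup>+y\<in>E. shell_avg \<phi> r y \<partial>\<nu>) \<le> ennreal (1 / r) * (\<integral>\<^sup>+x\<in>shell_over E r. ennreal (\<phi> x) \<partial>lborel)"
proof -
  have [measurable]: "E \<in> sets borel" using compact_imp_closed[OF E] by simp
  have [measurable]: "shell_over E r \<in> sets borel" by (rule shell_over_measurable[OF E])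
  define k where "k = 1 / (r * tube_vol r)"
  define h where "h x z = ennreal k * (ennreal (\<phi> z) * indicator (slab \<Omega> F r) z) * (if norm (proj (z - x)) \<le> r then 1 else 0)" for x z
  have [measurable]: "(\<lambda>(x, z). h x z) \<in> borel_measurable (borel \<Otimes>\<^sub>M borel)" unfolding h_def by measurable
  have sa: "shell_avg \<phi> r y = (\<integral>\<^sup>+z. h y z \<partial>lborel)" for y
    unfolding shell_avg_def h_def k_def[symmetric]
    by (subst nn_integral_cmult[symmetric], measurable, intro nn_integral_cong) (auto simp: indicator_def)
  have [measurable]: "shell_avg \<phi> r \<in> borel_measurable borel"
    unfolding sa[abs_def] by measurable
  have "(\<integral>\<^sup>+y\<in>E. shell_avg \<phi> r y \<partial>\<nu>) = (\<integral>\<^sup>+x\<in>slab \<Omega> F 1. (shell_avg \<phi> r (\<pi> x) * indicator E (\<pi> x)) \<partial>lborel)"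
    by (rule nn_integral_\<nu>) measurable
  also have "\<dots> = (\<integral>\<^sup>+x. (\<integral>\<^sup>+z. h x z * (indicator E (\<pi> x) * indicator (slab \<Omega> F 1) x) \<partial>lborel) \<partial>lborel)"
  proof (intro nn_integral_cong)
    fix x
    have "h (\<pi> x) z = h x z" for z by (simp add: h_def proj_enter_pt)
    then show "shell_avg \<phi> r (\<pi> x) * indicator E (\<pi> x) * indicator (slab \<Omega> F 1) x =
      (\<integral>\<^sup>+z. h x z * (indicator E (\<pi> x) * indicator (slab \<Omega> F 1) x) \<partial>lborel)"
      by (simp add: sa nn_integral_multc mult.assoc)
  qed
  also have "\<dots> = (\<integral>\<^sup>+z. (\<integral>\<^sup>+x. h x z * (indicator E (\<pi> x) * indicator (slab \<Omega> F 1) x) \<partial>lborel) \<partial>lborel)"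
    by (rule lborel_pair.Fubini') measurable
  also have "\<dots> \<le> (\<integral>\<^sup>+z. ennreal (1 / r) * (ennreal (\<phi> z) * indicator (shell_over E r) z) \<partial>lborel)"
  proof (rule nn_integral_mono)
    fix z
    let ?\<Omega> = "\<Omega> \<inter> {x. norm (proj (x - z)) \<le> r}"
    have sym: "norm (proj (z - x)) = norm (proj (x - z))" for x
      using linear_neg[OF linear_proj, of "x - z"] by simp
    show "(\<integral>\<^sup>+x. h x z * (indicator E (\<pi> x) * indicator (slab \<Omega> F 1) x) \<partial>lborel) \<le>
      ennreal (1 / r) * (ennreal (\<phi> z) * indicator (shell_over E r) z)"
    proof (cases "z \<in> shell_over E r")
      case True
      then have zs: "z \<in> slab \<Omega> F r" by (simp add: shell_over_def)
      have "(\<integral>\<^sup>+x. h x z * (indicator E (\<pi> x) * indicator (slab \<Omega> F 1) x) \<partial>lborel) \<le>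
          (\<integral>\<^sup>+x. (ennreal k * ennreal (\<phi> z)) * indicator (slab ?\<Omega> F 1) x \<partial>lborel)"
        by (intro nn_integral_mono) (use zs sym in \<open>auto simp: h_def indicator_def slab_def\<close>)
      also have "\<dots> = (ennreal k * ennreal (\<phi> z)) * (\<integral>\<^sup>+x\<in>slab ?\<Omega> F 1. 1 \<partial>lborel)"
        by (subst nn_integral_cmult) (auto simp: slab_def)
      also have "(\<integral>\<^sup>+x\<in>slab ?\<Omega> F 1. 1 \<partial>lborel) = (\<integral>\<^sup>+x\<in>slab ?\<Omega> (height z) 1. 1 \<partial>lborel)"
      proof (rule nn_integral_slab_eq)
        show "along ?\<Omega> \<theta> F" "along ?\<Omega> \<theta> (height z)"
          using along_enter_time along_height[of z r] unfolding along_def by blast+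
      qed auto
      also have "\<dots> \<le> (\<integral>\<^sup>+x\<in>slab {x. norm (proj (x - z)) \<le> r} (height z) 1. 1 \<partial>lborel)"
        by (intro nn_integral_mono) (auto simp: slab_def indicator_def)
      also have "\<dots> = ennreal (tube_vol r)" by (rule tube_volume[OF r])
      finally have "(\<integral>\<^sup>+x. h x z * (indicator E (\<pi> x) * indicator (slab \<Omega> F 1) x) \<partial>lborel) \<le>
        ennreal k * ennreal (\<phi> z) * ennreal (tube_vol r)"
        by (simp add: mult_left_mono)
      also have "\<dots> = ennreal (k * tube_vol r) * ennreal (\<phi> z)"
        using tube_vol_pos[OF r] by (subst ennreal_mult'') (auto simp: mult_ac)
      also have "k * tube_vol r = 1 / r" using tube_vol_pos[OF r] r by (simp add: k_def)
      finally show ?thesis using True by simp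
    next
      case False
      have zero: "h x z * (indicator E (\<pi> x) * indicator (slab \<Omega> F 1) x) = 0" for x
      proof (rule ccontr)
        assume "h x z * (indicator E (\<pi> x) * indicator (slab \<Omega> F 1) x) \<noteq> 0"
        then have "\<pi> x \<in> E" "z \<in> slab \<Omega> F r" "norm (proj (z - x)) \<le> r"
          by (auto simp: h_def indicator_def split: if_splits)
        then show False using False proj_enter_pt[of z x] by (auto simp: shell_over_def)
      qed
      show ?thesis unfolding zero by simp
    qed
  qed
  also have "\<dots> = ennreal (1 / r) * (\<integral>\<^sup>+x\<in>shell_over E r. ennreal (\<phi> x) \<partial>lborel)"
    by (rule nn_integral_cmult) measurable
  finally show ?thesis .
qed

lemma nn_integral_\<nu>_le_liminf_shell:
  assumes E: "compact E" "E \<subseteq> T_part k" and leb: "E \<subseteq> lebesgue_set \<phi>"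
    and [measurable]: "\<phi> \<in> borel_measurable borel" and \<phi>0: "\<And>x. 0 \<le> \<phi> x"
    and loc: "\<And>C. compact C \<Longrightarrow> set_integrable lborel C \<phi>"
  shows "(\<integral>\<^sup>+y\<in>E. ennreal (\<phi> y) \<partial>\<nu>) \<le>
    liminf (\<lambda>j. of_nat (Suc j) * (\<integral>\<^sup>+x\<in>shell_over E (1 / real (Suc j)). ennreal (\<phi> x) \<partial>lborel))"
proof -
  have [measurable]: "E \<in> sets borel" using compact_imp_closed[OF E(1)] by simp
  have [measurable]: "shell_avg \<phi> r \<in> borel_measurable borel" for r
  proof -
    have "(\<lambda>y. ennreal (1 / (r * tube_vol r)) *
     (\<integral>\<^sup>+x. ennreal (\<phi> x) * (if norm (proj (x - y)) \<le> r then 1 else 0) * indicator (slab \<Omega> F r) x \<partial>lborel)) \<in> borel_measurable borel"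
      by measurable
    also have "(\<lambda>y. ennreal (1 / (r * tube_vol r)) *
     (\<integral>\<^sup>+x. ennreal (\<phi> x) * (if norm (proj (x - y)) \<le> r then 1 else 0) * indicator (slab \<Omega> F r) x \<partial>lborel)) = shell_avg \<phi> r"
      by (auto simp: fun_eq_iff shell_avg_def indicator_def intro!: arg_cong2[where f = "(*)"] nn_integral_cong)
    finally show ?thesis .
  qed
  have "(\<integral>\<^sup>+y\<in>E. ennreal (\<phi> y) \<partial>\<nu>) \<le> (\<integral>\<^sup>+y. liminf (\<lambda>j. shell_avg \<phi> (1 / real (Suc j)) y * indicator E y) \<partial>\<nu>)"
  proof (rule nn_integral_mono)
    fix y
    show "ennreal (\<phi> y) * indicator E y \<le> liminf (\<lambda>j. shell_avg \<phi> (1 / real (Suc j)) y * indicator E y)"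
      using shell_avg_lower[of y k \<phi>] E leb \<phi>0 loc by (cases "y \<in> E") auto
  qed
  also have "\<dots> \<le> liminf (\<lambda>j. \<integral>\<^sup>+y\<in>E. shell_avg \<phi> (1 / real (Suc j)) y \<partial>\<nu>)"
    by (rule nn_integral_liminf) measurable
  also have "\<dots> \<le> liminf (\<lambda>j. of_nat (Suc j) * (\<integral>\<^sup>+x\<in>shell_over E (1 / real (Suc j)). ennreal (\<phi> x) \<partial>lborel))"
  proof (rule Liminf_mono, rule always_eventually, rule allI)
    fix j
    show "(\<integral>\<^sup>+y\<in>E. shell_avg \<phi> (1 / real (Suc j)) y \<partial>\<nu>) \<le>
      of_nat (Suc j) * (\<integral>\<^sup>+x\<in>shell_over E (1 / real (Suc j)). ennreal (\<phi> x) \<partial>lborel)"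
      using shell_avg_integral_le[OF E(1), of \<phi> "1 / real (Suc j)"]
      by (simp add: ennreal_of_nat_eq_real_of_nat del: of_nat_Suc)
  qed
  finally show ?thesis .
qed

text \<open>On its line, \<open>x\<close> lies after the entry point since
  \<open>F x \<le> 0\<close>, and before the point at parameter \<open>1 / Suc k\<close>, which is
  in \<open>K\<close>: the bound on \<open>r\<close> is chosen so that
  \<open>(Suc k + 1) * r \<le> 1 / Suc k\<close>. Since \<open>- r < F x\<close>, moving back by
  \<open>r\<close> leaves \<open>K\<close>.\<close>

lemma shell_over_props:
  assumes E: "E \<subseteq> T_part k" and r: "0 < r" "r < 1 / ((real (Suc k) + 1) * real (Suc k))" and x: "x \<in> shell_over E r"
  shows "x \<in> K" "x - r *\<^sub>R \<theta> \<notin> K" "\<exists>y\<in>E. norm (x - y) < near_const k * r"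
proof -
  obtain y where y: "y \<in> E" "norm (proj (x - y)) \<le> r" and xs: "x \<in> \<Omega>" "- r < F x" "F x \<le> 0"
    using x by (auto simp: shell_over_def slab_def)
  have yT: "y \<in> T_part k" using y E by blast
  have "1 / ((real (Suc k) + 1) * real (Suc k)) \<le> 1 / real (Suc k) ^ 2"
    unfolding power2_eq_square by (intro divide_left_mono mult_right_mono) auto
  then have r2: "r < 1 / real (Suc k) ^ 2" using r by linarith
  show "\<exists>y\<in>E. norm (x - y) < near_const k * r"
    using tube_slab_near[OF yT r(1) r2 y(2) xs(2,3)] y(1) by blast
  show "x - r *\<^sub>R \<theta> \<notin> K"
  proof
    assume "x - r *\<^sub>R \<theta> \<in> K"
    then have "F x \<le> - r" using enter_time_props(2)[OF xs(1), of "- r"] by simp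
    then show False using xs by simp
  qed
  note * = tube_in_dom[OF yT r2 y(2)]
  define w t where "w = proj (x - y)" and "t = ((x - y) \<bullet> \<theta>) / (\<theta> \<bullet> \<theta>)"
  define a where "a = 1 / real (Suc k)"
  have nw: "norm w \<le> a ^ 2" using y(2) r2 by (simp add: w_def a_def power_divide)
  have top: "y + w + a *\<^sub>R \<theta> \<in> K"
  proof -
    have "y + w + a *\<^sub>R \<theta> \<in> cball (y + a *\<^sub>R \<theta>) (a ^ 2)" using nw by (simp add: dist_norm norm_minus_commute)
    then show ?thesis using yT by (auto simp: T_part_def a_def power_divide)
  qed
  have ta: "F (y + w) \<le> t" "t \<le> a"
  proof -
    show "F (y + w) \<le> t" using *(5) xs by (simp add: w_def t_def)
    have "t \<le> real (Suc k) * r + r" using *(4,5) xs by (simp add: w_def t_def del: of_nat_Suc)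
    also have "\<dots> = (real (Suc k) + 1) * r" by (simp add: algebra_simps)
    also have "\<dots> \<le> (real (Suc k) + 1) * (1 / ((real (Suc k) + 1) * real (Suc k)))"
      using r by (intro mult_left_mono) auto
    also have "\<dots> = a" by (simp add: a_def)
    finally show "t \<le> a" .
  qed
  have bot: "y + w + F (y + w) *\<^sub>R \<theta> \<in> K" using enter_time_props(1)[OF *(2)] by (simp add: enter_pt_def w_def)
  have xe: "x = y + w + t *\<^sub>R \<theta>" using *(1) by (simp add: w_def t_def)
  show "x \<in> K"
  proof (cases "F (y + w) = a")
    case True then show ?thesis using ta top xe by simp
  next
    case False
    define l where "l = (t - F (y + w)) / (a - F (y + w))"
    have l: "0 \<le> l" "l \<le> 1" "(1 - l) * F (y + w) + l * a = t"
    proof -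
      have d: "a - F (y + w) > 0" using ta False by linarith
      show "0 \<le> l" "l \<le> 1" using ta d by (auto simp: l_def)
      have "l * (a - F (y + w)) = t - F (y + w)" using d by (simp add: l_def)
      then show "(1 - l) * F (y + w) + l * a = t" by (simp add: algebra_simps)
    qed
    have "(1 - l) *\<^sub>R (y + w + F (y + w) *\<^sub>R \<theta>) + l *\<^sub>R (y + w + a *\<^sub>R \<theta>) \<in> K"
      using l by (intro convexD[OF convex_K bot top]) auto
    also have "(1 - l) *\<^sub>R (y + w + F (y + w) *\<^sub>R \<theta>) + l *\<^sub>R (y + w + a *\<^sub>R \<theta>) = y + w + ((1 - l) * F (y + w) + l * a) *\<^sub>R \<theta>"
      by (simp add: algebra_simps)
    finally show ?thesis using l(3) xe by simp
  qed
qed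

end

section \<open>Adding up the directions\<close>

lemma sum_liminf_le:
  fixes f :: "'i \<Rightarrow> nat \<Rightarrow> ennreal"
  assumes "finite J"
  shows "(\<Sum>i\<in>J. liminf (f i)) \<le> liminf (\<lambda>j. \<Sum>i\<in>J. f i j)"
  using nn_integral_liminf[of "\<lambda>j i. f i j" "count_space J"] assms
  by (simp add: nn_integral_count_space_finite)

definition shell :: "'a::real_vector set \<Rightarrow> ('m \<Rightarrow> 'a) \<Rightarrow> real \<Rightarrow> 'a set" where
  "shell K th r = {x \<in> K. \<exists>i. x - r *\<^sub>R th i \<notin> K}"

lemma shell_measurable:
  fixes K :: "'a::euclidean_space set" and th :: "'m::finite \<Rightarrow> 'a"
  assumes "closed K" shows "shell K th r \<in> sets borel"
proof -
  have "shell K th r = K - (\<Inter>i. (\<lambda>x. x - r *\<^sub>R th i) -` K)" by (auto simp: shell_def)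
  moreover have "closed (\<Inter>i. (\<lambda>x. x - r *\<^sub>R th i) -` K)"
    by (intro closed_INT ballI closed_vimage assms continuous_intros)
  ultimately show ?thesis using assms by auto
qed

text \<open>Disjoint compact sets have positive distance, while the shell part belonging to
  \<open>E i\<close> stays within \<open>C i * r j\<close> of it. For large \<open>j\<close> the
  parts are therefore disjoint subsets of one common shell, and their masses add.\<close>

lemma sum_nn_integral_\<nu>_le_liminf_shell:
  fixes K :: "'a::euclidean_space set" and th :: "'m::finite \<Rightarrow> 'a"
  assumes K: "compact K" "convex K" and th: "\<And>i. i \<in> J \<Longrightarrow> th i \<noteq> 0"
    and E: "\<And>i. i \<in> J \<Longrightarrow> compact (E i)" "\<And>i. i \<in> J \<Longrightarrow> E i \<subseteq> convex_direction.T_part K (th i) k"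
    and leb: "\<And>i. i \<in> J \<Longrightarrow> E i \<subseteq> lebesgue_set \<phi>"
    and disj: "\<And>i i'. i \<in> J \<Longrightarrow> i' \<in> J \<Longrightarrow> i \<noteq> i' \<Longrightarrow> E i \<inter> E i' = {}"
    and \<phi>m [measurable]: "\<phi> \<in> borel_measurable borel" and \<phi>0: "\<And>x. 0 \<le> \<phi> x"
    and loc: "\<And>C. compact C \<Longrightarrow> set_integrable lborel C \<phi>"
  shows "(\<Sum>i\<in>J. \<integral>\<^sup>+y\<in>E i. ennreal (\<phi> y) \<partial>convex_direction.\<nu> K (th i)) \<le>
    liminf (\<lambda>j. of_nat (Suc j) * (\<integral>\<^sup>+x\<in>shell K th (1 / real (Suc j)). ennreal (\<phi> x) \<partial>lborel))"
proof -
  define r where "r j = 1 / real (Suc j)" for j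
  have r0: "0 < r j" for j by (simp add: r_def)
  have r_lim: "r \<longlonglongrightarrow> 0" unfolding r_def using LIMSEQ_inverse_real_of_nat by (simp add: inverse_eq_divide)
  define S where "S i j = convex_direction.shell_over K (th i) (E i) (r j)" for i j
  define C where "C i = convex_direction.near_const (th i) k" for i
  have cd: "convex_direction K (th i)" if "i \<in> J" for i using K th[OF that] by unfold_locales
  have Sm: "S i j \<in> sets borel" if "i \<in> J" for i j
    unfolding S_def by (rule convex_direction.shell_over_measurable[OF cd[OF that] E(1)[OF that]])
  have [measurable]: "shell K th (r j) \<in> sets borel" for j by (rule shell_measurable[OF compact_imp_closed[OF K(1)]])
  have small: "\<forall>\<^sub>F j in sequentially. r j < 1 / ((real (Suc k) + 1) * real (Suc k))"
    by (rule order_tendstoD(2)[OF r_lim]) (auto intro!: divide_pos_pos mult_pos_pos)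
  have sep: "\<forall>\<^sub>F j in sequentially. \<forall>x\<in>E i. \<forall>y\<in>E i'. (C i + C i') * r j < dist x y"
    if ii: "i \<in> J" "i' \<in> J" "i \<noteq> i'" for i i'
  proof -
    obtain d where d: "d > 0" "\<And>x y. x \<in> E i \<Longrightarrow> y \<in> E i' \<Longrightarrow> d \<le> dist x y"
      using separate_compact_closed[OF E(1)[OF ii(1)] compact_imp_closed[OF E(1)[OF ii(2)]] disj[OF ii]] by blast
    have "(\<lambda>j. (C i + C i') * r j) \<longlonglongrightarrow> (C i + C i') * 0" by (intro tendsto_intros r_lim)
    then have "\<forall>\<^sub>F j in sequentially. (C i + C i') * r j < d" using d(1) by (intro order_tendstoD(2)) auto
    then show ?thesis by eventually_elim (use d(2) in force)
  qed
  have sep_all: "\<forall>\<^sub>F j in sequentially. \<forall>i\<in>J. \<forall>i'\<in>J. i \<noteq> i' \<longrightarrow> (\<forall>x\<in>E i. \<forall>y\<in>E i'. (C i + C i') * r j < dist x y)"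
    by (intro eventually_ball_finite ballI finite) (use sep in \<open>auto intro: eventually_mono\<close>)
  have main: "\<forall>\<^sub>F j in sequentially. (\<Sum>i\<in>J. of_nat (Suc j) * (\<integral>\<^sup>+x\<in>S i j. ennreal (\<phi> x) \<partial>lborel)) \<le>
      of_nat (Suc j) * (\<integral>\<^sup>+x\<in>shell K th (r j). ennreal (\<phi> x) \<partial>lborel)"
    using small sep_all
  proof eventually_elim
    case (elim j)
    have props: "x \<in> shell K th (r j)" "\<exists>y\<in>E i. norm (x - y) < C i * r j" if "i \<in> J" "x \<in> S i j" for i x
      using convex_direction.shell_over_props[OF cd[OF that(1)] E(2)[OF that(1)] r0 elim(1), of x] that
      by (auto simp: S_def C_def shell_def)
    have uniq: "i = i'" if i: "i \<in> J" "x \<in> S i j" and i': "i' \<in> J" "x \<in> S i' j" for i i' x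
    proof (rule ccontr)
      assume "i \<noteq> i'"
      obtain y y' where y: "y \<in> E i" "norm (x - y) < C i * r j" "y' \<in> E i'" "norm (x - y') < C i' * r j"
        using props(2)[OF i] props(2)[OF i'] by blast
      have "dist y y' \<le> norm (x - y) + norm (x - y')"
        using norm_triangle_ineq4[of "x - y'" "x - y"] by (simp add: dist_norm)
      also have "\<dots> < (C i + C i') * r j" using y by (simp add: algebra_simps)
      finally show False using elim(2) i i' y \<open>i \<noteq> i'\<close> by force
    qed
    have "(\<Sum>i\<in>J. \<integral>\<^sup>+x\<in>S i j. ennreal (\<phi> x) \<partial>lborel) = (\<integral>\<^sup>+x. (\<Sum>i\<in>J. ennreal (\<phi> x) * indicator (S i j) x) \<partial>lborel)"
      using Sm by (intro nn_integral_sum[symmetric]) auto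
    also have "\<dots> \<le> (\<integral>\<^sup>+x\<in>shell K th (r j). ennreal (\<phi> x) \<partial>lborel)"
    proof (rule nn_integral_mono)
      fix x
      show "(\<Sum>i\<in>J. ennreal (\<phi> x) * indicator (S i j) x) \<le> ennreal (\<phi> x) * indicator (shell K th (r j)) x"
      proof (cases "\<exists>i\<in>J. x \<in> S i j")
        case True
        then obtain i where i: "i \<in> J" "x \<in> S i j" by blast
        have "(\<Sum>i\<in>J. ennreal (\<phi> x) * indicator (S i j) x) = (\<Sum>i'\<in>{i}. ennreal (\<phi> x) * indicator (S i' j) x)"
        proof (rule sum.mono_neutral_right)
          show "\<forall>l\<in>J - {i}. ennreal (\<phi> x) * indicator (S l j) x = 0"
          proof
            fix l assume "l \<in> J - {i}"
            then have "x \<notin> S l j" using uniq[OF i, of l] by blast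
            then show "ennreal (\<phi> x) * indicator (S l j) x = 0" by simp
          qed
        qed (use i in auto)
        then show ?thesis using props(1)[OF i] i by simp
      qed (simp add: indicator_def)
    qed
    finally show ?case by (simp add: sum_distrib_left[symmetric] mult_left_mono)
  qed
  have "(\<Sum>i\<in>J. \<integral>\<^sup>+y\<in>E i. ennreal (\<phi> y) \<partial>convex_direction.\<nu> K (th i)) \<le>
      (\<Sum>i\<in>J. liminf (\<lambda>j. of_nat (Suc j) * (\<integral>\<^sup>+x\<in>S i j. ennreal (\<phi> x) \<partial>lborel)))"
  proof (rule sum_mono)
    fix i assume i: "i \<in> J"
    show "(\<integral>\<^sup>+y\<in>E i. ennreal (\<phi> y) \<partial>convex_direction.\<nu> K (th i)) \<le>
      liminf (\<lambda>j. of_nat (Suc j) * (\<integral>\<^sup>+x\<in>S i j. ennreal (\<phi> x) \<partial>lborel))"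
      unfolding S_def r_def
      by (rule convex_direction.nn_integral_\<nu>_le_liminf_shell[OF cd[OF i] E(1)[OF i] E(2)[OF i] leb[OF i] \<phi>m \<phi>0 loc])
  qed
  also have "\<dots> \<le> liminf (\<lambda>j. \<Sum>i\<in>J. of_nat (Suc j) * (\<integral>\<^sup>+x\<in>S i j. ennreal (\<phi> x) \<partial>lborel))"
    by (rule sum_liminf_le) simp
  also have "\<dots> \<le> liminf (\<lambda>j. of_nat (Suc j) * (\<integral>\<^sup>+x\<in>shell K th (r j). ennreal (\<phi> x) \<partial>lborel))"
    by (rule Liminf_mono[OF main])
  finally show ?thesis by (simp add: r_def)
qed

section \<open>Outer normals and comparison with Hausdorff measure\<close>

lemma smooth_outer_normal:
  assumes K: "compact K" "convex K" "interior K \<noteq> {}" and y: "y \<in> frontier K - nonsmooth K"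
  shows "normals K y = {outer_normal K y}"
proof -
  obtain u where u: "u \<in> normals K y" using normals_nonempty[OF K] y by blast
  have uniq: "v = u" if "v \<in> normals K y" for v using u that y by (auto simp: nonsmooth_def)
  have "outer_normal K y = (THE v. v \<in> normals K y)" by (simp add: outer_normal_def normals_def)
  also have "\<dots> = u" using u by (rule the_equality) (rule uniq)
  finally have "outer_normal K y = u" .
  moreover have "normals K y = {u}" using u uniq by blast
  ultimately show ?thesis by simp
qed

text \<open>The graph is closed and the values lie in the compact sphere, which gives continuity; it
  is used to make the boundary weights Borel.\<close>

lemma continuous_on_outer_normal:
  assumes K: "compact K" "convex K" "interior K \<noteq> {}"
  shows "continuous_on (frontier K - nonsmooth K) (outer_normal K)"
proof -
  let ?S = "frontier K - nonsmooth K"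
  have sph: "outer_normal K \<in> ?S \<rightarrow> sphere 0 1"
  proof
    fix y assume "y \<in> ?S"
    from smooth_outer_normal[OF K this] have "outer_normal K y \<in> normals K y" by simp
    then show "outer_normal K y \<in> sphere 0 1" by (simp add: normals_def)
  qed
  have "(\<lambda>x. (x, outer_normal K x)) ` ?S = (?S \<times> sphere 0 1) \<inter> {(y, u). y \<in> frontier K \<and> u \<in> normals K y}"
  proof (intro equalityI subsetI)
    fix p assume "p \<in> (\<lambda>x. (x, outer_normal K x)) ` ?S"
    then show "p \<in> (?S \<times> sphere 0 1) \<inter> {(y, u). y \<in> frontier K \<and> u \<in> normals K y}"
      using smooth_outer_normal[OF K] sph by (auto simp: Pi_iff)
  next
    fix p assume "p \<in> (?S \<times> sphere 0 1) \<inter> {(y, u). y \<in> frontier K \<and> u \<in> normals K y}"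
    then obtain y u where "p = (y, u)" "y \<in> ?S" "u \<in> normals K y" by auto
    then show "p \<in> (\<lambda>x. (x, outer_normal K x)) ` ?S" using smooth_outer_normal[OF K, of y] by auto
  qed
  also have "closedin (top_of_set (?S \<times> sphere 0 1)) \<dots>"
    by (rule closedin_closed_Int) (rule compact_imp_closed[OF normal_graph_compact[OF K(1)]])
  finally show ?thesis
    using continuous_closed_graph_eq[OF compact_sphere sph] by simp
qed

context convex_direction
begin

lemma smooth_in_T:
  assumes "interior K \<noteq> {}" "y \<in> frontier K - nonsmooth K" "\<theta> \<bullet> outer_normal K y < 0"
  shows "y \<in> T"
  using smooth_ray_interior[OF convex_K assms(1) _ smooth_outer_normal[OF compact_K convex_K assms(1,2)] assms(3)]
    assms(2) frontier_subset_K by (auto simp: transversal_def)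

text \<open>The sets where the weight lies in \<open>(t\<^sup>j, t\<^sup>j\<^sup>+\<^sup>1]\<close> are compared one at a time, then
  \<open>t\<close> tends to 1.\<close>

lemma weighted_hausdorff_le_\<nu>:
  assumes int: "interior K \<noteq> {}" and A: "A \<in> sets borel" "A \<subseteq> frontier K - nonsmooth K"
    and neg: "\<And>y. y \<in> A \<Longrightarrow> \<theta> \<bullet> outer_normal K y < 0"
    and a [measurable]: "a \<in> borel_measurable borel" and aeq: "\<And>y. y \<in> A \<Longrightarrow> a y = - (\<theta> \<bullet> outer_normal K y)"
  shows "(\<integral>\<^sup>+y\<in>A. ennreal (a y) \<partial>hausdorff_measure (DIM('a) - 1)) \<le> emeasure \<nu> A"
proof -
  let ?d = "DIM('a) - 1"
  let ?H = "hausdorff_measure ?d :: 'a measure"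
  have [measurable]: "a \<in> borel_measurable ?H" "A \<in> sets ?H" "A \<in> sets borel" using a A by simp_all
  have le: "(\<integral>\<^sup>+y\<in>A. ennreal (a y) \<partial>?H) \<le> ennreal t * emeasure \<nu> A" if t: "t > 1" for t :: real
  proof -
    \<comment> \<open>The lower end is strict because \<open>density_smooth\<close> needs a constant
      strictly below the sharp density.\<close>
    define P where "P j = {y \<in> A. t powr of_int j < a y \<and> a y \<le> t powr (of_int j + 1)}" for j :: int
    have Pm [measurable]: "P j \<in> sets borel" for j unfolding P_def by measurable
    have dP: "disjoint_family P"
    proof -
      have "i = j" if "t powr of_int i < c" "c \<le> t powr (of_int i + 1)" "t powr of_int j < c" "c \<le> t powr (of_int j + 1)"
        for c and i j :: int
      proof -
        have "t powr of_int i < t powr (of_int j + 1)" "t powr of_int j < t powr (of_int i + 1)" using that by linarith+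
        then have "of_int i < (of_int j + 1 :: real)" "of_int j < (of_int i + 1 :: real)" using t by simp_all
        then show ?thesis by linarith
      qed
      then show ?thesis unfolding disjoint_family_on_def P_def by blast
    qed
    have UP: "A = (\<Union>j. P j)"
    proof (intro equalityI subsetI)
      fix y assume y: "y \<in> A"
      then have ay: "a y > 0" using aeq neg by simp
      define j where "j = \<lceil>log t (a y)\<rceil> - 1"
      have j: "of_int j < log t (a y)" "log t (a y) \<le> of_int j + 1" unfolding j_def by linarith+
      have "a y = t powr (log t (a y))" using ay t by simp
      then have "t powr of_int j < a y" "a y \<le> t powr (of_int j + 1)" using j t by (metis powr_less_cancel_iff, metis powr_le_cancel_iff)
      then show "y \<in> (\<Union>j. P j)" using y by (auto simp: P_def)
    qed (auto simp: P_def)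
    have piece: "(\<integral>\<^sup>+y\<in>P j. ennreal (a y) \<partial>?H) \<le> ennreal t * emeasure \<nu> (P j)" for j
    proof -
      have dens: "ennreal (t powr of_int j) * emeasure ?H (P j) \<le> emeasure \<nu> (P j)"
      proof (rule hausdorff_measure_le_of_density[OF sets_\<nu> finite_measure_\<nu> Pm])
        show "0 < t powr of_int j" using t by simp
        fix y and \<epsilon> :: real assume y: "y \<in> P j" and \<epsilon>: "\<epsilon> > 0"
        have yA: "y \<in> A" using y by (simp add: P_def)
        then have ys: "y \<in> frontier K - nonsmooth K" using A by blast
        have "t powr of_int j < - (\<theta> \<bullet> outer_normal K y)" using y aeq[OF yA] by (simp add: P_def)
        then obtain s0 where "s0 > 0" "\<And>s. 0 < s \<Longrightarrow> s \<le> s0 \<Longrightarrow>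
            ennreal (t powr of_int j * unit_ball_vol (real ?d) * s ^ ?d) \<le> emeasure \<nu> (cball y s)"
          using density_smooth[OF int _ smooth_outer_normal[OF compact_K convex_K int ys], of "t powr of_int j"] ys t by auto
        then show "\<exists>s>0. s < \<epsilon> \<and> ennreal (t powr of_int j * unit_ball_vol (real ?d) * s ^ ?d) \<le> emeasure \<nu> (cball y s)"
          using \<epsilon> by (intro exI[of _ "min s0 (\<epsilon> / 2)"]) auto
      qed
      have "(\<integral>\<^sup>+y\<in>P j. ennreal (a y) \<partial>?H) \<le> (\<integral>\<^sup>+y. ennreal (t * t powr of_int j) * indicator (P j) y \<partial>?H)"
        using t by (intro nn_integral_mono) (auto simp: indicator_def P_def powr_add mult.commute intro!: ennreal_leI)
      also have "\<dots> = ennreal t * (ennreal (t powr of_int j) * emeasure ?H (P j))"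
        using t by (subst nn_integral_cmult_indicator) (auto simp: ennreal_mult' mult.assoc)
      also have "\<dots> \<le> ennreal t * emeasure \<nu> (P j)" using dens by (rule mult_left_mono) simp
      finally show ?thesis .
    qed
    let ?D = "density ?H (\<lambda>y. ennreal (a y))"
    have "(\<integral>\<^sup>+y\<in>A. ennreal (a y) \<partial>?H) = emeasure ?D (\<Union>j. P j)" unfolding UP[symmetric] by (simp add: emeasure_density)
    also have "\<dots> = (\<integral>\<^sup>+j. emeasure ?D (P j) \<partial>count_space UNIV)"
      using dP by (intro emeasure_UN_countable) auto
    also have "\<dots> \<le> (\<integral>\<^sup>+j. ennreal t * emeasure \<nu> (P j) \<partial>count_space UNIV)"
      using piece by (intro nn_integral_mono) (simp add: emeasure_density)
    also have "\<dots> = ennreal t * (\<integral>\<^sup>+j. emeasure \<nu> (P j) \<partial>count_space UNIV)" by (rule nn_integral_cmult) simp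
    also have "(\<integral>\<^sup>+j. emeasure \<nu> (P j) \<partial>count_space UNIV) = emeasure \<nu> A"
      unfolding UP using dP by (intro emeasure_UN_countable[symmetric]) auto
    finally show ?thesis .
  qed
  have "((\<lambda>t. ennreal t * emeasure \<nu> A) \<longlongrightarrow> ennreal 1 * emeasure \<nu> A) (at_right 1)"
    by (intro tendsto_mult_ennreal tendsto_ennrealI tendsto_const tendsto_ident_at) auto
  then have "(\<integral>\<^sup>+y\<in>A. ennreal (a y) \<partial>?H) \<le> ennreal 1 * emeasure \<nu> A"
    by (rule tendsto_lowerbound) (use le eventually_at_right_less[of "1::real"] in \<open>auto elim: eventually_mono\<close>)
  then show ?thesis by simp
qed

text \<open>The comparison on every Borel subset of \<open>B\<close> is an inequality of measures,
  and so passes to integrals of nonnegative functions.\<close>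

lemma nn_integral_hausdorff_le_\<nu>:
  assumes int: "interior K \<noteq> {}" and B: "B \<in> sets borel" "B \<subseteq> frontier K - nonsmooth K"
    and neg: "\<And>y. y \<in> B \<Longrightarrow> \<theta> \<bullet> outer_normal K y < 0"
    and a [measurable]: "a \<in> borel_measurable borel" and aeq: "\<And>y. y \<in> B \<Longrightarrow> a y = - (\<theta> \<bullet> outer_normal K y)"
    and f [measurable]: "f \<in> borel_measurable borel"
  shows "(\<integral>\<^sup>+y\<in>B. ennreal (a y) * f y \<partial>hausdorff_measure (DIM('a) - 1)) \<le> (\<integral>\<^sup>+y\<in>B. f y \<partial>\<nu>)"
proof -
  let ?H = "hausdorff_measure (DIM('a) - 1) :: 'a measure"
  have [measurable]: "a \<in> borel_measurable ?H" "f \<in> borel_measurable ?H" "B \<in> sets ?H" "B \<in> sets borel" using a f B by simp_all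
  define D where "D = density ?H (\<lambda>y. ennreal (a y) * indicator B y)"
  have sets_D: "sets D = sets borel" by (simp add: D_def)
  have "D \<le> density \<nu> (indicator B)"
  proof -
    have "emeasure D \<le> emeasure (density \<nu> (indicator B))"
    proof (rule le_funI)
      fix X show "emeasure D X \<le> emeasure (density \<nu> (indicator B)) X"
      proof (cases "X \<in> sets borel")
        case True
        then have [measurable]: "X \<in> sets borel" "X \<in> sets ?H" by auto
        have "emeasure D X = (\<integral>\<^sup>+y\<in>B \<inter> X. ennreal (a y) \<partial>?H)"
          unfolding D_def by (subst emeasure_density) (auto intro!: nn_integral_cong simp: indicator_def)
        also have "\<dots> \<le> emeasure \<nu> (B \<inter> X)"
          using B neg aeq by (intro weighted_hausdorff_le_\<nu>[OF int _ _ _ a]) auto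
        also have "\<dots> = emeasure (density \<nu> (indicator B)) X"
          by (subst emeasure_density) (auto simp: indicator_inter_arith[symmetric])
        finally show ?thesis .
      next
        case False then show ?thesis using sets_D by (simp add: emeasure_notin_sets)
      qed
    qed
    moreover have "space D = space (density \<nu> (indicator B))" "sets D = sets (density \<nu> (indicator B))"
      by (simp_all add: D_def)
    ultimately show ?thesis unfolding le_measure_iff by simp
  qed
  then have "nn_integral D f \<le> nn_integral (density \<nu> (indicator B)) f"
    by (rule nn_integral_mono_measure[rotated]) (simp add: D_def)
  also have "nn_integral (density \<nu> (indicator B)) f = (\<integral>\<^sup>+y\<in>B. f y \<partial>\<nu>)"
    by (subst nn_integral_density) (auto simp: mult.commute)
  also have "nn_integral D f = (\<integral>\<^sup>+y\<in>B. ennreal (a y) * f y \<partial>?H)"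
    unfolding D_def by (subst nn_integral_density) (auto intro!: nn_integral_cong simp: indicator_def)
  finally show ?thesis .
qed

text \<open>The shell estimate needs compact sets inside one \<open>T_part k\<close>. Inner
  regularity of \<nu> supplies compact sets filling \<open>B\<close> up to a null set; as the pieces
  \<open>T_part j\<close> increase to \<open>T\<close>, intersecting with them loses nothing in the
  limit.\<close>

lemma compact_exhaustion:
  assumes B: "B \<in> sets borel" "B \<subseteq> T"
  obtains E where "\<And>j. compact (E j)" "\<And>j. E j \<subseteq> B" "\<And>j. E j \<subseteq> T_part j"
    "\<And>f. f \<in> borel_measurable borel \<Longrightarrow> (\<lambda>j. \<integral>\<^sup>+y\<in>E j. f y \<partial>\<nu>) \<longlonglongrightarrow> (\<integral>\<^sup>+y\<in>B. f y \<partial>\<nu>)"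
proof -
  interpret N: finite_measure \<nu> by (rule finite_measure_\<nu>)
  have "\<exists>C. compact C \<and> C \<subseteq> B \<and> emeasure \<nu> B \<le> emeasure \<nu> C + ennreal (1 / real (Suc j))" for j
  proof (cases "emeasure \<nu> B = 0")
    case True then show ?thesis by (intro exI[of _ "{}"]) auto
  next
    case False
    have "emeasure \<nu> B - ennreal (1 / real (Suc j)) < emeasure \<nu> B"
      using False by (intro ennreal_between) (auto simp: N.emeasure_finite less_top[symmetric] zero_less_iff_neq_zero)
    also have "emeasure \<nu> B = (SUP C\<in>{C. C \<subseteq> B \<and> compact C}. emeasure \<nu> C)"
      using B(1) by (intro inner_regular) auto
    finally obtain C where "C \<subseteq> B" "compact C" "emeasure \<nu> B - ennreal (1 / real (Suc j)) < emeasure \<nu> C"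
      by (auto simp: less_SUP_iff)
    then show ?thesis by (intro exI[of _ C]) (auto simp: ennreal_minus_le_iff add.commute dest: less_imp_le)
  qed
  then obtain C where C: "\<And>j. compact (C j)" "\<And>j. C j \<subseteq> B"
      "\<And>j. emeasure \<nu> B \<le> emeasure \<nu> (C j) + ennreal (1 / real (Suc j))" by metis
  define E where "E j = (\<Union>l\<le>j. C l) \<inter> T_part j" for j
  have Ec: "compact (E j)" for j
    unfolding E_def by (intro compact_Int compact_UN compact_T_part C) auto
  have EB: "E j \<subseteq> B" for j using C(2) by (auto simp: E_def)
  have [measurable]: "E j \<in> sets borel" for j using compact_imp_closed[OF Ec] by simp
  have [measurable]: "C j \<in> sets borel" for j using compact_imp_closed[OF C(1)] by simp
  have [measurable]: "B \<in> sets borel" by fact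
  have inc: "incseq E" unfolding incseq_def E_def using T_part_mono by (fastforce intro: order_trans)
  have UE: "(\<Union>j. E j) = (\<Union>j. C j)"
  proof (intro equalityI subsetI)
    fix y assume "y \<in> (\<Union>j. C j)"
    then obtain l where l: "y \<in> C l" by blast
    then obtain k where k: "y \<in> T_part k" using C(2) B(2) T_eq_UN by blast
    have "y \<in> E (max l k)" using l k T_part_mono[of k "max l k"] by (auto simp: E_def)
    then show "y \<in> (\<Union>j. E j)" by blast
  qed (auto simp: E_def)
  have null: "emeasure \<nu> (B - (\<Union>j. E j)) = 0"
  proof -
    have "emeasure \<nu> (B - (\<Union>j. E j)) \<le> ennreal (1 / real (Suc j))" for j
    proof -
      have "emeasure \<nu> (B - (\<Union>j. E j)) \<le> emeasure \<nu> (B - C j)" unfolding UE by (rule emeasure_mono) auto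
      also have "\<dots> = emeasure \<nu> B - emeasure \<nu> (C j)" using C(2) by (intro emeasure_Diff) auto
      also have "\<dots> \<le> ennreal (1 / real (Suc j))" using C(3) by (simp add: ennreal_minus_le_iff)
      finally show ?thesis .
    qed
    moreover have "(\<lambda>j. ennreal (1 / real (Suc j))) \<longlonglongrightarrow> ennreal 0"
      using LIMSEQ_inverse_real_of_nat by (intro tendsto_ennrealI) (simp add: inverse_eq_divide)
    ultimately have "emeasure \<nu> (B - (\<Union>j. E j)) \<le> ennreal 0"
      by (intro LIMSEQ_le_const[of "\<lambda>j. ennreal (1 / real (Suc j))"]) auto
    then show ?thesis by simp
  qed
  show thesis
  proof (rule that[OF Ec EB])
    show "E j \<subseteq> T_part j" for j by (simp add: E_def)
    fix f :: "'a \<Rightarrow> ennreal" assume [measurable]: "f \<in> borel_measurable borel"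
    have "(\<lambda>j. \<integral>\<^sup>+y\<in>E j. f y \<partial>\<nu>) \<longlonglongrightarrow> (\<integral>\<^sup>+y\<in>(\<Union>j. E j). f y \<partial>\<nu>)"
    proof (rule nn_integral_LIMSEQ)
      show "incseq (\<lambda>j y. f y * indicator (E j) y)"
        using inc by (auto simp: incseq_def le_fun_def indicator_def)
      show "(\<lambda>j. f y * indicator (E j) y) \<longlonglongrightarrow> f y * indicator (\<Union>j. E j) y" for y
      proof (cases "y \<in> (\<Union>j. E j)")
        case True
        then obtain l where "y \<in> E l" by blast
        then have "\<forall>\<^sub>F j in sequentially. f y * indicator (E j) y = f y * indicator (\<Union>j. E j) y"
          using inc by (intro eventually_sequentiallyI[of l]) (auto simp: incseq_def indicator_def)
        then show ?thesis by (rule tendsto_eventually)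
      qed (auto simp: indicator_def)
    qed auto
    also have "(\<integral>\<^sup>+y\<in>(\<Union>j. E j). f y \<partial>\<nu>) = (\<integral>\<^sup>+y\<in>B. f y \<partial>\<nu>)"
    proof (rule nn_integral_cong_AE)
      have "AE y in \<nu>. y \<notin> B - (\<Union>j. E j)" using null by (intro AE_not_in) (simp add: null_sets_def)
      then show "AE y in \<nu>. f y * indicator (\<Union>j. E j) y = f y * indicator B y"
        by eventually_elim (use EB in \<open>auto simp: indicator_def\<close>)
    qed
    finally show "(\<lambda>j. \<integral>\<^sup>+y\<in>E j. f y \<partial>\<nu>) \<longlonglongrightarrow> (\<integral>\<^sup>+y\<in>B. f y \<partial>\<nu>)" .
  qed
qed

end

text \<open>The frontier is split according to the first index attaining the maximum, because only on
  disjoint pieces are the parts of the shell swept in the different directions disjoint.\<close>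

lemma boundary_integral_le_liminf_shell:
  fixes K :: "'a::euclidean_space set" and th :: "'m::finite \<Rightarrow> 'a"
  assumes K: "compact K" "convex K" "interior K \<noteq> {}"
    and \<phi>m [measurable]: "\<phi> \<in> borel_measurable borel" and \<phi>0: "\<And>x. 0 \<le> \<phi> x"
    and loc: "\<And>C. compact C \<Longrightarrow> set_integrable lborel C \<phi>"
    and leb: "frontier K \<subseteq> lebesgue_set \<phi>"
  shows "(\<integral>\<^sup>+y\<in>frontier K. ennreal (Max (range (\<lambda>i. neg_part (th i \<bullet> outer_normal K y))) * \<phi> y)
        \<partial>hausdorff_measure (DIM('a) - 1)) \<le>
    liminf (\<lambda>j. of_nat (Suc j) * (\<integral>\<^sup>+x\<in>shell K th (1 / real (Suc j)). ennreal (\<phi> x) \<partial>lborel))"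
    (is "_ \<le> ?S")
proof -
  let ?H = "hausdorff_measure (DIM('a) - 1) :: 'a measure"
  \<comment> \<open>The index type carries no order; \<open>ix\<close> provides one for breaking
    ties of the maximum.\<close>
  obtain ix :: "'m \<Rightarrow> nat" where ix: "inj ix"
    by (metis finite_imp_inj_to_nat_seg finite_class.finite_UNIV)
  define Sm where "Sm = frontier K - nonsmooth K"
  have [measurable]: "nonsmooth K \<in> sets borel" by (rule nonsmooth_measurable[OF K(1)])
  have [measurable]: "Sm \<in> sets borel" by (simp add: Sm_def)
  \<comment> \<open>Cutting off by the indicator of the smooth points makes the weight Borel on the
    whole space.\<close>
  define a where "a i y = - (th i \<bullet> (indicator Sm y *\<^sub>R outer_normal K y))" for i y
  have nm: "(\<lambda>y. indicator Sm y *\<^sub>R outer_normal K y) \<in> borel_measurable borel"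
    by (rule borel_measurable_continuous_on_indicator)
      (use continuous_on_outer_normal[OF K] in \<open>auto simp: Sm_def\<close>)
  have am [measurable]: "a i \<in> borel_measurable borel" for i
    unfolding a_def by (intro borel_measurable_uminus borel_measurable_inner borel_measurable_const nm)
  have [measurable]: "a i \<in> borel_measurable ?H" for i using am by simp
  have aS: "a i y = - (th i \<bullet> outer_normal K y)" if "y \<in> Sm" for i y using that by (simp add: a_def)
  define B where "B i = {y \<in> Sm. 0 < a i y \<and> (\<forall>l. a l y \<le> a i y) \<and> (\<forall>l. ix l < ix i \<longrightarrow> a l y < a i y)}" for i
  have Bm [measurable]: "B i \<in> sets borel" for i unfolding B_def by measurable
  have [measurable]: "B i \<in> sets ?H" for i by simp
  have Bdisj: "B i \<inter> B i' = {}" if "i \<noteq> i'" for i i'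
  proof -
    have "ix i \<noteq> ix i'" using ix that by (auto dest: injD)
    moreover have "\<not> ix i < ix i'" if "x \<in> B i" "x \<in> B i'" for i i' x
    proof
      assume "ix i < ix i'"
      then have "a i x < a i' x" using that(2) by (simp add: B_def)
      moreover have "a i' x \<le> a i x" using that(1) by (simp add: B_def)
      ultimately show False by simp
    qed
    ultimately show ?thesis by (metis disjoint_iff linorder_neqE_nat)
  qed
  have mx: "Max (range (\<lambda>i. neg_part (th i \<bullet> outer_normal K y))) = (\<Sum>i\<in>UNIV. a i y * indicator (B i) y)"
    if y: "y \<in> Sm" for y
  proof -
    have np: "neg_part (th i \<bullet> outer_normal K y) = max 0 (a i y)" for i
      using aS[OF y] by (simp add: neg_part_def)
    show ?thesis
    proof (cases "\<exists>i. 0 < a i y")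
      case False
      then have "neg_part (th i \<bullet> outer_normal K y) = 0" for i using np by (simp add: max_def) (meson not_le order_antisym)
      moreover have "y \<notin> B i" for i using False by (auto simp: B_def)
      ultimately show ?thesis by simp
    next
      case True
      define m where "m = Max (range (\<lambda>i. a i y))"
      have m: "m \<in> range (\<lambda>i. a i y)" "\<And>i. a i y \<le> m" unfolding m_def by (rule Max_in) (auto intro: Max_ge)
      have m0: "m > 0" using True m(2) by (meson less_le_trans)
      define i where "i = arg_min ix (\<lambda>i. a i y = m)"
      have i: "a i y = m" "\<And>l. a l y = m \<Longrightarrow> ix i \<le> ix l"
        using m(1) arg_min_nat_lemma[of "\<lambda>i. a i y = m" _ ix] unfolding i_def by auto
      have yB: "y \<in> B i" unfolding B_def using y i m m0 by (auto simp: less_le) (metis not_le order_less_le)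
      then have "y \<notin> B l" if "l \<noteq> i" for l using Bdisj[OF that] by blast
      then have "(\<Sum>l\<in>UNIV. a l y * indicator (B l) y) = (\<Sum>l\<in>{i}. a l y * indicator (B l) y)"
        by (intro sum.mono_neutral_right) (auto simp: indicator_def)
      also have "\<dots> = m" using yB i by simp
      finally have "(\<Sum>l\<in>UNIV. a l y * indicator (B l) y) = m" .
      moreover have "Max (range (\<lambda>i. neg_part (th i \<bullet> outer_normal K y))) = m"
        unfolding np
      proof (rule Max_eqI)
        show "m \<in> range (\<lambda>i. max 0 (a i y))" using i(1) m0 by (auto intro!: image_eqI[of _ _ i])
      qed (use m m0 in auto)
      ultimately show ?thesis by simp
    qed
  qed
  \<comment> \<open>Components equal to 0 define no direction; their weight vanishes, so their
    pieces are empty.\<close>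
  define J where "J = {i. th i \<noteq> 0}"
  have BJ: "B i = {}" if "i \<notin> J" for i using that by (auto simp: B_def J_def a_def)
  have cd: "convex_direction K (th i)" if "i \<in> J" for i using K that by unfold_locales (auto simp: J_def)
  have BT: "B i \<subseteq> transversal K (th i)" if "i \<in> J" for i
    using convex_direction.smooth_in_T[OF cd[OF that] K(3)] aS by (force simp: B_def Sm_def)
  have "AE y in ?H. y \<notin> nonsmooth K"
    using hausdorff_nonsmooth[OF K] by (intro AE_not_in) (simp add: null_sets_def)
  then have "(\<integral>\<^sup>+y\<in>frontier K. ennreal (Max (range (\<lambda>i. neg_part (th i \<bullet> outer_normal K y))) * \<phi> y) \<partial>?H) =
      (\<integral>\<^sup>+y. (\<Sum>i\<in>UNIV. ennreal (a i y) * ennreal (\<phi> y) * indicator (B i) y) \<partial>?H)"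
  proof (intro nn_integral_cong_AE, elim eventually_mono)
    fix y assume ns: "y \<notin> nonsmooth K"
    show "ennreal (Max (range (\<lambda>i. neg_part (th i \<bullet> outer_normal K y))) * \<phi> y) * indicator (frontier K) y =
      (\<Sum>i\<in>UNIV. ennreal (a i y) * ennreal (\<phi> y) * indicator (B i) y)"
    proof (cases "y \<in> frontier K")
      case True
      then have y: "y \<in> Sm" using ns by (simp add: Sm_def)
      have nn: "0 \<le> a i y * indicator (B i) y * \<phi> y" for i using \<phi>0 by (auto simp: indicator_def B_def)
      have "ennreal (Max (range (\<lambda>i. neg_part (th i \<bullet> outer_normal K y))) * \<phi> y) = ennreal (\<Sum>i\<in>UNIV. a i y * indicator (B i) y * \<phi> y)"
        unfolding mx[OF y] by (simp only: sum_distrib_right)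
      also have "\<dots> = (\<Sum>i\<in>UNIV. ennreal (a i y * indicator (B i) y * \<phi> y))" using nn by (intro sum_ennreal[symmetric]) auto
      also have "\<dots> = (\<Sum>i\<in>UNIV. ennreal (a i y) * ennreal (\<phi> y) * indicator (B i) y)"
        using \<phi>0 by (intro sum.cong refl) (auto simp: indicator_def ennreal_mult'')
      finally show ?thesis using True by simp
    next
      case False
      then have "y \<notin> B i" for i by (auto simp: B_def Sm_def)
      then show ?thesis using False by simp
    qed
  qed
  also have "\<dots> = (\<Sum>i\<in>UNIV. \<integral>\<^sup>+y. ennreal (a i y) * ennreal (\<phi> y) * indicator (B i) y \<partial>?H)"
  proof (rule nn_integral_sum)
    have "\<phi> \<in> borel_measurable ?H" using \<phi>m by simp
    then show "(\<lambda>y. ennreal (a i y) * ennreal (\<phi> y) * indicator (B i) y) \<in> borel_measurable ?H" for i by measurable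
  qed
  also have "\<dots> = (\<Sum>i\<in>J. \<integral>\<^sup>+y. ennreal (a i y) * ennreal (\<phi> y) * indicator (B i) y \<partial>?H)"
    using BJ by (intro sum.mono_neutral_right) auto
  also have "\<dots> \<le> (\<Sum>i\<in>J. \<integral>\<^sup>+y\<in>B i. ennreal (\<phi> y) \<partial>convex_direction.\<nu> K (th i))"
  proof (rule sum_mono)
    fix i assume i: "i \<in> J"
    show "(\<integral>\<^sup>+y. ennreal (a i y) * ennreal (\<phi> y) * indicator (B i) y \<partial>?H) \<le> (\<integral>\<^sup>+y\<in>B i. ennreal (\<phi> y) \<partial>convex_direction.\<nu> K (th i))"
      by (rule convex_direction.nn_integral_hausdorff_le_\<nu>[OF cd[OF i] K(3) Bm _ _ am])
        (use aS in \<open>force simp: B_def Sm_def\<close>)+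
  qed
  also have "\<dots> \<le> ?S"
  proof -
    have "\<exists>E. (\<forall>j. compact (E j) \<and> E j \<subseteq> B i \<and> E j \<subseteq> convex_direction.T_part K (th i) j) \<and>
      (\<lambda>j. \<integral>\<^sup>+y\<in>E j. ennreal (\<phi> y) \<partial>convex_direction.\<nu> K (th i)) \<longlonglongrightarrow> (\<integral>\<^sup>+y\<in>B i. ennreal (\<phi> y) \<partial>convex_direction.\<nu> K (th i))"
      if i: "i \<in> J" for i
    proof -
      interpret convex_direction K "th i" by (rule cd[OF i])
      obtain E where E: "\<And>j. compact (E j)" "\<And>j. E j \<subseteq> B i" "\<And>j. E j \<subseteq> T_part j"
        "\<And>f. f \<in> borel_measurable borel \<Longrightarrow> (\<lambda>j. \<integral>\<^sup>+y\<in>E j. f y \<partial>\<nu>) \<longlonglongrightarrow> (\<integral>\<^sup>+y\<in>B i. f y \<partial>\<nu>)"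
        using compact_exhaustion[OF Bm BT[OF i]] by blast
      have "(\<lambda>y. ennreal (\<phi> y)) \<in> borel_measurable borel" by measurable
      then show ?thesis using E by blast
    qed
    then have "\<forall>i\<in>J. \<exists>E. (\<forall>j. compact (E j) \<and> E j \<subseteq> B i \<and> E j \<subseteq> convex_direction.T_part K (th i) j) \<and>
      (\<lambda>j. \<integral>\<^sup>+y\<in>E j. ennreal (\<phi> y) \<partial>convex_direction.\<nu> K (th i)) \<longlonglongrightarrow> (\<integral>\<^sup>+y\<in>B i. ennreal (\<phi> y) \<partial>convex_direction.\<nu> K (th i))"
      by (rule ballI)
    from bchoice[OF this] obtain E where EE: "\<forall>i\<in>J. (\<forall>j. compact (E i j) \<and> E i j \<subseteq> B i \<and> E i j \<subseteq> convex_direction.T_part K (th i) j) \<and>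
      (\<lambda>j. \<integral>\<^sup>+y\<in>E i j. ennreal (\<phi> y) \<partial>convex_direction.\<nu> K (th i)) \<longlonglongrightarrow> (\<integral>\<^sup>+y\<in>B i. ennreal (\<phi> y) \<partial>convex_direction.\<nu> K (th i))"
      by (rule exE)
    have E: "compact (E i j) \<and> E i j \<subseteq> B i \<and> E i j \<subseteq> convex_direction.T_part K (th i) j"
      and lim: "(\<lambda>j. \<integral>\<^sup>+y\<in>E i j. ennreal (\<phi> y) \<partial>convex_direction.\<nu> K (th i)) \<longlonglongrightarrow> (\<integral>\<^sup>+y\<in>B i. ennreal (\<phi> y) \<partial>convex_direction.\<nu> K (th i))"
      if "i \<in> J" for i j using EE that by blast+
    have "(\<lambda>j. \<Sum>i\<in>J. \<integral>\<^sup>+y\<in>E i j. ennreal (\<phi> y) \<partial>convex_direction.\<nu> K (th i)) \<longlonglongrightarrow>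
        (\<Sum>i\<in>J. \<integral>\<^sup>+y\<in>B i. ennreal (\<phi> y) \<partial>convex_direction.\<nu> K (th i))"
      by (intro tendsto_sum lim)
    \<comment> \<open>For fixed \<open>j\<close> the thickness of the shell tends to 0 first. The
      bound \<open>?S\<close> does not depend on \<open>j\<close>, so the exhaustion is completed
      afterwards.\<close>
    moreover have "(\<Sum>i\<in>J. \<integral>\<^sup>+y\<in>E i j. ennreal (\<phi> y) \<partial>convex_direction.\<nu> K (th i)) \<le> ?S" for j
    proof (rule sum_nn_integral_\<nu>_le_liminf_shell[OF K(1,2)])
      show "E i j \<subseteq> lebesgue_set \<phi>" if "i \<in> J" for i
        using E[OF that, of j] leb by (auto simp: B_def Sm_def)
      show "E i j \<inter> E i' j = {}" if "i \<in> J" "i' \<in> J" "i \<noteq> i'" for i i'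
        using E[OF that(1), of j] E[OF that(2), of j] Bdisj[OF that(3)] by blast
    qed (use E \<phi>m \<phi>0 loc in \<open>auto simp: J_def\<close>)
    ultimately show ?thesis by (intro LIMSEQ_le_const2) auto
  qed
  finally show ?thesis .
qed

section \<open>The covariogram and the inclusions\<close>

lemma C_const_eq:
  "C_const Q p \<mu> K = extend_at_0 (\<lambda>p. inverse (profile_mean (measure \<mu> K) (\<lambda>t. Q_inv Q (measure \<mu> K) (Q (measure \<mu> K) - t)) p)) p"
  unfolding C_const_def
proof (rule extend_at_0_cong)
  fix p :: real assume p: "p \<noteq> 0"
  show "C_const_nz Q \<mu> K p = inverse (profile_mean (measure \<mu> K) (\<lambda>t. Q_inv Q (measure \<mu> K) (Q (measure \<mu> K) - t)) p)"
    using epowr_uminus[of "1 / p"] p by (simp add: C_const_nz_def profile_mean_def moment_int_def Let_def)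
qed

text \<open>An infinite \<open>cp\<close> makes the right side the whole space. Otherwise the
  inclusion is tested on each ray; \<open>cq \<le> cp\<close> keeps \<open>cq\<close> finite, and
  the finite \<open>\<rho>p\<close> keeps the comparison within real radii.\<close>

lemma dilate_star_body_mono:
  assumes "cp \<noteq> \<infinity> \<Longrightarrow> cq \<le> cp"
    and "\<And>\<theta>. cp \<noteq> \<infinity> \<Longrightarrow> norm \<theta> = 1 \<Longrightarrow> cq * \<rho>q \<theta> \<le> cp * \<rho>p \<theta>"
    and fin: "\<And>\<theta>. norm \<theta> = 1 \<Longrightarrow> \<rho>p \<theta> \<noteq> \<infinity>"
  shows "dilate cq (star_body \<rho>q) \<subseteq> dilate cp (star_body \<rho>p)"
proof (cases "cp = \<infinity>")
  case False
  have cq: "cq \<le> cp" "cq \<noteq> \<infinity>" using assms(1)[OF False] False by (auto simp: top_unique)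
  define a b where "a = enn2real cq" and "b = enn2real cp"
  have ab: "cq = ennreal a" "cp = ennreal b" "0 \<le> a" "0 \<le> b"
    using False cq by (auto simp: a_def b_def less_top)
  show ?thesis
  proof
    fix x assume "x \<in> dilate cq (star_body \<rho>q)"
    then obtain t \<theta> where x: "x = a *\<^sub>R t *\<^sub>R \<theta>" "norm \<theta> = 1" "0 \<le> t" "ennreal t \<le> \<rho>q \<theta>"
      using cq by (auto simp: dilate_def star_body_def a_def)
    have "ennreal (a * t) \<le> cq * \<rho>q \<theta>" using x ab by (simp add: ennreal_mult mult_left_mono)
    also have "\<dots> \<le> cp * \<rho>p \<theta>" by (rule assms(2)[OF False x(2)])
    finally have le: "ennreal (a * t) \<le> ennreal b * \<rho>p \<theta>" by (simp add: ab)
    obtain r where r: "\<rho>p \<theta> = ennreal r" "0 \<le> r" using fin[OF x(2)] by (cases "\<rho>p \<theta>") auto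
    have le': "a * t \<le> b * r" using le ab r by (simp add: ennreal_mult'[symmetric])
    define s where "s = (if b = 0 then 0 else a * t / b)"
    have s: "0 \<le> s" "s \<le> r" "b * s = a * t"
      using le' ab x(3) r cq by (auto simp: s_def divide_le_eq mult.commute)
    have "s *\<^sub>R \<theta> \<in> star_body \<rho>p" unfolding star_body_def using s x(2) r by (auto intro!: exI[of _ s] exI[of _ \<theta>] ennreal_leI)
    then have "b *\<^sub>R (s *\<^sub>R \<theta>) \<in> (\<lambda>x. b *\<^sub>R x) ` star_body \<rho>p" by (rule imageI)
    also have "\<dots> = dilate cp (star_body \<rho>p)" using False by (simp add: dilate_def b_def)
    finally have "b *\<^sub>R s *\<^sub>R \<theta> \<in> dilate cp (star_body \<rho>p)" .
    then show "x \<in> dilate cp (star_body \<rho>p)" using x(1) s(3) by simp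
  qed
qed (simp add: dilate_def)

section \<open>Level sets of the radial function and the covariogram\<close>

locale body_with_density =
  fixes K :: "(real^'n) set" and \<mu> :: "(real^'n) measure" and \<phi> :: "real^'n \<Rightarrow> real"
  assumes body: "convex_body K"
    and dens: "has_loc_density \<mu> \<phi>"
    and pos: "0 < emeasure \<mu> K"
    and fin: "emeasure \<mu> K < \<infinity>"
begin

definition M :: real where "M = measure \<mu> K"

definition cap :: "(real^'n)^'m \<Rightarrow> real \<Rightarrow> (real^'n) set" where
  "cap \<theta> r = {x \<in> K. \<forall>i. x - r *\<^sub>R (\<theta> $ i) \<in> K}"

definition covariogram :: "(real^'n)^'m \<Rightarrow> real \<Rightarrow> real" where
  "covariogram \<theta> r = measure \<mu> (cap \<theta> r)"

text \<open>The value 0 outside \<open>K\<close> makes its superlevel sets at positive levels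
  exactly the sets \<open>cap\<close>.\<close>

definition min_radial :: "(real^'n)^'m \<Rightarrow> real^'n \<Rightarrow> ennreal" where
  "min_radial \<theta> x = (if x \<in> K then INF i. radial_fun ((\<lambda>y. y - x) ` K) (- (\<theta> $ i)) else 0)"

definition N :: "(real^'n) measure" where
  "N = density lborel (\<lambda>x. ennreal (\<phi> x) * indicator K x)"

lemma K_props: "compact K" "convex K" "interior K \<noteq> {}" "closed K"
  using body compact_imp_closed by (auto simp: convex_body_def)

lemma K_measurable [measurable]: "K \<in> sets borel"
  using K_props(4) by simp

lemma \<phi>_measurable [measurable]: "\<phi> \<in> borel_measurable borel" and \<phi>_nonneg: "0 \<le> \<phi> x"
  and \<phi>_loc: "compact C \<Longrightarrow> set_integrable lborel C \<phi>"
  and \<mu>_eq: "\<mu> = density lborel (\<lambda>x. ennreal (\<phi> x))"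
  using dens by (auto simp: has_loc_density_def)

lemma sets_\<mu> [simp]: "sets \<mu> = sets borel"
  by (simp add: \<mu>_eq)

lemma M_props: "0 < M" "emeasure \<mu> K = ennreal M"
  using pos fin by (auto simp: M_def measure_def enn2real_positive_iff less_top)

lemma emeasure_N: "A \<in> sets borel \<Longrightarrow> A \<subseteq> K \<Longrightarrow> emeasure N A = emeasure \<mu> A"
  unfolding N_def \<mu>_eq
  by (subst (1 2) emeasure_density) (auto intro!: nn_integral_cong simp: indicator_def)

lemma N_space: "space N = UNIV" "sets N = sets borel" "emeasure N (space N) = ennreal M"
proof -
  show "space N = UNIV" "sets N = sets borel" by (simp_all add: N_def)
  have "emeasure N UNIV = emeasure N K"
    unfolding N_def by (subst (1 2) emeasure_density) (auto intro!: nn_integral_cong simp: indicator_def)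
  then show "emeasure N (space N) = ennreal M" using emeasure_N[OF K_measurable] M_props by (simp add: N_def)
qed

lemma finite_N: "finite_measure N"
  by standard (simp add: N_space(3))

lemma closed_cap: "closed (cap \<theta> r)"
proof -
  have "cap \<theta> r = K \<inter> (\<Inter>i. (\<lambda>x. x - r *\<^sub>R (\<theta> $ i)) -` K)" by (auto simp: cap_def)
  also have "closed \<dots>" by (intro closed_Int closed_INT ballI closed_vimage K_props continuous_intros)
  finally show ?thesis .
qed

lemma cap_measurable [measurable]: "cap \<theta> r \<in> sets borel"
  by (rule borel_closed[OF closed_cap])

lemma cap_compact_convex: "cap \<theta> r \<in> compact_convex_subsets K"
proof -
  have sub: "cap \<theta> r \<subseteq> K" by (auto simp: cap_def)
  have "compact (K \<inter> cap \<theta> r)" by (intro compact_Int_closed K_props closed_cap)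
  then have "compact (cap \<theta> r)" using sub by (simp add: Int_absorb1)
  moreover have "convex (cap \<theta> r)"
  proof (rule convexI)
    fix x y u v assume *: "x \<in> cap \<theta> r" "y \<in> cap \<theta> r" "0 \<le> (u::real)" "0 \<le> v" "u + v = 1"
    have "u *\<^sub>R x + v *\<^sub>R y - r *\<^sub>R (\<theta> $ i) \<in> K" for i
    proof -
      have "u *\<^sub>R (x - r *\<^sub>R (\<theta> $ i)) + v *\<^sub>R (y - r *\<^sub>R (\<theta> $ i)) \<in> K"
        using * convexD[OF K_props(2)] by (auto simp: cap_def)
      also have "u *\<^sub>R (x - r *\<^sub>R (\<theta> $ i)) + v *\<^sub>R (y - r *\<^sub>R (\<theta> $ i)) = u *\<^sub>R x + v *\<^sub>R y - (u + v) *\<^sub>R r *\<^sub>R (\<theta> $ i)"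
        by (simp add: algebra_simps)
      finally show ?thesis using *(5) by simp
    qed
    then show "u *\<^sub>R x + v *\<^sub>R y \<in> cap \<theta> r" using * convexD[OF K_props(2)] by (auto simp: cap_def)
  qed
  ultimately show ?thesis using sub by (simp add: compact_convex_subsets_def)
qed

lemma emeasure_cap: "emeasure \<mu> (cap \<theta> r) = ennreal (covariogram \<theta> r)"
proof -
  have "emeasure \<mu> (cap \<theta> r) \<le> emeasure \<mu> K" by (rule emeasure_mono) (auto simp: cap_def)
  then have "emeasure \<mu> (cap \<theta> r) < \<infinity>" using fin by (rule le_less_trans)
  then show ?thesis by (simp add: covariogram_def measure_def less_top)
qed

text \<open>The supremum is attained: convexity fills in all parameters below it, and closedness
  adds the endpoint.\<close>

lemma radial_ge_iff:
  assumes x: "x \<in> K" and r: "r > 0"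
  shows "ennreal r \<le> radial_fun ((\<lambda>y. y - x) ` K) (- v) \<longleftrightarrow> x - r *\<^sub>R v \<in> K"
proof -
  have mem: "\<tau> *\<^sub>R (- v) \<in> (\<lambda>y. y - x) ` K \<longleftrightarrow> x - \<tau> *\<^sub>R v \<in> K" for \<tau>
  proof
    assume "\<tau> *\<^sub>R (- v) \<in> (\<lambda>y. y - x) ` K"
    then obtain y where "y \<in> K" "\<tau> *\<^sub>R (- v) = y - x" by blast
    then have "y \<in> K" "y = x - \<tau> *\<^sub>R v" by (auto simp: algebra_simps)
    then show "x - \<tau> *\<^sub>R v \<in> K" by simp
  next
    assume "x - \<tau> *\<^sub>R v \<in> K"
    then show "\<tau> *\<^sub>R (- v) \<in> (\<lambda>y. y - x) ` K" by (intro image_eqI[of _ _ "x - \<tau> *\<^sub>R v"]) auto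
  qed
  show ?thesis
  proof
    assume le: "ennreal r \<le> radial_fun ((\<lambda>y. y - x) ` K) (- v)"
    have below: "x - s *\<^sub>R v \<in> K" if s: "0 \<le> s" "s < r" for s
    proof -
      have "ennreal s < ennreal r" using s by (simp add: ennreal_less_iff)
      from less_le_trans[OF this le] have "ennreal s < radial_fun ((\<lambda>y. y - x) ` K) (- v)" .
      then obtain \<tau> where \<tau>: "x - \<tau> *\<^sub>R v \<in> K" "ennreal s < ennreal \<tau>"
        unfolding radial_fun_def less_SUP_iff mem by blast
      then have "s < \<tau>" using s by (simp add: ennreal_less_iff)
      then have "0 < \<tau>" "s / \<tau> \<le> 1" using s by (auto simp: field_simps)
      then have "(1 - s / \<tau>) *\<^sub>R x + (s / \<tau>) *\<^sub>R (x - \<tau> *\<^sub>R v) \<in> K"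
        using s by (intro convexD[OF K_props(2) x \<tau>(1)]) auto
      then show ?thesis using \<open>0 < \<tau>\<close> by (simp add: algebra_simps)
    qed
    have "(\<lambda>j. x - (r * (1 - 1 / real (Suc j))) *\<^sub>R v) \<longlonglongrightarrow> x - (r * (1 - 0)) *\<^sub>R v"
      using LIMSEQ_inverse_real_of_nat by (intro tendsto_intros) (simp add: inverse_eq_divide)
    moreover have "x - (r * (1 - 1 / real (Suc j))) *\<^sub>R v \<in> K" for j
      using r by (intro below) (auto simp: field_simps)
    ultimately show "x - r *\<^sub>R v \<in> K"
      using closed_sequentially[OF K_props(4)] by fastforce
  next
    assume "x - r *\<^sub>R v \<in> K"
    then show "ennreal r \<le> radial_fun ((\<lambda>y. y - x) ` K) (- v)"
      unfolding radial_fun_def mem by (intro SUP_upper) simp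
  qed
qed

lemma min_radial_ge_iff: "r > 0 \<Longrightarrow> ennreal r \<le> min_radial \<theta> x \<longleftrightarrow> x \<in> cap \<theta> r"
proof (cases "x \<in> K")
  case True
  assume "r > 0"
  then show ?thesis using True by (simp add: min_radial_def le_INF_iff radial_ge_iff cap_def)
next
  case False
  assume "r > 0"
  then show ?thesis using False by (simp add: min_radial_def cap_def)
qed

lemma cap_empty:
  fixes \<theta> :: "(real^'n)^'m"
  assumes "norm \<theta> = 1" shows "\<exists>R>0. \<forall>r>R. cap \<theta> r = {}"
proof -
  obtain B where B: "\<And>y. y \<in> K \<Longrightarrow> norm y \<le> B" using compact_imp_bounded[OF K_props(1)] by (auto simp: bounded_iff)
  have "\<theta> \<noteq> 0" using assms by auto
  then obtain i where i: "\<theta> $ i \<noteq> 0" by (auto simp: vec_eq_iff)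
  define R where "R = max 1 (2 * B / norm (\<theta> $ i))"
  have "cap \<theta> r = {}" if r: "r > R" for r
  proof (rule ccontr)
    assume "cap \<theta> r \<noteq> {}"
    then obtain x where x: "x \<in> K" "x - r *\<^sub>R (\<theta> $ i) \<in> K" by (auto simp: cap_def)
    have "norm (r *\<^sub>R (\<theta> $ i)) \<le> norm x + norm (x - r *\<^sub>R (\<theta> $ i))"
      using norm_triangle_ineq4[of x "x - r *\<^sub>R (\<theta> $ i)"] by simp
    then have "\<bar>r\<bar> * norm (\<theta> $ i) \<le> 2 * B" using B[OF x(1)] B[OF x(2)] by simp
    moreover have "2 * B / norm (\<theta> $ i) < r" "0 < r" using r by (auto simp: R_def)
    ultimately show False using i by (simp add: field_simps)
  qed
  then show ?thesis by (intro exI[of _ R]) (simp add: R_def)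
qed

lemma min_radial_finite:
  fixes \<theta> :: "(real^'n)^'m"
  assumes "norm \<theta> = 1" shows "min_radial \<theta> x < \<infinity>"
proof -
  obtain R where R: "R > 0" "\<And>r. r > R \<Longrightarrow> cap \<theta> r = {}" using cap_empty[OF assms] by blast
  have "\<not> ennreal (R + 1) \<le> min_radial \<theta> x" using R by (subst min_radial_ge_iff) auto
  then have "min_radial \<theta> x < ennreal (R + 1)" by (simp only: not_le)
  also have "\<dots> < \<infinity>" by simp
  finally show ?thesis .
qed

lemma min_radial_measurable:
  fixes \<theta> :: "(real^'n)^'m"
  assumes "norm \<theta> = 1" shows "min_radial \<theta> \<in> borel_measurable borel"
proof (rule borel_measurableI_ge)
  fix y :: ennreal
  show "{x \<in> space borel. y \<le> min_radial \<theta> x} \<in> sets borel"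
  proof (cases y rule: ennreal_cases_pos)
    case 2
    then have "\<not> y \<le> min_radial \<theta> x" for x using min_radial_finite[OF assms, of x] by (simp only: not_le)
    then show ?thesis by simp
  qed (auto simp: min_radial_ge_iff)
qed

lemma min_radial_pos:
  assumes "x \<in> interior K" shows "0 < min_radial (\<theta> :: (real^'n)^'m) x"
proof -
  obtain e where e: "e > 0" "cball x e \<subseteq> K" using assms by (auto simp: mem_interior_cball)
  define B where "B = 1 + norm \<theta>"
  have B: "B > 0" by (simp add: B_def add_pos_nonneg)
  have "x - (e / B) *\<^sub>R (\<theta> $ i) \<in> K" for i
  proof -
    have "norm (\<theta> $ i) \<le> norm \<theta>" by (rule Finite_Cartesian_Product.norm_nth_le)
    then have "norm (\<theta> $ i) \<le> B" by (simp add: B_def)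
    then have "e / B * norm (\<theta> $ i) \<le> e / B * B" using e B by (intro mult_left_mono) auto
    then show ?thesis using e B by (intro subsetD[OF e(2)]) (simp add: dist_norm)
  qed
  then have "x \<in> cap \<theta> (e / B)" using e by (auto simp: cap_def subset_iff)
  then have "ennreal (e / B) \<le> min_radial \<theta> x" using e B by (subst min_radial_ge_iff) auto
  then show ?thesis using e B by (meson divide_pos_pos ennreal_less_zero_iff less_le_trans)
qed

text \<open>The layer cake formula for \<open>min_radial\<close> under the restriction
  \<open>N\<close> of \<mu>. It applies because \<open>min_radial\<close> is positive on the
  interior and the frontier is a null set. If the covariogram vanished at all positive arguments,
  \<open>min_radial\<close> would be 0 almost everywhere.\<close>

lemma radial_mean_eq:
  fixes \<theta> :: "(real^'n)^'m"
  assumes \<theta>: "norm \<theta> = 1"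
  shows "profile M (covariogram \<theta>)" and "p \<noteq> 0 \<Longrightarrow> radial_mean \<mu> K \<theta> p = profile_mean M (covariogram \<theta>) p"
    and "\<exists>r>0. 0 < covariogram \<theta> r"
proof -
  interpret finite_measure N by (rule finite_N)
  have fm: "min_radial \<theta> \<in> borel_measurable N"
    using min_radial_measurable[OF \<theta>] by (simp add: N_def)
  have MN: "M = measure N (space N)" using N_space(3) M_props(1) by (simp add: measure_def)
  have AE_pos: "AE x in N. 0 < min_radial \<theta> x \<and> min_radial \<theta> x < \<infinity>"
  proof -
    have "frontier K \<in> null_sets lborel"
      using negligible_convex_frontier[OF K_props(2)]
      by (simp add: negligible_iff_null_sets null_sets_completion_iff)
    then have "AE x in lborel. x \<notin> frontier K" by (rule AE_not_in)
    then have "AE x in lborel. 0 < ennreal (\<phi> x) * indicator K x \<longrightarrow> 0 < min_radial \<theta> x \<and> min_radial \<theta> x < \<infinity>"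
    proof eventually_elim
      case (elim x)
      show ?case
      proof
        assume "0 < ennreal (\<phi> x) * indicator K x"
        then have "x \<in> K" by (cases "x \<in> K") auto
        then have "x \<in> interior K" using elim closure_subset[of K] by (auto simp: frontier_def)
        then show "0 < min_radial \<theta> x \<and> min_radial \<theta> x < \<infinity>"
          using min_radial_pos min_radial_finite[OF \<theta>] by blast
      qed
    qed
    then show ?thesis unfolding N_def by (subst AE_density) auto
  qed
  have g: "measure N {x \<in> space N. ennreal r \<le> min_radial \<theta> x} = covariogram \<theta> r" if "r > 0" for r
  proof -
    have "{x \<in> space N. ennreal r \<le> min_radial \<theta> x} = cap \<theta> r" using that by (auto simp: min_radial_ge_iff N_space)
    moreover have "emeasure N (cap \<theta> r) = emeasure \<mu> (cap \<theta> r)" by (rule emeasure_N) (auto simp: cap_def)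
    ultimately show ?thesis by (simp add: measure_def covariogram_def)
  qed
  note lc = nn_integral_epowr_layer_cake[OF finite_measure_axioms fm AE_pos MN M_props(1)]
  show prof: "profile M (covariogram \<theta>)"
    using lc(1)[of 1] g unfolding profile_def by auto
  show "radial_mean \<mu> K \<theta> p = profile_mean M (covariogram \<theta>) p" if p: "p \<noteq> 0"
  proof -
    have [measurable]: "(\<lambda>x. epowr (min_radial \<theta> x) p) \<in> borel_measurable borel"
    proof -
      have "(\<lambda>a. epowr a p) \<in> borel_measurable borel" unfolding epowr_def by measurable
      then show ?thesis by (rule measurable_compose[OF min_radial_measurable[OF \<theta>]])
    qed
    have "(\<integral>\<^sup>+x\<in>K. epowr (INF i. radial_fun ((\<lambda>y. y - x) ` K) (- (\<theta> $ i))) p \<partial>\<mu>) = (\<integral>\<^sup>+x\<in>K. epowr (min_radial \<theta> x) p \<partial>\<mu>)"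
      by (intro nn_integral_cong) (auto simp: min_radial_def indicator_def)
    also have "\<dots> = (\<integral>\<^sup>+x. epowr (min_radial \<theta> x) p \<partial>N)"
      unfolding N_def \<mu>_eq by (subst (1 2) nn_integral_density) (auto simp: mult_ac)
    finally have "radial_mean \<mu> K \<theta> p = epowr ((\<integral>\<^sup>+x. epowr (min_radial \<theta> x) p \<partial>N) / emeasure N (space N)) (1 / p)"
      by (simp add: radial_mean_def N_space(3) M_props(2))
    also have "\<dots> = epowr (moment_int M (covariogram \<theta>) p) (1 / p)"
    proof -
      have "moment_int M (\<lambda>t. measure N {x \<in> space N. ennreal t \<le> min_radial \<theta> x}) p = moment_int M (covariogram \<theta>) p"
        unfolding moment_int_def using g by (auto intro!: nn_integral_cong simp: indicator_def)
      then show ?thesis using lc(2)[OF p] by simp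
    qed
    finally show ?thesis by (simp add: profile_mean_def)
  qed
  show "\<exists>r>0. 0 < covariogram \<theta> r"
  proof (rule ccontr)
    assume "\<not> ?thesis"
    then have z: "covariogram \<theta> r = 0" if "r > 0" for r
      using that prof by (force simp: profile_def)
    have "AE x in N. \<not> ennreal (1 / real (Suc j)) \<le> min_radial \<theta> x" for j
    proof -
      have "emeasure N (cap \<theta> (1 / real (Suc j))) = emeasure \<mu> (cap \<theta> (1 / real (Suc j)))"
        by (rule emeasure_N) (auto simp: cap_def)
      then have "cap \<theta> (1 / real (Suc j)) \<in> null_sets N"
        using z[of "1 / real (Suc j)"] by (simp add: emeasure_cap null_sets_def N_space(2))
      then show ?thesis by (rule AE_not_in[THEN eventually_mono]) (simp add: min_radial_ge_iff)
    qed
    then have "AE x in N. \<forall>j. \<not> ennreal (1 / real (Suc j)) \<le> min_radial \<theta> x" by (simp add: AE_all_countable)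
    with AE_pos have "AE x in N. False"
    proof eventually_elim
      case (elim x)
      then obtain a where a: "min_radial \<theta> x = ennreal a" "a > 0" by (cases "min_radial \<theta> x" rule: ennreal_cases_pos) auto
      obtain j where "1 / real (Suc j) < a" using nat_approx_posE[OF a(2)] by blast
      then have "ennreal (1 / real (Suc j)) \<le> min_radial \<theta> x" unfolding a(1) by (intro ennreal_leI) simp
      then show False using elim by blast
    qed
    then have "emeasure N (space N) = 0" by (simp add: AE_iff_measurable[where N = "space N"])
    then show False using N_space(3) M_props(1) by simp
  qed
qed

lemma radial_mean_body_eq:
  "radial_mean_body p \<mu> K = star_body (\<lambda>\<theta> :: (real^'n)^'m. extended_mean M (covariogram \<theta>) p)"
proof -
  have "extend_at_0 (radial_mean \<mu> K \<theta>) p = extended_mean M (covariogram \<theta>) p" if "norm \<theta> = 1" for \<theta> :: "(real^'n)^'m"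
    by (rule extend_at_0_cong) (rule radial_mean_eq(2)[OF that])
  then show ?thesis unfolding radial_mean_body_def star_body_def by (auto, metis+)
qed

lemma covariogram_zero:
  fixes \<theta> :: "(real^'n)^'m"
  assumes "norm \<theta> = 1" shows "\<exists>R>0. \<forall>r>R. covariogram \<theta> r = 0"
  using cap_empty[OF assms] by (metis covariogram_def measure_empty)

text \<open>\<open>K\<close> plays the role of the cap at 0, and the combination of the cap at
  \<open>s\<close> with \<open>K\<close> is contained in the cap at \<open>r\<close>.\<close>

lemma covariogram_Q_concave:
  fixes \<theta> :: "(real^'n)^'m"
  assumes "Q_concave_on Q M (compact_convex_subsets K) \<mu>"
    and rs: "0 < r" "r < s" and s: "0 < covariogram \<theta> s"
  shows "Q_inv Q M (r / s * Q (covariogram \<theta> s) + (1 - r / s) * Q M) \<le> covariogram \<theta> r"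
proof -
  have KC: "K \<in> compact_convex_subsets K" using K_props by (simp add: compact_convex_subsets_def)
  have s0: "0 < emeasure \<mu> (cap \<theta> s)" using s by (simp add: emeasure_cap)
  have "Q_inv Q M (r / s * Q (measure \<mu> (cap \<theta> s)) + (1 - r / s) * Q (measure \<mu> K)) \<le>
      measure \<mu> (minkowski_comb (r / s) (cap \<theta> s) K)"
    using assms(1)[unfolded Q_concave_on_def, rule_format, OF cap_compact_convex KC, of "r / s" \<theta> s] rs s0 pos by auto
  also have "\<dots> \<le> measure \<mu> (cap \<theta> r)"
  proof -
    have "minkowski_comb (r / s) (cap \<theta> s) K \<subseteq> cap \<theta> r"
    proof
      fix z assume "z \<in> minkowski_comb (r / s) (cap \<theta> s) K"
      then obtain a b where z: "z = (r / s) *\<^sub>R a + (1 - r / s) *\<^sub>R b" "a \<in> cap \<theta> s" "b \<in> K"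
        by (auto simp: minkowski_comb_def)
      have c: "(r / s) *\<^sub>R a' + (1 - r / s) *\<^sub>R b \<in> K" if "a' \<in> K" for a'
        using rs by (intro convexD[OF K_props(2) that z(3)]) auto
      have zi: "z - r *\<^sub>R (\<theta> $ i) = (r / s) *\<^sub>R (a - s *\<^sub>R (\<theta> $ i)) + (1 - r / s) *\<^sub>R b" for i
        using rs by (simp add: z(1) algebra_simps)
      have "z \<in> K" unfolding z(1) by (rule c) (use z(2) in \<open>simp add: cap_def\<close>)
      moreover have "z - r *\<^sub>R (\<theta> $ i) \<in> K" for i
        unfolding zi by (rule c) (use z(2) in \<open>simp add: cap_def\<close>)
      ultimately show "z \<in> cap \<theta> r" by (simp add: cap_def)
    qed
    moreover have "cap \<theta> r \<in> fmeasurable \<mu>" by (rule fmeasurableI) (auto simp: emeasure_cap)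
    ultimately show ?thesis
    proof (cases "minkowski_comb (r / s) (cap \<theta> s) K \<in> sets \<mu>")
      \<comment> \<open>A set outside the sigma-algebra has measure 0 by convention, so an upper
        bound for its measure is immediate.\<close>
      case False then show ?thesis by (simp add: measure_notin_sets)
    qed (simp add: measure_mono_fmeasurable)
  qed
  finally show ?thesis by (simp add: covariogram_def M_def)
qed

section \<open>The inclusions for a general \<open>Q\<close>\<close>

context
  fixes Q :: "real \<Rightarrow> real"
  assumes Q: "strict_mono_on {0<..M} Q" "continuous_on {0<..M} Q"
    "Q_concave_on Q M (compact_convex_subsets K) \<mu>"
begin

abbreviation \<psi> :: "real \<Rightarrow> real" where "\<psi> t \<equiv> Q_inv Q M (Q M - t)"

lemma \<psi>_profile: "profile M \<psi>"
  by (rule profile_Q_inv[OF Q(1,2) M_props(1)])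

lemma covariogram_dominates:
  fixes \<theta> :: "(real^'n)^'m"
  assumes "norm \<theta> = 1" shows "dominates_from_right \<psi> (covariogram \<theta>)"
  by (rule dominates_from_right_Q_inv[OF Q(1,2) M_props(1) radial_mean_eq(1)[OF assms]])
    (rule covariogram_Q_concave[OF Q(3)])

lemma C_const_\<psi>: "C_const Q p \<mu> K = extended_const M \<psi> p"
  unfolding C_const_eq M_def ..

lemma first_inclusion:
  assumes "p \<le> q"
  shows "dilate (C_const Q q \<mu> K) (radial_mean_body q \<mu> K :: ((real^'n)^'m) set)
    \<subseteq> dilate (C_const Q p \<mu> K) (radial_mean_body p \<mu> K)"
  unfolding radial_mean_body_eq C_const_\<psi>
proof (rule dilate_star_body_mono)
  show "extended_const M \<psi> q \<le> extended_const M \<psi> p"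
    by (rule extended_const_antimono[OF M_props(1) \<psi>_profile assms])
next
  fix \<theta> :: "(real^'n)^'m"
  assume \<theta>: "norm \<theta> = 1"
  obtain R where R: "R > 0" "\<And>r. r > R \<Longrightarrow> covariogram \<theta> r = 0" using covariogram_zero[OF \<theta>] by blast
  show "extended_mean M (covariogram \<theta>) p \<noteq> \<infinity>"
    by (rule profile_mean_extended_finite[OF M_props(1) radial_mean_eq(1)[OF \<theta>] R])
  assume fin: "extended_const M \<psi> p \<noteq> \<infinity>"
  obtain r where r: "r > 0" "0 < covariogram \<theta> r" using radial_mean_eq(3)[OF \<theta>] by blast
  obtain s where s: "s > 0" "0 < \<psi> s" using Q_inv_positive_somewhere[OF Q(1,2) M_props(1)] by blast
  show "extended_const M \<psi> q * extended_mean M (covariogram \<theta>) q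
    \<le> extended_const M \<psi> p * extended_mean M (covariogram \<theta>) p"
    by (rule extended_ratio_antimono[OF M_props(1) radial_mean_eq(1)[OF \<theta>] \<psi>_profile covariogram_dominates[OF \<theta>] R r
        Q_inv_vanishes[OF Q(1,2) M_props(1)] s assms fin])
qed

context
  fixes D :: real
  assumes D: "(Q has_real_derivative D) (at_left M)" "0 < D"
begin

text \<open>The constant decreases in the exponent, so it suffices to bound it at some exponent in
  (-1, 0) not exceeding \<open>p\<close>; there the linear bound for \<open>M - \<psi>\<close>
  applies.\<close>

lemma C_const_finite:
  assumes "- 1 < p" shows "C_const Q p \<mu> K \<noteq> \<infinity>"
proof -
  have neg: "inverse (profile_mean M \<psi> a) \<noteq> \<infinity>" if a: "-1 < a" "a < 0" for a
  proof -
    obtain d where "d > 0" "\<And>t. 0 < t \<Longrightarrow> t \<le> d \<Longrightarrow> M - \<psi> t \<le> (1 / D + 1) * t"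
      using Q_inv_linear_bound[OF Q(1,2) M_props(1) D] by blast
    then have "profile_mean M \<psi> a \<noteq> 0" using profile_mean_neg_finite[OF M_props(1) \<psi>_profile _ _ a] by blast
    then show ?thesis by simp
  qed
  define a where "a = (if p < 0 then p else - 1 / 2)"
  have a: "-1 < a" "a < 0" "a \<le> p" using assms by (auto simp: a_def)
  have "C_const Q p \<mu> K \<le> extended_const M \<psi> a"
    unfolding C_const_\<psi> by (rule extended_const_antimono[OF M_props(1) \<psi>_profile a(3)])
  then show ?thesis using neg[OF a(1,2)] a by (auto simp: extend_at_0_nonzero top_unique)
qed

lemma shell_eq_Diff_cap:
  "shell K (\<lambda>i. s *\<^sub>R (\<theta> $ i)) r = K - cap \<theta> (s * r)"
  by (auto simp: shell_def cap_def mult.commute)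

lemma nn_integral_shell:
  fixes \<theta> :: "(real^'n)^'m"
  shows "(\<integral>\<^sup>+x\<in>shell K (\<lambda>i. s *\<^sub>R (\<theta> $ i)) r. ennreal (\<phi> x) \<partial>lborel) = ennreal (M - covariogram \<theta> (s * r))"
proof -
  have "(\<integral>\<^sup>+x\<in>shell K (\<lambda>i. s *\<^sub>R (\<theta> $ i)) r. ennreal (\<phi> x) \<partial>lborel) = emeasure \<mu> (K - cap \<theta> (s * r))"
    unfolding shell_eq_Diff_cap \<mu>_eq by (subst emeasure_density) auto
  also have "\<dots> = emeasure \<mu> K - emeasure \<mu> (cap \<theta> (s * r))"
    by (intro emeasure_Diff) (auto simp: emeasure_cap, auto simp: cap_def)
  also have "\<dots> = ennreal (M - covariogram \<theta> (s * r))"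
    unfolding emeasure_cap M_props(2) by (rule ennreal_minus) (simp add: covariogram_def)
  finally show ?thesis .
qed

text \<open>Put \<open>s = D * (c * t)\<close>. Support value above 1 at
  \<open>s *\<^sub>R \<theta>\<close> makes the covariogram, rescaled by \<open>s\<close>, decay at
  a rate \<open>c'\<close> above 1. By the slope lemma the covariogram is then below the dilate of
  \<psi> by \<open>l = c * t / c1\<close>, so the constant times the mean is at most
  \<open>l\<close>, which is less than \<open>c * t\<close>.\<close>

lemma proj_support_le_1:
  fixes \<theta> :: "(real^'n)^'m"
  assumes leb: "frontier K \<subseteq> lebesgue_set \<phi>" and p: "- 1 < p" and \<theta>: "norm \<theta> = 1"
    and t: "0 \<le> t" "ennreal t \<le> extended_mean M (covariogram \<theta>) p"
  shows "proj_support \<phi> K ((D * (enn2real (C_const Q p \<mu> K) * t)) *\<^sub>R \<theta>) \<le> 1"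
proof (rule ccontr)
  define c where "c = enn2real (C_const Q p \<mu> K)"
  define s where "s = D * (c * t)"
  have c: "C_const Q p \<mu> K = ennreal c" "0 \<le> c" using C_const_finite[OF p] by (auto simp: c_def less_top)
  assume "\<not> proj_support \<phi> K ((D * (enn2real (C_const Q p \<mu> K) * t)) *\<^sub>R \<theta>) \<le> 1"
  then have big: "1 < proj_support \<phi> K (s *\<^sub>R \<theta>)" by (simp add: s_def c_def not_le)
  have s0: "s \<noteq> 0"
  proof
    assume "s = 0"
    have "proj_support \<phi> K ((0::real) *\<^sub>R \<theta>) = 0" by (simp add: proj_support_def neg_part_def)
    then show False using big \<open>s = 0\<close> by simp
  qed
  then have s: "s > 0" using D(2) c(2) t(1) by (simp add: s_def less_le)
  define g where "g r = covariogram \<theta> (s * r)" for r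
  have "proj_support \<phi> K (s *\<^sub>R \<theta>) \<le> liminf (\<lambda>j. of_nat (Suc j) *
      (\<integral>\<^sup>+x\<in>shell K (\<lambda>i. s *\<^sub>R (\<theta> $ i)) (1 / real (Suc j)). ennreal (\<phi> x) \<partial>lborel))"
    using boundary_integral_le_liminf_shell[OF K_props(1,2,3) \<phi>_measurable \<phi>_nonneg \<phi>_loc leb, of "\<lambda>i. s *\<^sub>R (\<theta> $ i)"]
    by (simp add: proj_support_def)
  also have "\<dots> = liminf (\<lambda>j. ennreal (real (Suc j) * (M - g (1 / real (Suc j)))))"
    unfolding nn_integral_shell g_def
    by (simp add: ennreal_of_nat_eq_real_of_nat ennreal_mult'[symmetric] del: of_nat_Suc)
  finally have "1 < liminf (\<lambda>j. ennreal (real (Suc j) * (M - g (1 / real (Suc j)))))" using big by simp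
  then obtain b where b: "1 < b" "b < liminf (\<lambda>j. ennreal (real (Suc j) * (M - g (1 / real (Suc j)))))"
    using dense by blast
  then have "b \<noteq> \<infinity>" by auto
  then obtain c' where c': "b = ennreal c'" "1 < c'" using b(1)
    by (cases b) (auto simp: ennreal_less_iff ennreal_1[symmetric] simp del: ennreal_1)
  have "\<forall>\<^sub>F j in sequentially. c' \<le> real (Suc j) * (M - g (1 / real (Suc j)))"
    using less_LiminfD[OF b(2)]
  proof eventually_elim
    case (elim j)
    then show ?case using c' by (auto simp: ennreal_less_iff)
  qed
  then have ev: "\<forall>\<^sub>F k in sequentially. c' \<le> real k * (M - g (1 / real k))"
    by (subst (asm) eventually_sequentially_Suc[of "\<lambda>k. c' \<le> real k * (M - g (1 / real k))"])
  have dom: "dominates_from_right \<psi> g"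
    unfolding dominates_from_right_def g_def
  proof (intro allI impI)
    fix l a b' :: real assume *: "l > 0" "a > 0" "a < b'" "\<psi> (b' / l) < covariogram \<theta> (s * b')"
    have "\<psi> ((s * b') / (s * l)) < covariogram \<theta> (s * b')" using * s by simp
    then have "\<psi> ((s * a) / (s * l)) \<le> covariogram \<theta> (s * a)"
      using covariogram_dominates[OF \<theta>, unfolded dominates_from_right_def, rule_format, of "s * l" "s * a" "s * b'"] * s by simp
    then show "\<psi> (a / l) \<le> covariogram \<theta> (s * a)" using s by simp
  qed
  \<comment> \<open>\<open>c1 < c'\<close> leaves room for the slope argument, and
    \<open>1 < c1\<close> yields the final strict inequality.\<close>
  define c1 where "c1 = (1 + c') / 2"
  have c1: "1 < c1" "c1 < c'" "0 < c1" using c' by (auto simp: c1_def)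
  define l where "l = s / (D * c1)"
  have l: "l > 0" using s D c1 by (simp add: l_def)
  have le: "covariogram \<theta> r \<le> \<psi> (r / l)" if r: "r > 0" for r
  proof -
    have "g (r / s) \<le> \<psi> ((r / s) / (1 / (D * c1)))"
      by (rule le_Q_inv_of_slope[OF Q(1,2) M_props(1) D dom c1(3,2) ev]) (use r s in simp)
    then show ?thesis using s by (simp add: g_def l_def)
  qed
  obtain R where R: "R > 0" "\<And>r. r > R \<Longrightarrow> covariogram \<theta> r = 0" using covariogram_zero[OF \<theta>] by blast
  have "ennreal (c * t) \<le> C_const Q p \<mu> K * extended_mean M (covariogram \<theta>) p"
    unfolding c(1) using c(2) t by (simp add: ennreal_mult mult_left_mono)
  also have "\<dots> \<le> ennreal l"
    unfolding C_const_\<psi>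
    by (rule extended_ratio_le[OF M_props(1) radial_mean_eq(1)[OF \<theta>] \<psi>_profile R l le])
      (use C_const_finite[OF p] in \<open>auto simp: C_const_\<psi>\<close>)
  finally have "c * t \<le> l" using l by simp
  moreover have "l < c * t"
  proof -
    have "l = (c * t) / c1" using D by (simp add: l_def s_def)
    moreover have "c * t > 0" using s D by (simp add: s_def zero_less_mult_iff)
    ultimately show ?thesis using c1 mult_strict_left_mono[OF c1(1), of "c * t"] by (simp add: divide_less_eq)
  qed
  ultimately show False by simp
qed

lemma second_inclusion:
  assumes "class_M K \<mu> \<phi>" "- 1 < p"
  shows "dilate (C_const Q p \<mu> K) (radial_mean_body p \<mu> K :: ((real^'n)^'m) set)
    \<subseteq> (\<lambda>x. (1 / D) *\<^sub>R x) ` polar_proj_body \<phi> K"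
proof
  fix x :: "(real^'n)^'m" assume "x \<in> dilate (C_const Q p \<mu> K) (radial_mean_body p \<mu> K)"
  then obtain t \<theta> where x: "x = enn2real (C_const Q p \<mu> K) *\<^sub>R t *\<^sub>R \<theta>" "norm \<theta> = 1" "0 \<le> t"
      "ennreal t \<le> extended_mean M (covariogram \<theta>) p"
    using C_const_finite[OF assms(2)] by (auto simp: dilate_def radial_mean_body_eq star_body_def)
  have "frontier K \<subseteq> lebesgue_set \<phi>" using assms(1) by (simp add: class_M_def)
  from proj_support_le_1[OF this assms(2) x(2-4)]
  have "(D * (enn2real (C_const Q p \<mu> K) * t)) *\<^sub>R \<theta> \<in> polar_proj_body \<phi> K" by (simp add: polar_proj_body_def)
  moreover have "x = (1 / D) *\<^sub>R ((D * (enn2real (C_const Q p \<mu> K) * t)) *\<^sub>R \<theta>)" using D by (simp add: x(1))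
  ultimately show "x \<in> (\<lambda>x. (1 / D) *\<^sub>R x) ` polar_proj_body \<phi> K" by blast
qed

end

end

section \<open>The logarithmic case\<close>

lemma ln_facts:
  "strict_mono_on {0<..M} ln" "continuous_on {0<..M} (ln :: real \<Rightarrow> real)"
  "(ln has_real_derivative 1 / M) (at_left M)" "0 < 1 / M"
proof -
  show "strict_mono_on {0<..M} ln" by (auto simp: strict_mono_on_def)
  show "continuous_on {0<..M} (ln :: real \<Rightarrow> real)" by (intro continuous_intros) auto
  show "(ln has_real_derivative 1 / M) (at_left M)"
    using DERIV_ln_divide[OF M_props(1)] by (rule has_field_derivative_at_within)
qed (use M_props in simp)

text \<open>For \<open>Q = ln\<close> the profile \<psi> is \<open>M * exp (- t)\<close>, whose
  moments are values of \<open>Gamma\<close>. At the exponent 0 the limit is known in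
  \<open>ennreal\<close>; finiteness of the constant carries it over to the reals, where
  \<open>gamma_const\<close> is defined.\<close>

lemma C_const_ln:
  assumes conc: "Q_concave_on ln M (compact_convex_subsets K) \<mu>" and p: "- 1 < p"
  shows "C_const ln p \<mu> K = ennreal (gamma_const p)" and "0 \<le> gamma_const p"
proof -
  note Q = ln_facts(1,2) conc
  have nz: "C_const ln a \<mu> K = ennreal (1 / Gamma (1 + a) powr (1 / a))" if a: "-1 < a" "a \<noteq> 0" for a
  proof -
    have G: "Gamma (1 + a) > 0" using a by (intro Gamma_real_pos) simp
    have "profile_mean M (\<lambda>t. Q_inv ln M (ln M - t)) a = profile_mean M (\<lambda>t. M * exp (- t)) a"
    proof -
      have "Q_inv ln M (ln M - t) = M * exp (- t)" if "t > 0" for t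
        using Q_inv_apply[OF ln_facts(1), of "M * exp (- t)"] M_props(1) that by (simp add: ln_mult)
      then show ?thesis unfolding profile_mean_def moment_int_def
        by (auto intro!: arg_cong2[where f = epowr] nn_integral_cong simp: indicator_def)
    qed
    also have "\<dots> = ennreal (Gamma (1 + a) powr (1 / a))"
      unfolding profile_mean_def moment_int_exp(2)[OF M_props(1) a] by (rule epowr_ennreal[OF G])
    finally have "profile_mean M (\<lambda>t. Q_inv ln M (ln M - t)) a = ennreal (Gamma (1 + a) powr (1 / a))" .
    moreover have "Gamma (1 + a) powr (1 / a) > 0" using G by simp
    ultimately show ?thesis using a by (simp add: C_const_\<psi>[OF Q] extend_at_0_nonzero inverse_ennreal inverse_eq_divide)
  qed
  have "C_const ln p \<mu> K = ennreal (gamma_const p) \<and> 0 \<le> gamma_const p"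
  proof (cases "p = 0")
    case False then show ?thesis using nz[OF p False] by (simp add: gamma_const_def extend_at_0_nonzero)
  next
    case True
    have "((\<lambda>p. inverse (profile_mean M (\<lambda>t. Q_inv ln M (ln M - t)) p)) \<longlongrightarrow> C_const ln 0 \<mu> K) (at_right 0)"
      unfolding C_const_\<psi>[OF Q] using extend_at_0_inverse_profile_mean[OF M_props(1) \<psi>_profile[OF Q]] by simp
    moreover have "\<forall>\<^sub>F a in at_right 0. inverse (profile_mean M (\<lambda>t. Q_inv ln M (ln M - t)) a) = ennreal (1 / Gamma (1 + a) powr (1 / a))"
      using eventually_at_right_less[of "0::real"]
      by eventually_elim (use nz in \<open>simp add: C_const_\<psi>[OF Q] extend_at_0_nonzero\<close>)
    ultimately have lim: "((\<lambda>a. ennreal (1 / Gamma (1 + a) powr (1 / a))) \<longlongrightarrow> C_const ln 0 \<mu> K) (at_right 0)"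
      by (rule Lim_transform_eventually)
    have finC: "C_const ln 0 \<mu> K \<noteq> \<infinity>" by (rule C_const_finite[OF Q ln_facts(3,4)]) simp
    then have "C_const ln 0 \<mu> K = ennreal (enn2real (C_const ln 0 \<mu> K))" by (simp add: less_top)
    then have "((\<lambda>a. enn2real (ennreal (1 / Gamma (1 + a) powr (1 / a)))) \<longlongrightarrow> enn2real (C_const ln 0 \<mu> K)) (at_right 0)"
      using lim by (intro tendsto_enn2real) auto
    then have "((\<lambda>a. 1 / Gamma (1 + a) powr (1 / a)) \<longlongrightarrow> enn2real (C_const ln 0 \<mu> K)) (at_right 0)" by simp
    then have "gamma_const 0 = enn2real (C_const ln 0 \<mu> K)"
      unfolding gamma_const_def by (rule extend_at_0_eq_limit_right)
    then show ?thesis using True finC by (simp add: less_top)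
  qed
  then show "C_const ln p \<mu> K = ennreal (gamma_const p)" "0 \<le> gamma_const p" by auto
qed

lemma dilate_ln:
  assumes "Q_concave_on ln M (compact_convex_subsets K) \<mu>" "- 1 < p"
  shows "dilate (C_const ln p \<mu> K) L = (\<lambda>x. gamma_const p *\<^sub>R x) ` L"
  using C_const_ln[OF assms] by (simp add: dilate_def)

end

theorem theorem4p6:
  fixes K :: "(real^'n) set" and \<mu> :: "(real^'n) measure" and \<phi> :: "real^'n \<Rightarrow> real"
  assumes body: "convex_body K"
    and dens: "has_loc_density \<mu> \<phi>"
    and pos: "0 < emeasure \<mu> K"
    and fin: "emeasure \<mu> K < \<infinity>"
  shows
    "(\<forall>Q. strict_mono_on {0<..measure \<mu> K} Q \<and> continuous_on {0<..measure \<mu> K} Q \<and>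
          Q_concave_on Q (measure \<mu> K) (compact_convex_subsets K) \<mu> \<longrightarrow>
        (\<forall>p q. - 1 < p \<and> p \<le> q \<longrightarrow>
           dilate (C_const Q q \<mu> K) (radial_mean_body q \<mu> K :: ((real^'n)^'m) set)
             \<subseteq> dilate (C_const Q p \<mu> K) (radial_mean_body p \<mu> K)) \<and>
        (\<forall>D. class_M K \<mu> \<phi> \<and> (Q has_real_derivative D) (at_left (measure \<mu> K)) \<and> 0 < D \<longrightarrow>
           (\<forall>p. - 1 < p \<longrightarrow>
              dilate (C_const Q p \<mu> K) (radial_mean_body p \<mu> K :: ((real^'n)^'m) set)
                \<subseteq> (\<lambda>x. (1 / D) *\<^sub>R x) ` polar_proj_body \<phi> K)))
     \<and>
     (Q_concave_on ln (measure \<mu> K) (compact_convex_subsets K) \<mu> \<longrightarrow>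
        (\<forall>p q. - 1 < p \<and> p \<le> q \<longrightarrow>
           (\<lambda>x. gamma_const q *\<^sub>R x) ` (radial_mean_body q \<mu> K :: ((real^'n)^'m) set)
             \<subseteq> (\<lambda>x. gamma_const p *\<^sub>R x) ` radial_mean_body p \<mu> K) \<and>
        (class_M K \<mu> \<phi> \<longrightarrow>
           (\<forall>p. - 1 < p \<longrightarrow>
              (\<lambda>x. gamma_const p *\<^sub>R x) ` (radial_mean_body p \<mu> K :: ((real^'n)^'m) set)
                \<subseteq> (\<lambda>x. measure \<mu> K *\<^sub>R x) ` polar_proj_body \<phi> K)))"
proof -
  interpret body_with_density K \<mu> \<phi> by unfold_locales (fact body dens pos fin)+
  show ?thesis
    unfolding M_def[symmetric]
  proof (intro conjI allI impI)
    fix Q and p q :: real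
    assume Q: "strict_mono_on {0<..M} Q \<and> continuous_on {0<..M} Q \<and> Q_concave_on Q M (compact_convex_subsets K) \<mu>"
    {
      assume "- 1 < p \<and> p \<le> q"
      then show "dilate (C_const Q q \<mu> K) (radial_mean_body q \<mu> K :: ((real^'n)^'m) set)
             \<subseteq> dilate (C_const Q p \<mu> K) (radial_mean_body p \<mu> K)"
        using first_inclusion[of Q p q] Q by blast
    }
    fix D assume "class_M K \<mu> \<phi> \<and> (Q has_real_derivative D) (at_left M) \<and> 0 < D" "- 1 < p"
    then show "dilate (C_const Q p \<mu> K) (radial_mean_body p \<mu> K :: ((real^'n)^'m) set)
                \<subseteq> (\<lambda>x. (1 / D) *\<^sub>R x) ` polar_proj_body \<phi> K"
      using second_inclusion[of Q D p] Q by blast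
  next
    fix p q :: real
    assume conc: "Q_concave_on ln M (compact_convex_subsets K) \<mu>"
    {
      assume pq: "- 1 < p \<and> p \<le> q"
      show "(\<lambda>x. gamma_const q *\<^sub>R x) ` (radial_mean_body q \<mu> K :: ((real^'n)^'m) set)
             \<subseteq> (\<lambda>x. gamma_const p *\<^sub>R x) ` radial_mean_body p \<mu> K"
      proof -
        from pq have "dilate (C_const ln q \<mu> K) (radial_mean_body q \<mu> K :: ((real^'n)^'m) set)
            \<subseteq> dilate (C_const ln p \<mu> K) (radial_mean_body p \<mu> K)"
          using first_inclusion[OF ln_facts(1,2) conc, of p q] by blast
        then show ?thesis using pq by (simp add: dilate_ln[OF conc])
      qed
    }
    assume cl: "class_M K \<mu> \<phi>" "- 1 < p"
    \<comment> \<open>The derivative of \<open>ln\<close> at \<open>M\<close> is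
      \<open>1 / M\<close>, so its reciprocal supplies the factor \<open>M\<close>.\<close>
    have "dilate (C_const ln p \<mu> K) (radial_mean_body p \<mu> K :: ((real^'n)^'m) set)
        \<subseteq> (\<lambda>x. (1 / (1 / M)) *\<^sub>R x) ` polar_proj_body \<phi> K"
      by (rule second_inclusion[OF ln_facts(1,2) conc ln_facts(3,4) cl])
    then show "(\<lambda>x. gamma_const p *\<^sub>R x) ` (radial_mean_body p \<mu> K :: ((real^'n)^'m) set)
                \<subseteq> (\<lambda>x. M *\<^sub>R x) ` polar_proj_body \<phi> K"
      using cl by (simp add: dilate_ln[OF conc])
  qed
qed

end
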